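(* Let $d\ge2$, $1\le k<d$, $D=\operatorname{diag}(1,\dots,1,0,\dots,0)\in\mathbb{R}^{d\times d}$ with $k$ ones, and $C\in\mathbb{R}^{d\times d}$ satisfy condition (A). Let $\psi$ be an admissible generating function, $f_0\in L^1(\mathbb{R}^d)$, $f_0\ge0$, $\int f_0=1$ with $e_\psi(f_0|f_\infty)<\infty$, and let $f(t)$ be the solution of $\partial_tf=\operatorname{div}(D\nabla f+Cxf)$ with initial condition $f_0$. Let $\tau$ be the minimal integer such that $\sum_{j=0}^{\tau}C^jD(C^T)^j\ge\kappa\operatorname{Id}$ for some $\kappa>0$, and let $P$ be a symmetric positive definite matrix with $QP+PQ^T\ge2(\mu-\varepsilon)P$ for some $\varepsilon\in[0,\mu)$. Then there is a constant $c_r>0$ such that $S_\psi(f(t))\le c_r\,t^{-(2\tau+1)}e_\psi(f_0|f_\infty)$ for all $t\in(0,1]$.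
   Context: Condition (A): (a) no non-trivial subspace of $\ker D$ is invariant under $C^T$; (b) all eigenvalues of $C$ have positive real part. $K$ is the symmetric positive definite solution of $2D=CK+KC^T$, $f_\infty(x)=(2\pi)^{-d/2}(\det K)^{-1/2}\exp(-x^TK^{-1}x/2)$, $Q:=KC^TK^{-1}$, $\mu:=\min\{\operatorname{Re}\lambda:\lambda\in\sigma(C)\}$. Admissible generating function: $\psi\not\equiv0$, $\psi\in C([0,\infty))\cap C^4((0,\infty))$, $\psi(1)=\psi'(1)=0$, $\psi''\ge0$, $(\psi''')^2\le\frac12\psi''\psi^{IV}$. $e_\psi(g|f_\infty):=\int\psi(g/f_\infty)f_\infty dx$, $S_\psi(g):=\int_{g/f_\infty>0}\psi''(g/f_\infty)\nabla(g/f_\infty)^TP\nabla(g/f_\infty)f_\infty dx$. *)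

theory Defs
  imports "HOL-Analysis.Analysis"
begin

definition loewner_ge :: "real^'n^'n \<Rightarrow> real^'n^'n \<Rightarrow> bool" where
  "loewner_ge A B \<longleftrightarrow> (\<forall>v::real^'n. v \<bullet> ((A - B) *v v) \<ge> 0)"

definition sym_pos_def :: "real^'n^'n \<Rightarrow> bool" where
  "sym_pos_def A \<longleftrightarrow> transpose A = A \<and> (\<forall>v::real^'n. v \<noteq> 0 \<longrightarrow> v \<bullet> (A *v v) > 0)"

definition diagD :: "nat \<Rightarrow> real^('n::{finite,linorder})^('n::{finite,linorder})" where
  "diagD k = (\<chi> i j. if i = j \<and> card {j'. j' < i} < k then 1 else 0)"

definition cmat :: "real^'n^'n \<Rightarrow> complex^'n^'n" where
  "cmat C = (\<chi> i j. complex_of_real (C $ i $ j))"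

definition is_eigenvalue :: "real^'n^'n \<Rightarrow> complex \<Rightarrow> bool" where
  "is_eigenvalue C l \<longleftrightarrow> (\<exists>v::complex^'n. v \<noteq> 0 \<and> cmat C *v v = l *s v)"

definition condA :: "real^'n^'n \<Rightarrow> real^'n^'n \<Rightarrow> bool" where
  "condA D C \<longleftrightarrow>
     (\<forall>V::(real^'n) set. subspace V \<and> V \<subseteq> {x. D *v x = 0} \<and> (\<lambda>x. transpose C *v x) ` V \<subseteq> V
        \<longrightarrow> V = {0})
   \<and> (\<forall>l. is_eigenvalue C l \<longrightarrow> Re l > 0)"

definition mu_spec :: "real^'n^'n \<Rightarrow> real" where
  "mu_spec C = Inf (Re ` {l. is_eigenvalue C l})"

definition f_inf :: "real^'n^'n \<Rightarrow> real^'n \<Rightarrow> real" where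
  "f_inf K x = (2*pi) powr (- real CARD('n) / 2) * (det K) powr (-1/2)
                * exp (- (x \<bullet> (matrix_inv K *v x)) / 2)"

definition Qmat :: "real^'n^'n \<Rightarrow> real^'n^'n \<Rightarrow> real^'n^'n" where
  "Qmat K C = K ** transpose C ** matrix_inv K"

primrec matpow :: "real^'n^'n \<Rightarrow> nat \<Rightarrow> real^'n^'n" where
  "matpow A 0 = mat 1"
| "matpow A (Suc j) = A ** matpow A j"

definition hc_index :: "real^'n^'n \<Rightarrow> real^'n^'n \<Rightarrow> nat" where
  "hc_index C D = (LEAST tau. \<exists>kappa>0.
      loewner_ge (\<Sum>j\<le>tau. matpow C j ** D ** matpow (transpose C) j) (kappa *\<^sub>R mat 1))"

definition admissible :: "(real \<Rightarrow> real) \<Rightarrow> bool" where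
  "admissible psi \<longleftrightarrow>
     (\<exists>x\<ge>0. psi x \<noteq> 0)
   \<and> continuous_on {0..} psi
   \<and> (\<forall>j<4. \<forall>x>0. ((deriv ^^ j) psi has_real_derivative (deriv ^^ Suc j) psi x) (at x))
   \<and> continuous_on {0<..} ((deriv ^^ 4) psi)
   \<and> psi 1 = 0 \<and> deriv psi 1 = 0
   \<and> (\<forall>x>0. (deriv ^^ 2) psi x \<ge> 0)
   \<and> (\<forall>x>0. ((deriv ^^ 3) psi x)^2 \<le> 1/2 * (deriv ^^ 2) psi x * (deriv ^^ 4) psi x)"

definition pd :: "(real^'n \<Rightarrow> real) \<Rightarrow> 'n \<Rightarrow> real^'n \<Rightarrow> real" where
  "pd h j x = deriv (\<lambda>s. h (x + s *\<^sub>R axis j 1)) 0"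

definition grad :: "(real^'n \<Rightarrow> real) \<Rightarrow> real^'n \<Rightarrow> real^'n" where
  "grad h x = (\<chi> j. pd h j x)"

text \<open>Relative entropy e_psi(g|f_inf) (integrand is nonnegative for admissible psi).\<close>
definition e_psi :: "(real \<Rightarrow> real) \<Rightarrow> (real^'n \<Rightarrow> real) \<Rightarrow> (real^'n \<Rightarrow> real) \<Rightarrow> ennreal" where
  "e_psi psi finf g = (\<integral>\<^sup>+ x. ennreal (psi (g x / finf x) * finf x) \<partial>lborel)"

text \<open>Entropy production functional S_psi(g) (nonnegative integrand).\<close>
definition S_psi :: "(real \<Rightarrow> real) \<Rightarrow> real^'n^'n \<Rightarrow> (real^'n \<Rightarrow> real) \<Rightarrow> (real^'n \<Rightarrow> real) \<Rightarrow> ennreal" where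
  "S_psi psi P finf g = (\<integral>\<^sup>+ x. indicator {y. g y / finf y > 0} x *
      ennreal ((deriv ^^ 2) psi (g x / finf x)
               * (grad (\<lambda>y. g y / finf y) x \<bullet> (P *v grad (\<lambda>y. g y / finf y) x)) * finf x) \<partial>lborel)"

text \<open>Solution of d_t f = div(D grad f + C x f) with initial datum f0:
  a classical solution for t > 0 (continuous time derivative, spatial first derivatives,
  and divergence of the flux), nonnegative with unit mass for every t > 0, attaining the
  initial datum in L^1 as t \<rightarrow> 0+.  In this class of probability solutions the solution is unique.\<close>
definition FP_solution :: "real^'n^'n \<Rightarrow> real^'n^'n \<Rightarrow> (real^'n \<Rightarrow> real) \<Rightarrow> (real \<Rightarrow> real^'n \<Rightarrow> real) \<Rightarrow> bool" where
  "FP_solution D C f0 f \<longleftrightarrow>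
     (\<exists>ft :: real \<Rightarrow> real^'n \<Rightarrow> real. \<exists>gf :: real \<Rightarrow> real^'n \<Rightarrow> real^'n. \<exists>dF :: real \<Rightarrow> real^'n \<Rightarrow> 'n \<Rightarrow> real.
        (\<forall>t>0. \<forall>x. ((\<lambda>s. f s x) has_real_derivative ft t x) (at t))
      \<and> (\<forall>t>0. \<forall>x. \<forall>j. ((\<lambda>h. f t (x + h *\<^sub>R axis j 1)) has_real_derivative gf t x $ j) (at 0))
      \<and> (\<forall>t>0. \<forall>x. \<forall>i. ((\<lambda>h. (D *v gf t (x + h *\<^sub>R axis i 1)
                                 + f t (x + h *\<^sub>R axis i 1) *\<^sub>R (C *v (x + h *\<^sub>R axis i 1))) $ i)
                          has_real_derivative dF t x i) (at 0))
      \<and> (\<forall>t>0. \<forall>x. ft t x = (\<Sum>i\<in>UNIV. dF t x i))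
      \<and> continuous_on ({0<..} \<times> UNIV) (\<lambda>(t,x). f t x)
      \<and> continuous_on ({0<..} \<times> UNIV) (\<lambda>(t,x). ft t x)
      \<and> continuous_on ({0<..} \<times> UNIV) (\<lambda>(t,x). gf t x)
      \<and> (\<forall>i. continuous_on ({0<..} \<times> UNIV) (\<lambda>(t,x). dF t x i)))
   \<and> (\<forall>t>0. \<forall>x. f t x \<ge> 0)
   \<and> (\<forall>t>0. integrable lborel (f t) \<and> (\<integral>x. f t x \<partial>lborel) = 1)
   \<and> ((\<lambda>t. \<integral>x. \<bar>f t x - f0 x\<bar> \<partial>lborel) \<longlongrightarrow> 0) (at_right 0)"

end

theory Submission
  imports Defs "HOL-Probability.Probability"
begin

text \<open>
  Write \<open>E(t) = e\<^sup>-\<^sup>t\<^sup>C\<close> and \<open>W(t) = K - E(t) K E(t)\<^sup>T\<close>. The transition density of the equation is Gaussian with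
  mean \<open>E(t) x\<close> and covariance \<open>W(t)\<close>. Testing the equation against this density in the initial point (it solves
  the backward equation) shows that \<open>h = f/f\<^sub>\<infinity>\<close> satisfies
  \<open>h(t,y) = \<integral> h\<^sub>0(x) k\<^sub>t(y,x) dx\<close> with Gaussian probability densities \<open>k\<^sub>t(y,\<cdot>)\<close> that leave \<open>f\<^sub>\<infinity>\<close> invariant.

  Admissibility gives \<open>\<psi>''(u) \<ge> \<psi>''(m) m/(m+u)\<close>, so \<open>\<psi>\<close> dominates, up to an affine function, a multiple of the
  logarithmic entropy of \<open>u + m\<close>. The entropy (Gibbs) variational principle for Gaussian measures then yields the
  pointwise reverse inequality \<open>\<psi>''(h) (\<partial>\<^sub>v h)\<^sup>2 \<le> 4 (v \<bullet> W(t)\<^sup>-\<^sup>1 v) \<integral> \<psi>(h\<^sub>0(x)) k\<^sub>t(y,x) dx\<close>, which is integrated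
  against \<open>f\<^sub>\<infinity>\<close>. The rate comes from \<open>W(t) \<ge> c t\<^sup>2\<^sup>\<tau>\<^sup>+\<^sup>1\<close>, a quantitative Kalman rank condition.
\<close>

section \<open>Admissible generating functions\<close>

text \<open>A solution in this class has bounded mass but no known moments or spatial decay, while
  the drift grows linearly; every pairing with a test function therefore runs through a cutoff, and
  the representation is proved for each solution rather than imported from a semigroup. The kernel
  \<open>k r y\<close> is the law of the starting point of the equilibrium process given that it
  ends in y. Its covariance does not depend on y and its mean is linear in y, so moving y along v
  multiplies the density by an exponential of a linear function, whose variance is v . R v - v .
  K^-1 v. The derivative of h along v thus becomes a correlation of h_0 with a Gaussian variable,
  which an entropy controls quadratically; optimising the free slope gives the factor 4. The weight
  m/(m+u) comes from admissibility: it makes 1/psi'' concave wherever psi'' > 0, so 1/psi'' grows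
  from m to u at most by the factor max(m,u)/m. Replacing the maximum by m+u loses at most a factor
  2 and gives a weight with an elementary double primitive, essentially (m+u) ln(m+u).\<close>

lemma concave_pos_growth:
  fixes l :: "real \<Rightarrow> real"
  assumes conc: "concave_on {0<..} l" and pos: "\<And>x. x > 0 \<Longrightarrow> l x \<ge> 0" and m: "m > 0" and u: "u > 0"
  shows "l u * m \<le> l m * (m + u)"
proof -
  have key: "l m \<ge> (1 - t) * l a + t * l b" if "a > 0" "b > 0" "0 \<le> t" "t \<le> 1" "m = (1 - t) * a + t * b" for a b t
  proof -
    have "l ((1 - t) *\<^sub>R a + t *\<^sub>R b) \<ge> (1 - t) * l a + t * l b"
      using concave_onD[OF conc, of t a b] that by simp
    then show ?thesis using that by simp
  qed
  consider "u = m" | "u > m" | "u < m" by linarith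
  then show ?thesis
  proof cases
    case 1
    then show ?thesis using pos[OF m] m by (simp add: mult_left_mono)
  next
    case 2
    \<comment> \<open>The half line is open, so the chord through m cannot start at 0. A left end a
      with a * u \<le> m^2 still gives u the weight t \<ge> m / (m + u); the value chosen is such a
      point and lies below m.\<close>
    define a where "a = m^2 / (2*u)"
    have a: "a > 0" "a < m" "a * u \<le> m^2"
      using 2 m by (auto simp: a_def field_simps power2_eq_square)
    define t where "t = (m - a) / (u - a)"
    have t: "0 \<le> t" "t \<le> 1" and tu: "t * (u - a) = m - a" using a 2 by (auto simp: t_def)
    have "l m \<ge> (1 - t) * l a + t * l u"
    proof (rule key)
      show "m = (1 - t) * a + t * u" using tu by (simp add: algebra_simps)
    qed (use a t u in auto)
    moreover have "(1 - t) * l a \<ge> 0" using t pos a by simp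
    ultimately have lt: "l m \<ge> t * l u" by linarith
    have "m \<le> t * (m + u)"
    proof -
      have "m * (u - a) \<le> (m - a) * (m + u)" using a by (simp add: algebra_simps power2_eq_square)
      then show ?thesis using a 2 by (simp add: t_def field_simps)
    qed
    then have "l u * m \<le> l u * (t * (m + u))" using pos[OF u] by (rule mult_left_mono)
    also have "\<dots> = (t * l u) * (m + u)" by simp
    also have "\<dots> \<le> l m * (m + u)" using lt m u by (intro mult_right_mono) auto
    finally show ?thesis .
  next
    case 3
    \<comment> \<open>For u below m the chord is continued to the right. The requirement t * (m + u)
      \<ge> m now reads b * u \<ge> m^2, and b takes the borderline value.\<close>
    define b where "b = m^2 / u"
    have b: "b > m" "b * u = m^2"
      using 3 m u by (auto simp: b_def field_simps power2_eq_square)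
    define t where "t = (b - m) / (b - u)"
    have t: "0 \<le> t" "t \<le> 1" and tu: "t * (b - u) = b - m" using b 3 by (auto simp: t_def)
    have "l m \<ge> (1 - t) * l b + t * l u"
    proof (rule key)
      show "m = (1 - t) * b + t * u" using tu by (simp add: algebra_simps)
    qed (use b t u m in auto)
    moreover have "(1 - t) * l b \<ge> 0" using t pos b m by simp
    ultimately have lt: "l m \<ge> t * l u" by linarith
    have "m \<le> t * (m + u)"
    proof -
      have "m * (b - u) \<le> (b - m) * (m + u)" using b by (simp add: algebra_simps power2_eq_square)
      then show ?thesis using b 3 by (simp add: t_def field_simps)
    qed
    then have "l u * m \<le> l u * (t * (m + u))" using pos[OF u] by (rule mult_left_mono)
    also have "\<dots> = (t * l u) * (m + u)" by simp
    also have "\<dots> \<le> l m * (m + u)" using lt m u by (intro mult_right_mono) auto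
    finally show ?thesis .
  qed
qed

text \<open>Where g > 0 the inequality between g, g1 and g2 says (1/g)'' \<le> 0, so
  \<open>concave_pos_growth\<close> applies to 1/g. It is used with g = psi'', for which this is the
  fourth-order admissibility condition. Zeros of g are handled by passing to g + \<delta> and
  letting \<delta> tend to 0.\<close>

lemma reciprocal_concave_growth:
  fixes g g1 g2 :: "real \<Rightarrow> real"
  assumes d1: "\<And>x. x > 0 \<Longrightarrow> (g has_real_derivative g1 x) (at x)"
    and d2: "\<And>x. x > 0 \<Longrightarrow> (g1 has_real_derivative g2 x) (at x)"
    and cont: "continuous_on {0<..} g2"
    and nn: "\<And>x. x > 0 \<Longrightarrow> g x \<ge> 0"
    and ineq: "\<And>x. x > 0 \<Longrightarrow> 2 * (g1 x)^2 \<le> g x * g2 x"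
    and m: "m > 0" and u: "u > 0"
  shows "g m * m \<le> g u * (m + u)"
proof -
  \<comment> \<open>Adding \<delta> to g preserves the differential inequality once g2 is
    nonnegative. If g2 were negative at x, then g * g2 \<le> 0 near x would force g1 = 0 there,
    hence g2 x = 0.\<close>
  have g2nn: "g2 x \<ge> 0" if x: "x > 0" for x
  proof (rule ccontr)
    assume neg: "\<not> g2 x \<ge> 0"
    have "isCont g2 x" using cont x by (simp add: continuous_on_eq_continuous_at)
    then have "\<forall>\<^sub>F y in nhds x. g2 y < 0"
      using neg by (metis isCont_def not_le_imp_less order_tendstoD(2) tendsto_at_iff_tendsto_nhds)
    moreover have "\<forall>\<^sub>F y in nhds x. y > 0"
      using x by (intro order_tendstoD(1)[OF filterlim_ident])
    ultimately have ev: "\<forall>\<^sub>F y in nhds x. g1 y = 0"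
    proof eventually_elim
      case (elim y)
      have "0 \<le> 2 * (g1 y)^2" by simp
      also have "\<dots> \<le> g y * g2 y" using ineq elim by simp
      finally have "g y * g2 y \<ge> 0" .
      moreover have "g y * g2 y \<le> 0" using nn[of y] elim by (simp add: mult_le_0_iff)
      ultimately have "2 * (g1 y)^2 \<le> 0" using ineq[of y] elim by linarith
      then show ?case by simp
    qed
    have "(g1 has_real_derivative 0) (at x)"
      using DERIV_cong_ev[OF refl ev refl, of 0] by simp
    then have "g2 x = 0" using d2[OF x] DERIV_unique by blast
    then show False using neg by simp
  qed
  have step: "(g m + \<delta>) * m \<le> (g u + \<delta>) * (m + u)" if \<delta>: "\<delta> > 0" for \<delta>
  proof -
    have gp: "g x + \<delta> > 0" if "x > 0" for x using nn[OF that] \<delta> by linarith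
    have "concave_on {0<..} (\<lambda>x. 1 / (g x + \<delta>))"
    proof (rule f''_le0_imp_concave)
      fix x :: real assume "x \<in> {0<..}"
      then have x: "x > 0" by simp
      note [derivative_intros] = d1[OF x] d2[OF x]
      show "((\<lambda>x. 1 / (g x + \<delta>)) has_real_derivative - g1 x / (g x + \<delta>)^2) (at x)"
        using gp[OF x] by (auto intro!: derivative_eq_intros simp: power2_eq_square)
      show "((\<lambda>x. - g1 x / (g x + \<delta>)^2) has_real_derivative
         (2 * (g1 x)^2 - (g x + \<delta>) * g2 x) / (g x + \<delta>)^3) (at x)"
        using gp[OF x] apply (auto intro!: derivative_eq_intros)
        by (simp add: divide_simps) (simp add: algebra_simps power2_eq_square power3_eq_cube power4_eq_xxxx)
      have "(2 * (g1 x)^2 - (g x + \<delta>) * g2 x) \<le> 0"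
      proof -
        have "0 \<le> \<delta> * g2 x" using g2nn[OF x] \<delta> by simp
        then show ?thesis using ineq[OF x] by (simp add: distrib_right)
      qed
      then show "(2 * (g1 x)^2 - (g x + \<delta>) * g2 x) / (g x + \<delta>)^3 \<le> 0"
        using gp[OF x] by (simp add: divide_le_0_iff)
    qed auto
    from concave_pos_growth[OF this _ m u] have "1 / (g u + \<delta>) * m \<le> 1 / (g m + \<delta>) * (m + u)"
      using gp by (simp add: less_imp_le)
    then show ?thesis using gp[OF m] gp[OF u] by (simp add: field_simps)
  qed
  have "((\<lambda>\<delta>. (g u + \<delta>) * (m + u) - (g m + \<delta>) * m) \<longlongrightarrow> (g u + 0) * (m + u) - (g m + 0) * m) (at_right 0)"
    by (intro tendsto_intros)
  moreover have "\<forall>\<^sub>F \<delta> in at_right 0. (g u + \<delta>) * (m + u) - (g m + \<delta>) * m \<ge> 0"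
    using step by (auto simp: eventually_at_right_less intro: eventually_mono[OF eventually_at_right_less])
  ultimately have "(g u + 0) * (m + u) - (g m + 0) * m \<ge> 0"
    by (intro tendsto_lowerbound) auto
  then show ?thesis by simp
qed

lemma convex_tangent_bound:
  fixes F :: "real \<Rightarrow> real"
  assumes d1: "\<And>x. x > 0 \<Longrightarrow> (F has_real_derivative F1 x) (at x)"
    and d2: "\<And>x. x > 0 \<Longrightarrow> (F1 has_real_derivative F2 x) (at x)"
    and nn: "\<And>x. x > 0 \<Longrightarrow> F2 x \<ge> 0"
    and m: "m > 0" "F m = 0" "F1 m = 0" and u: "u > 0"
  shows "F u \<ge> 0"
proof -
  have mono: "F1 x \<le> F1 y" if "0 < x" "x \<le> y" for x y
  proof (rule DERIV_nonneg_imp_nondecreasing[OF that(2)])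
    fix z assume "x \<le> z" "z \<le> y"
    then have "z > 0" using that by linarith
    then show "\<exists>D. (F1 has_real_derivative D) (at z) \<and> 0 \<le> D" using d2 nn by blast
  qed
  show ?thesis
  proof (cases "m \<le> u")
    case True
    have "F m \<le> F u"
    proof (rule DERIV_nonneg_imp_nondecreasing[OF True])
      fix z assume z: "m \<le> z" "z \<le> u"
      then have "F1 z \<ge> 0" using mono[of m z] m by simp
      then show "\<exists>D. (F has_real_derivative D) (at z) \<and> 0 \<le> D" using d1[of z] z m by auto
    qed
    then show ?thesis using m by simp
  next
    case False
    have "F u \<ge> F m"
    proof (rule DERIV_nonpos_imp_nonincreasing[of u m])
      fix z assume z: "u \<le> z" "z \<le> m"
      then have "F1 z \<le> 0" using mono[of z m] m u by simp
      then show "\<exists>D. (F has_real_derivative D) (at z) \<and> D \<le> 0" using d1[of z] z u by auto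
    qed (use False in simp)
    then show ?thesis using m by simp
  qed
qed

lemma admissible_derivs:
  assumes "admissible psi"
  shows "\<And>x. x > 0 \<Longrightarrow> (psi has_real_derivative deriv psi x) (at x)"
    and "\<And>x. x > 0 \<Longrightarrow> (deriv psi has_real_derivative (deriv ^^ 2) psi x) (at x)"
    and "\<And>x. x > 0 \<Longrightarrow> ((deriv ^^ 2) psi has_real_derivative (deriv ^^ 3) psi x) (at x)"
    and "\<And>x. x > 0 \<Longrightarrow> ((deriv ^^ 3) psi has_real_derivative (deriv ^^ 4) psi x) (at x)"
proof -
  have *: "((deriv ^^ j) psi has_real_derivative (deriv ^^ Suc j) psi x) (at x)" if "j < 4" "x > 0" for j x
    using assms that unfolding admissible_def by blast
  show "(psi has_real_derivative deriv psi x) (at x)" if "x > 0" for x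
    using *[of 0 x] that by simp
  show "(deriv psi has_real_derivative (deriv ^^ 2) psi x) (at x)" if "x > 0" for x
    using *[of 1 x] that by (simp add: numeral_2_eq_2)
  show "((deriv ^^ 2) psi has_real_derivative (deriv ^^ 3) psi x) (at x)" if "x > 0" for x
    using *[of 2 x] that by (simp add: eval_nat_numeral)
  show "((deriv ^^ 3) psi has_real_derivative (deriv ^^ 4) psi x) (at x)" if "x > 0" for x
    using *[of 3 x] that by (simp add: eval_nat_numeral)
qed

text \<open>The right-hand side agrees with psi to first order at m, and the logarithmic term has
  second derivative 1 / (m + u), so \<open>reciprocal_concave_growth\<close> is exactly convexity of
  the difference. The normalisation 2 * m is the mean of m + u when u has mean m, which makes this a
  relative entropy after integration. The endpoint u = 0 follows by continuity.\<close>

lemma admissible_entropy_bound: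
  assumes adm: "admissible psi" and m: "m > 0" and u: "u \<ge> 0"
  shows "psi u \<ge> psi m + deriv psi m * (u - m)
    + (deriv ^^ 2) psi m * m * ((m + u) * ln ((m + u) / (2 * m)) - (u - m))"
proof -
  define g where "g = (deriv ^^ 2) psi"
  define F where "F u = psi u - (psi m + deriv psi m * (u - m)
    + g m * m * ((m + u) * ln ((m + u) / (2 * m)) - (u - m)))" for u
  note D = admissible_derivs[OF adm, folded g_def]
  have g_growth: "g m * m \<le> g u * (m + u)" if "u > 0" for u
  proof (rule reciprocal_concave_growth[of g "(deriv ^^ 3) psi" "(deriv ^^ 4) psi"])
    show "2 * ((deriv ^^ 3) psi x)\<^sup>2 \<le> g x * (deriv ^^ 4) psi x" if "x > 0" for x
    proof -
      have "((deriv ^^ 3) psi x)\<^sup>2 \<le> 1 / 2 * g x * (deriv ^^ 4) psi x"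
        using adm that unfolding admissible_def g_def by blast
      then show ?thesis by simp
    qed
    show "(g has_real_derivative (deriv ^^ 3) psi x) (at x)" if "x > 0" for x using D(3) that by blast
    show "((deriv ^^ 3) psi has_real_derivative (deriv ^^ 4) psi x) (at x)" if "x > 0" for x
      using D(4) that by blast
    show "continuous_on {0<..} ((deriv ^^ 4) psi)" "\<And>x. x > 0 \<Longrightarrow> 0 \<le> g x"
      using adm unfolding admissible_def g_def by blast+
  qed (use m that in auto)
  have pos: "F u \<ge> 0" if u: "u > 0" for u
  proof (rule convex_tangent_bound[where F = F and m = m and
        ?F1.0 = "\<lambda>u. deriv psi u - (deriv psi m + g m * m * ln ((m + u) / (2 * m)))" and
        ?F2.0 = "\<lambda>u. g u - g m * m / (m + u)"])
    fix x :: real assume x: "x > 0"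
    note [derivative_intros] = D[OF x]
    have p: "m + x > 0" "(m + x) / (2 * m) > 0" using m x by auto
    have "((\<lambda>u. (m + u) * ln ((m + u) / (2 * m)) - (u - m)) has_real_derivative
        (1 * ln ((m + x) / (2 * m)) + (m + x) * (1 / (m + x))) - 1) (at x)"
      using p m by (auto intro!: derivative_eq_intros)
    then have [derivative_intros]: "((\<lambda>u. (m + u) * ln ((m + u) / (2 * m)) - (u - m)) has_real_derivative
        ln ((m + x) / (2 * m))) (at x)" using p by simp
    show "(F has_real_derivative deriv psi x - (deriv psi m + g m * m * ln ((m + x) / (2 * m)))) (at x)"
      unfolding F_def by (auto intro!: derivative_eq_intros)
    show "((\<lambda>u. deriv psi u - (deriv psi m + g m * m * ln ((m + u) / (2 * m)))) has_real_derivative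
        g x - g m * m / (m + x)) (at x)"
    proof -
      have "((\<lambda>u. ln ((m + u) / (2 * m))) has_real_derivative 1 / (m + x)) (at x)"
        using p m by (auto intro!: derivative_eq_intros)
      note [derivative_intros] = this
      show ?thesis by (auto intro!: derivative_eq_intros)
    qed
    show "0 \<le> g x - g m * m / (m + x)"
      using g_growth[OF x] p by (simp add: field_simps)
  qed (use u m in \<open>auto simp: F_def\<close>)
  have "F u \<ge> 0"
  proof (cases "u = 0")
    case True
    have "continuous_on {0..} F"
      unfolding F_def using adm m
      by (intro continuous_intros) (auto simp: admissible_def)
    then have "(F \<longlongrightarrow> F 0) (at 0 within {0..})" by (simp add: continuous_on)
    then have "(F \<longlongrightarrow> F 0) (at_right 0)" by (rule tendsto_within_subset) auto
    moreover have "\<forall>\<^sub>F x in at_right 0. F x \<ge> 0"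
      by (rule eventually_mono[OF eventually_at_right_less]) (use pos in auto)
    ultimately show ?thesis using True by (auto intro: tendsto_lowerbound)
  next
    case False
    then show ?thesis using pos u by simp
  qed
  then show ?thesis by (simp add: F_def g_def)
qed

text \<open>Pointwise form of the Gibbs variational principle, with equality at T = ln (w / M): an
  arbitrary trial function T gives a lower bound on the entropy, and its integral involves only a
  linear pairing with w and an exponential moment of T.\<close>

lemma entropy_young:
  fixes w M T :: real
  assumes "w > 0" "M > 0"
  shows "w * ln (w / M) \<ge> w * T - M * exp T + w"
proof -
  have "ln (M * exp T / w) \<le> M * exp T / w - 1"
    using assms by (intro ln_le_minus_one) auto
  then have "w * ln (M * exp T / w) \<le> M * exp T - w" using assms by (simp add: field_simps)
  moreover have "ln (M * exp T / w) = T - ln (w / M)" using assms by (simp add: ln_mult ln_div)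
  ultimately show ?thesis by (simp add: algebra_simps)
qed

lemma admissible_nonneg:
  assumes adm: "admissible psi" and u: "u \<ge> 0"
  shows "psi u \<ge> 0"
proof -
  have "(deriv ^^ 2) psi 1 * ((1 + u) * ln ((1 + u) / 2) - (u - 1)) \<ge> 0"
    using entropy_young[of "1 + u" 2 0] adm u by (intro mult_nonneg_nonneg) (auto simp: admissible_def)
  then show ?thesis using admissible_entropy_bound[OF adm, of 1 u] adm u by (auto simp: admissible_def)
qed

lemma admissible_measurable:
  assumes adm: "admissible psi" and u: "u \<in> borel_measurable M" and nn: "\<And>x. u x \<ge> 0"
  shows "(\<lambda>x. psi (u x)) \<in> borel_measurable M"
proof -
  \<comment> \<open>Nothing is known about psi on negative arguments, so it is frozen there at the
    value \<open>psi 0\<close>.\<close>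
  have "continuous_on UNIV (\<lambda>y. psi (max 0 y))"
    by (rule continuous_on_compose2[of "{0..}" psi])
      (use adm in \<open>auto simp: admissible_def intro!: continuous_on_max\<close>)
  then have "(\<lambda>y. psi (max 0 y)) \<in> borel_measurable borel"
    by (rule borel_measurable_continuous_onI)
  from measurable_compose[OF u this] show ?thesis
    using nn by (simp add: max_absorb2)
qed

section \<open>The matrix exponential\<close>

lemma norm_matrix_vector_le:
  fixes A :: "real^'n^'m" and v :: "real^'n"
  shows "norm (A *v v) \<le> norm A * norm v"
proof -
  have "norm (A *v v) = L2_set (\<lambda>i. A $ i \<bullet> v) UNIV"
    by (simp add: norm_vec_def matrix_vector_mul_component L2_set_def)
  also have "\<dots> \<le> L2_set (\<lambda>i. norm (A $ i) * norm v) UNIV"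
    unfolding L2_set_def
    by (intro real_sqrt_le_mono sum_mono power_mono_even) (use Cauchy_Schwarz_ineq2 in auto)
  also have "\<dots> = norm A * norm v"
    by (simp add: norm_vec_def[of A] L2_set_left_distrib)
  finally show ?thesis .
qed

lemma bounded_bilinear_matrix_vector: "bounded_bilinear ((*v) :: real^'n^'m \<Rightarrow> real^'n \<Rightarrow> real^'m)"
proof
  have "\<forall>(a :: real^'n^'m) b. norm (a *v b) \<le> norm a * norm b * 1"
    by (simp add: norm_matrix_vector_le)
  then show "\<exists>K. \<forall>(a :: real^'n^'m) b. norm (a *v b) \<le> norm a * norm b * K" ..
qed (auto simp: matrix_vector_mult_add_rdistrib matrix_vector_right_distrib matrix_vector_mult_scaleR
    scaleR_matrix_vector_assoc)

lemma bounded_bilinear_matrix_matrix: "bounded_bilinear ((**) :: real^'n^'m \<Rightarrow> real^'p^'n \<Rightarrow> real^'p^'m)"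
proof -
  have "bilinear ((**) :: real^'n^'m \<Rightarrow> real^'p^'n \<Rightarrow> real^'p^'m)"
    unfolding bilinear_def
    by (auto intro!: linearI simp: matrix_add_ldistrib matrix_matrix_mult_def vec_eq_iff sum.distrib
        algebra_simps sum_distrib_left)
  then show ?thesis by (simp add: bilinear_conv_bounded_bilinear)
qed

lemma bounded_linear_transpose: "bounded_linear (transpose :: real^'n^'m \<Rightarrow> real^'m^'n)"
  unfolding linear_conv_bounded_linear[symmetric] by (intro linearI) (auto simp: transpose_def vec_eq_iff)

lemmas continuous_on_matrix_vector [continuous_intros] =
  bounded_bilinear.continuous_on[OF bounded_bilinear_matrix_vector]
lemmas continuous_on_matrix_matrix [continuous_intros] =
  bounded_bilinear.continuous_on[OF bounded_bilinear_matrix_matrix]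
lemmas continuous_on_transpose [continuous_intros] =
  bounded_linear.continuous_on[OF bounded_linear_transpose]
lemmas tendsto_matrix_matrix [tendsto_intros] =
  bounded_bilinear.tendsto[OF bounded_bilinear_matrix_matrix]

lemma inner_matrix_left:
  fixes A :: "real^'n^'m"
  shows "(A *v x) \<bullet> y = x \<bullet> (transpose A *v y)"
  by (metis adjoint_matrix adjoint_works inner_commute matrix_vector_mul_linear)

lemma inner_matrix_right:
  fixes A :: "real^'n^'m"
  shows "x \<bullet> (A *v y) = (transpose A *v x) \<bullet> y"
  by (metis inner_matrix_left transpose_transpose)

lemma matpow_Suc_right: "matpow A (Suc j) = matpow A j ** A"
  by (induction j) (simp_all add: matrix_mul_assoc)

lemma transpose_matpow: "transpose (matpow A j) = matpow (transpose A) j"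
proof (induction j)
  case (Suc j)
  have "transpose (matpow A (Suc j)) = transpose (matpow A j ** A)"
    by (simp only: matpow_Suc_right)
  then show ?case using Suc by (simp add: matrix_transpose_mul)
qed simp

lemma matpow_entry_bound:
  fixes A :: "real^'n^'n"
  assumes "c \<ge> 0" and c: "\<And>a b. \<bar>A $ a $ b\<bar> \<le> c"
  shows "\<bar>matpow A j $ a $ b\<bar> \<le> (real CARD('n) * c) ^ j"
proof (induction j arbitrary: a b)
  case 0
  then show ?case by (simp add: mat_def)
next
  case (Suc j)
  have "\<bar>matpow A (Suc j) $ a $ b\<bar> \<le> (\<Sum>k\<in>UNIV. \<bar>A $ a $ k * matpow A j $ k $ b\<bar>)"
    by (simp add: matrix_matrix_mult_def sum_abs)
  also have "\<dots> \<le> (\<Sum>k\<in>(UNIV::'n set). c * (real CARD('n) * c) ^ j)"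
    unfolding abs_mult by (intro sum_mono mult_mono Suc c) (use assms in auto)
  also have "\<dots> = (real CARD('n) * c) ^ Suc j" by simp
  finally show ?case .
qed

text \<open>Defined entry by entry as a real power series, so that differentiation and rearrangement
  reduce to scalar series.\<close>

definition mexp :: "real^'n^'n \<Rightarrow> real \<Rightarrow> real^'n^'n" where
  "mexp A r = (\<chi> a b. \<Sum>j. matpow A j $ a $ b / fact j * r ^ j)"

lemma mexp_summable_abs:
  fixes A :: "real^'n^'n"
  shows "summable (\<lambda>j. \<bar>matpow A j $ a $ b / fact j * r ^ j\<bar>)"
proof -
  define c where "c = norm A"
  have c: "\<bar>A $ a $ b\<bar> \<le> c" for a b
    unfolding c_def using component_le_norm_cart[of "A $ a" b] Finite_Cartesian_Product.norm_nth_le[of A a] by simp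
  define m where "m = real CARD('n) * c * \<bar>r\<bar>"
  have "summable (\<lambda>j. inverse (fact j) * m ^ j)" by (rule summable_exp)
  then show ?thesis
  proof (rule summable_comparison_test[rotated], intro exI allI impI)
    fix j
    have "\<bar>matpow A j $ a $ b\<bar> * \<bar>r\<bar> ^ j \<le> (real CARD('n) * c) ^ j * \<bar>r\<bar> ^ j"
      using matpow_entry_bound[OF _ c, of j a b] by (intro mult_right_mono) (auto simp: c_def)
    then show "norm \<bar>matpow A j $ a $ b / fact j * r ^ j\<bar> \<le> inverse (fact j) * m ^ j"
      by (simp add: abs_mult power_abs m_def power_mult_distrib divide_simps)
  qed
qed

lemma mexp_summable: "summable (\<lambda>j. matpow A j $ a $ b / fact j * r ^ j)"
  by (rule summable_rabs_cancel[OF mexp_summable_abs])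

lemma mexp_0 [simp]: "mexp A 0 = mat 1"
proof -
  have "(\<Sum>j. matpow A j $ a $ b / fact j * 0 ^ j) = mat 1 $ a $ b" for a b
    using powser_zero[of "\<lambda>j. matpow A j $ a $ b / fact j"] by simp
  then show ?thesis by (simp add: mexp_def vec_eq_iff)
qed

lemma has_vector_derivative_matrix_iff:
  fixes F :: "real \<Rightarrow> real^'n^'m"
  assumes "\<And>a b. ((\<lambda>r. F r $ a $ b) has_real_derivative F' $ a $ b) (at r)"
  shows "(F has_vector_derivative F') (at r)"
  unfolding has_vector_derivative_def
proof (subst has_derivative_componentwise_within, rule ballI)
  fix i :: "real^'n^'m" assume "i \<in> Basis"
  then obtain a b where i: "i = axis a (axis b 1)"
    by (auto simp: Basis_vec_def)
  show "((\<lambda>x. F x \<bullet> i) has_derivative (\<lambda>x. x *\<^sub>R F' \<bullet> i)) (at r)"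
    using assms[of a b] by (simp add: i inner_axis has_field_derivative_def mult_commute_abs)
qed

lemma mexp_derivative_entry:
  "((\<lambda>r. mexp A r $ a $ b) has_real_derivative (A ** mexp A r) $ a $ b) (at r)"
proof -
  have "((\<lambda>r. \<Sum>j. matpow A j $ a $ b / fact j * r ^ j) has_real_derivative
     (\<Sum>j. diffs (\<lambda>j. matpow A j $ a $ b / fact j) j * r ^ j)) (at r)"
    by (rule termdiffs_strong_converges_everywhere) (rule mexp_summable)
  also have "(\<lambda>j. diffs (\<lambda>j. matpow A j $ a $ b / fact j) j * r ^ j)
    = (\<lambda>j. \<Sum>k\<in>UNIV. A $ a $ k * (matpow A j $ k $ b / fact j * r ^ j))"
  proof
    fix j
    have "diffs (\<lambda>j. matpow A j $ a $ b / fact j) j = matpow A (Suc j) $ a $ b / fact j"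
      by (simp add: diffs_def divide_simps del: matpow.simps of_nat_Suc)
    then show "diffs (\<lambda>j. matpow A j $ a $ b / fact j) j * r ^ j =
      (\<Sum>k\<in>UNIV. A $ a $ k * (matpow A j $ k $ b / fact j * r ^ j))"
      by (simp add: matrix_matrix_mult_def sum_distrib_right sum_divide_distrib mult.assoc)
  qed
  also have "(\<Sum>j. \<Sum>k\<in>UNIV. A $ a $ k * (matpow A j $ k $ b / fact j * r ^ j))
     = (\<Sum>k\<in>UNIV. \<Sum>j. A $ a $ k * (matpow A j $ k $ b / fact j * r ^ j))"
    by (rule suminf_sum) (rule summable_mult[OF mexp_summable])
  also have "\<dots> = (\<Sum>k\<in>UNIV. A $ a $ k * (\<Sum>j. matpow A j $ k $ b / fact j * r ^ j))"
    by (simp only: suminf_mult[OF mexp_summable])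
  finally show ?thesis by (simp add: mexp_def matrix_matrix_mult_def)
qed

lemma mexp_commute: "A ** mexp A r = mexp A r ** A"
proof -
  have "(\<Sum>k\<in>UNIV. A $ a $ k * (\<Sum>j. matpow A j $ k $ b / fact j * r ^ j)) =
      (\<Sum>k\<in>UNIV. (\<Sum>j. matpow A j $ a $ k / fact j * r ^ j) * A $ k $ b)" for a b
  proof -
    have "(\<Sum>k\<in>UNIV. A $ a $ k * (\<Sum>j. matpow A j $ k $ b / fact j * r ^ j))
      = (\<Sum>k\<in>UNIV. \<Sum>j. A $ a $ k * (matpow A j $ k $ b / fact j * r ^ j))"
      by (simp only: suminf_mult[OF mexp_summable])
    also have "\<dots> = (\<Sum>j. \<Sum>k\<in>UNIV. A $ a $ k * (matpow A j $ k $ b / fact j * r ^ j))"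
      by (rule suminf_sum[symmetric]) (rule summable_mult[OF mexp_summable])
    also have "\<dots> = (\<Sum>j. matpow A (Suc j) $ a $ b / fact j * r ^ j)"
      by (simp add: matrix_matrix_mult_def sum_distrib_right sum_divide_distrib mult.assoc)
    also have "\<dots> = (\<Sum>j. \<Sum>k\<in>UNIV. (matpow A j $ a $ k / fact j * r ^ j) * A $ k $ b)"
      by (simp only: matpow_Suc_right)
        (simp add: matrix_matrix_mult_def sum_distrib_right sum_distrib_left sum_divide_distrib mult_ac)
    also have "\<dots> = (\<Sum>k\<in>UNIV. \<Sum>j. (matpow A j $ a $ k / fact j * r ^ j) * A $ k $ b)"
      by (rule suminf_sum) (rule summable_mult2[OF mexp_summable])
    also have "\<dots> = (\<Sum>k\<in>UNIV. (\<Sum>j. matpow A j $ a $ k / fact j * r ^ j) * A $ k $ b)"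
      by (simp only: suminf_mult2[OF mexp_summable])
    finally show ?thesis .
  qed
  then show ?thesis by (simp add: mexp_def matrix_matrix_mult_def vec_eq_iff)
qed

lemma transpose_mexp: "transpose (mexp A r) = mexp (transpose A) r"
  unfolding mexp_def transpose_matpow[symmetric] by (simp add: transpose_def)

text \<open>For r \<le> 1 every tail power r^(j+n) is at most r^n, so the absolutely convergent tail
  at r = 1 serves as the constant. The constant is uniform in r and v, as is needed when the
  remainder is absorbed in \<open>W_lower\<close>.\<close>

lemma mexp_taylor:
  fixes A :: "real^'n^'n"
  obtains c where "c > 0"
    and "\<And>r v. 0 \<le> r \<Longrightarrow> r \<le> 1 \<Longrightarrow>
      norm (mexp A r *v v - (\<Sum>j<n. (r ^ j / fact j) *\<^sub>R (matpow A j *v v))) \<le> c * r ^ n * norm v"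
proof -
  define s where "s a b = (\<Sum>j. \<bar>matpow A (j + n) $ a $ b / fact (j + n)\<bar>)" for a b
  define c where "c = 1 + (\<Sum>a\<in>UNIV. \<Sum>b\<in>UNIV. s a b)"
  define X where "X r = mexp A r - (\<Sum>j<n. (r ^ j / fact j) *\<^sub>R matpow A j)" for r
  have summ: "summable (\<lambda>j. \<bar>matpow A (j + n) $ a $ b / fact (j + n)\<bar>)" for a b
    using summable_ignore_initial_segment[OF mexp_summable_abs[of A a b 1], of n]
    by (simp only: power_one mult_1_right)
  have s0: "s a b \<ge> 0" for a b unfolding s_def by (intro suminf_nonneg summ) auto
  have entry: "\<bar>X r $ a $ b\<bar> \<le> s a b * r ^ n" if r: "0 \<le> r" "r \<le> 1" for r a b
  proof -
    let ?f = "\<lambda>j. matpow A j $ a $ b / fact j * r ^ j"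
    have "X r $ a $ b = (\<Sum>j. ?f j) - (\<Sum>j<n. ?f j)"
      by (simp add: X_def mexp_def mult_ac)
    also have "\<dots> = (\<Sum>j. ?f (j + n))"
      using suminf_minus_initial_segment[OF mexp_summable[of A a b r], of n] by simp
    finally have X: "X r $ a $ b = (\<Sum>j. ?f (j + n))" .
    have "\<bar>X r $ a $ b\<bar> \<le> (\<Sum>j. \<bar>?f (j + n)\<bar>)"
      unfolding X by (intro summable_rabs summable_ignore_initial_segment mexp_summable_abs)
    also have "\<dots> \<le> (\<Sum>j. \<bar>matpow A (j + n) $ a $ b / fact (j + n)\<bar> * r ^ n)"
    proof (intro suminf_le summable_ignore_initial_segment mexp_summable_abs summable_mult2 summ)
      fix j
      have "r ^ (j + n) \<le> r ^ n" using r by (intro power_decreasing) auto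
      then show "\<bar>?f (j + n)\<bar> \<le> \<bar>matpow A (j + n) $ a $ b / fact (j + n)\<bar> * r ^ n"
        using r by (simp add: abs_mult mult_left_mono divide_right_mono)
    qed (use mexp_summable_abs[of A a b 1] in simp)
    also have "\<dots> = s a b * r ^ n" unfolding s_def by (intro suminf_mult2[symmetric] summ)
    finally show ?thesis .
  qed
  have "norm (X r) \<le> c * r ^ n" if r: "0 \<le> r" "r \<le> 1" for r
  proof -
    have "norm (X r) \<le> (\<Sum>a\<in>UNIV. norm (X r $ a))" unfolding norm_vec_def by (rule L2_set_le_sum) auto
    also have "\<dots> \<le> (\<Sum>a\<in>UNIV. \<Sum>b\<in>UNIV. \<bar>X r $ a $ b\<bar>)" by (intro sum_mono norm_le_l1_cart)
    also have "\<dots> \<le> (\<Sum>a\<in>UNIV. \<Sum>b\<in>UNIV. s a b * r ^ n)" by (intro sum_mono entry r)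
    also have "\<dots> \<le> c * r ^ n" using r by (simp add: c_def distrib_right sum_distrib_right)
    finally show ?thesis .
  qed
  moreover have "mexp A r *v v - (\<Sum>j<n. (r ^ j / fact j) *\<^sub>R (matpow A j *v v)) = X r *v v" for r v
  proof -
    have "(\<Sum>j<n. (r ^ j / fact j) *\<^sub>R matpow A j) *v v = (\<Sum>j<n. (r ^ j / fact j) *\<^sub>R (matpow A j *v v))"
      by (simp only: bounded_bilinear.sum_left[OF bounded_bilinear_matrix_vector]
          bounded_bilinear.scaleR_left[OF bounded_bilinear_matrix_vector])
    then show ?thesis
      by (simp add: X_def matrix_vector_mult_diff_rdistrib)
  qed
  ultimately have "norm (mexp A r *v v - (\<Sum>j<n. (r ^ j / fact j) *\<^sub>R (matpow A j *v v))) \<le> c * r ^ n * norm v"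
    if "0 \<le> r" "r \<le> 1" for r v
    using that order_trans[OF norm_matrix_vector_le[of "X r" v] mult_right_mono[of "norm (X r)" "c * r ^ n" "norm v"]]
    by simp
  moreover have "c > 0" unfolding c_def by (smt (verit) s0 sum_nonneg)
  ultimately show thesis using that by blast
qed

section \<open>Energy of polynomials\<close>

lemma norm_add_square_le: "(norm (a + b))\<^sup>2 \<le> 2 * (norm a)\<^sup>2 + 2 * (norm b)\<^sup>2"
  for a b :: "'a :: real_normed_vector"
proof -
  have "(norm (a + b))\<^sup>2 \<le> (norm a + norm b)\<^sup>2" by (intro power_mono norm_triangle_ineq) auto
  also have "\<dots> \<le> 2 * (norm a)\<^sup>2 + 2 * (norm b)\<^sup>2"
    using zero_le_power2[of "norm a - norm b"] by (simp add: power2_eq_square algebra_simps)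
  finally show ?thesis .
qed

lemma norm_sum_square_le:
  fixes b :: "nat \<Rightarrow> 'a :: real_normed_vector"
  shows "(norm (\<Sum>j<n. b j))\<^sup>2 \<le> real n * (\<Sum>j<n. (norm (b j))\<^sup>2)"
proof -
  have "(norm (\<Sum>j<n. b j))\<^sup>2 \<le> (\<Sum>j<n. 1 * norm (b j))\<^sup>2"
    by (intro power_mono) (auto intro: norm_sum)
  also have "\<dots> \<le> (\<Sum>j<n. 1\<^sup>2) * (\<Sum>j<n. (norm (b j))\<^sup>2)" by (rule Cauchy_Schwarz_ineq_sum)
  finally show ?thesis by simp
qed

text \<open>The map \<open>p \<mapsto> p(r) - 2\<^sup>n p(r/2)\<close> kills the top coefficient and does not shrink the others,
  which drives the induction on the degree.\<close>

lemma polynomial_energy_bound: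
  "\<exists>c>0. \<forall>(a :: nat \<Rightarrow> 'a :: real_normed_vector) F F' t. t > 0 \<longrightarrow>
     (\<forall>r\<in>{0..t}. (F has_real_derivative F' r) (at r) \<and> F' r \<ge> (norm (\<Sum>j<n. r ^ j *\<^sub>R a j))\<^sup>2) \<longrightarrow>
     F t - F 0 \<ge> c * (\<Sum>j<n. t ^ (2 * j + 1) * (norm (a j))\<^sup>2)"
proof (induction n)
  case 0
  have "F t - F 0 \<ge> 0" if "t > 0" "\<forall>r\<in>{0..t}. (F has_real_derivative F' r) (at r) \<and> F' r \<ge> 0"
    for F F' :: "real \<Rightarrow> real" and t
  proof -
    have "F 0 \<le> F t" by (rule DERIV_nonneg_imp_nondecreasing[of 0 t F]) (use that in auto)
    then show ?thesis by simp
  qed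
  then show ?case by (auto intro!: exI[of _ 1])
next
  case (Suc n)
  then obtain c where c: "c > 0" and IH: "\<And>(a :: nat \<Rightarrow> 'a) F F' t. t > 0 \<Longrightarrow>
     (\<And>r. r \<in> {0..t} \<Longrightarrow> (F has_real_derivative F' r) (at r)) \<Longrightarrow>
     (\<And>r. r \<in> {0..t} \<Longrightarrow> F' r \<ge> (norm (\<Sum>j<n. r ^ j *\<^sub>R a j))\<^sup>2) \<Longrightarrow>
     F t - F 0 \<ge> c * (\<Sum>j<n. t ^ (2 * j + 1) * (norm (a j))\<^sup>2)" by blast
  \<comment> \<open>k comes from the induction hypothesis applied to G, whose increment is at most 2
    + 4 * 4^n times that of F. l bounds the top coefficient through H, after the lower ones have
    been bounded with k.\<close>
  define k where "k = (2 + 4 * 4 ^ n) / c"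
  have k: "k > 0" unfolding k_def using c by (intro divide_pos_pos add_pos_pos) auto
  define l where "l = (2 + 2 * real n * k) * real (2 * n + 1)"
  have l: "l > 0" unfolding l_def using k by (intro mult_pos_pos add_pos_nonneg) auto
  have bound: "(k + l) * (F t - F 0) \<ge> (\<Sum>j<Suc n. t ^ (2 * j + 1) * (norm (a j))\<^sup>2)"
    if t: "t > 0" and d: "\<And>r. r \<in> {0..t} \<Longrightarrow> (F has_real_derivative F' r) (at r)"
      and F': "\<And>r. r \<in> {0..t} \<Longrightarrow> F' r \<ge> (norm (\<Sum>j<Suc n. r ^ j *\<^sub>R a j))\<^sup>2"
    for a :: "nat \<Rightarrow> 'a" and F F' :: "real \<Rightarrow> real" and t :: real
  proof -
    let ?p = "\<lambda>r. \<Sum>j<Suc n. r ^ j *\<^sub>R a j"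
    have F'0: "F' r \<ge> 0" if "r \<in> {0..t}" for r using F'[OF that] by (meson order_trans zero_le_power2)
    have mono: "F (t / 2) \<le> F t"
    proof (rule DERIV_nonneg_imp_nondecreasing[of "t / 2" t F])
      fix r assume "t / 2 \<le> r" "r \<le> t"
      then have "r \<in> {0..t}" using t by auto
      then show "\<exists>D. (F has_real_derivative D) (at r) \<and> 0 \<le> D" using d F'0 by blast
    qed (use t in simp)
    define S where "S = (\<Sum>j<n. t ^ (2 * j + 1) * (norm (a j))\<^sup>2)"
    \<comment> \<open>Coefficients of p(r) - 2^n p(r/2). For j < n the factor 2^n / 2^j is at least
      2, hence at distance at least 1 from 1; for j = n it equals 1 and the term disappears.\<close>
    define b where "b j = (1 - 2 ^ n / 2 ^ j) *\<^sub>R a j" for j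
    have b: "norm (b j) \<ge> norm (a j)" if "j < n" for j
    proof -
      have "(2::real) ^ Suc j \<le> 2 ^ n" using that by (intro power_increasing) auto
      then have "(2::real) ^ n / 2 ^ j \<ge> 2" by (simp add: field_simps)
      then have "\<bar>1 - 2 ^ n / 2 ^ j :: real\<bar> \<ge> 1" by linarith
      then show ?thesis unfolding b_def using mult_right_mono[of 1 _ "norm (a j)"] by simp
    qed
    \<comment> \<open>The squared norm of the difference is at most 2 |p(r)|^2 + 2 * 4^n |p(r/2)|^2;
      the inner derivative 1/2 of F (r / 2) accounts for the coefficient 4 * 4^n.\<close>
    define G where "G r = 2 * F r + 4 * 4 ^ n * F (r / 2)" for r
    have "c * (\<Sum>j<n. t ^ (2 * j + 1) * (norm (b j))\<^sup>2) \<le> G t - G 0"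
    proof (rule IH[OF t, of G "\<lambda>r. 2 * F' r + 2 * 4 ^ n * F' (r / 2)"])
      fix r assume r: "r \<in> {0..t}"
      then have r2: "r / 2 \<in> {0..t}" by auto
      have "((\<lambda>r. F (r / 2)) has_real_derivative F' (r / 2) * (1 / 2)) (at r)"
        by (rule DERIV_chain2[where f = F and g = "\<lambda>r. r / 2"]) (auto intro!: derivative_eq_intros d r2)
      note [derivative_intros] = this d[OF r]
      show "(G has_real_derivative 2 * F' r + 2 * 4 ^ n * F' (r / 2)) (at r)"
        unfolding G_def by (auto intro!: derivative_eq_intros)
      have "(\<Sum>j<n. r ^ j *\<^sub>R b j) = (\<Sum>j<Suc n. r ^ j *\<^sub>R b j)" by (simp add: b_def)
      also have "\<dots> = ?p r + (- (2 ^ n)) *\<^sub>R ?p (r / 2)"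
        unfolding scaleR_sum_right sum.distrib[symmetric]
        by (intro sum.cong refl) (simp add: b_def algebra_simps power_divide)
      finally have "(norm (\<Sum>j<n. r ^ j *\<^sub>R b j))\<^sup>2 \<le> 2 * (norm (?p r))\<^sup>2 + 2 * (2 ^ n * norm (?p (r / 2)))\<^sup>2"
        using norm_add_square_le[of "?p r" "(- (2 ^ n)) *\<^sub>R ?p (r / 2)"] by simp
      also have "\<dots> = 2 * (norm (?p r))\<^sup>2 + 2 * (4 ^ n * (norm (?p (r / 2)))\<^sup>2)"
        by (simp add: power_mult_distrib power_mult[symmetric] mult.commute[of n]) (simp add: power_mult)
      also have "\<dots> \<le> 2 * F' r + 2 * (4 ^ n * F' (r / 2))"
        by (intro add_mono mult_left_mono F' r r2) auto
      finally show "(norm (\<Sum>j<n. r ^ j *\<^sub>R b j))\<^sup>2 \<le> 2 * F' r + 2 * 4 ^ n * F' (r / 2)" by simp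
    qed
    moreover have "S \<le> (\<Sum>j<n. t ^ (2 * j + 1) * (norm (b j))\<^sup>2)"
      unfolding S_def using b t by (intro sum_mono mult_left_mono power_mono) auto
    moreover have "G t - G 0 \<le> (2 + 4 * 4 ^ n) * (F t - F 0)"
      using mono by (simp add: G_def algebra_simps)
    ultimately have "c * S \<le> (2 + 4 * 4 ^ n) * (F t - F 0)"
      using c mult_left_mono[of S "\<Sum>j<n. t ^ (2 * j + 1) * (norm (b j))\<^sup>2" c] by linarith
    then have S: "S \<le> k * (F t - F 0)" using c by (simp add: k_def field_simps)
    \<comment> \<open>r^n a_n is p(r) minus the lower terms, whose energy S is already controlled. H
      subtracts the primitive of |r^n a_n|^2 from multiples of the other two energies, so its
      monotonicity is the integrated form of that triangle inequality.\<close>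
    define H where "H r = 2 * F r + 2 * real n * (\<Sum>j<n. r ^ (2 * j + 1) * (norm (a j))\<^sup>2)
       - r ^ (2 * n + 1) / real (2 * n + 1) * (norm (a n))\<^sup>2" for r
    have "H 0 \<le> H t"
    proof (rule DERIV_nonneg_imp_nondecreasing[of 0 t H])
      fix r assume "0 \<le> r" "r \<le> t"
      then have r: "r \<in> {0..t}" by auto
      note [derivative_intros] = d[OF r]
      have D1: "((\<lambda>r. \<Sum>j<n. r ^ (2 * j + 1) * (norm (a j))\<^sup>2) has_real_derivative
         (\<Sum>j<n. real (2 * j + 1) * r ^ (2 * j) * (norm (a j))\<^sup>2)) (at r)"
      proof (intro DERIV_sum DERIV_cmult_right)
        show "((\<lambda>r. r ^ (2 * j + 1)) has_real_derivative real (2 * j + 1) * r ^ (2 * j)) (at r)" for j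
          using DERIV_pow[of "2 * j + 1" r] by simp
      qed
      have D2: "((\<lambda>r. r ^ (2 * n + 1) / real (2 * n + 1)) has_real_derivative r ^ (2 * n)) (at r)"
        by (rule derivative_eq_intros refl | simp del: of_nat_Suc of_nat_add power_Suc)+
      have "(H has_real_derivative 2 * F' r + 2 * real n * (\<Sum>j<n. real (2 * j + 1) * r ^ (2 * j) * (norm (a j))\<^sup>2)
         - r ^ (2 * n) * (norm (a n))\<^sup>2) (at r)"
        unfolding H_def by (intro DERIV_diff DERIV_add DERIV_cmult DERIV_cmult_right d[OF r] D1 D2)
      moreover have "0 \<le> 2 * F' r + 2 * real n * (\<Sum>j<n. real (2 * j + 1) * r ^ (2 * j) * (norm (a j))\<^sup>2)
         - r ^ (2 * n) * (norm (a n))\<^sup>2"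
      proof -
        have "r ^ (2 * n) * (norm (a n))\<^sup>2 = (norm (?p r + (\<Sum>j<n. - (r ^ j *\<^sub>R a j))))\<^sup>2"
          by (simp add: sum_negf power_mult_distrib power_mult[symmetric] mult.commute)
        also have "\<dots> \<le> 2 * (norm (?p r))\<^sup>2 + 2 * (norm (\<Sum>j<n. - (r ^ j *\<^sub>R a j)))\<^sup>2"
          by (rule norm_add_square_le)
        also have "\<dots> \<le> 2 * F' r + 2 * (real n * (\<Sum>j<n. (norm (- (r ^ j *\<^sub>R a j)))\<^sup>2))"
          by (intro add_mono mult_left_mono F' r norm_sum_square_le) auto
        also have "(\<Sum>j<n. (norm (- (r ^ j *\<^sub>R a j)))\<^sup>2) \<le> (\<Sum>j<n. real (2 * j + 1) * r ^ (2 * j) * (norm (a j))\<^sup>2)"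
        proof (intro sum_mono)
          fix j
          have "1 * (r ^ (2 * j) * (norm (a j))\<^sup>2) \<le> real (2 * j + 1) * (r ^ (2 * j) * (norm (a j))\<^sup>2)"
            by (intro mult_right_mono) auto
          then show "(norm (- (r ^ j *\<^sub>R a j)))\<^sup>2 \<le> real (2 * j + 1) * r ^ (2 * j) * (norm (a j))\<^sup>2"
            by (simp add: power_mult_distrib power_mult[symmetric] mult.commute mult.left_commute)
        qed
        finally show ?thesis by (simp add: mult_left_mono)
      qed
      ultimately show "\<exists>D. (H has_real_derivative D) (at r) \<and> 0 \<le> D" by blast
    qed (use t in simp)
    then have "t ^ (2 * n + 1) / real (2 * n + 1) * (norm (a n))\<^sup>2 \<le> 2 * (F t - F 0) + 2 * real n * S"
      by (simp add: H_def S_def)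
    also have "\<dots> \<le> 2 * (F t - F 0) + 2 * real n * (k * (F t - F 0))"
      using S by (intro add_left_mono mult_left_mono) auto
    finally have "t ^ (2 * n + 1) * (norm (a n))\<^sup>2 \<le> l * (F t - F 0)"
      by (simp add: l_def field_simps)
    then show ?thesis using S by (simp add: S_def algebra_simps)
  qed
  show ?case
  proof (intro exI[of _ "1 / (k + l)"] conjI allI impI)
    fix a :: "nat \<Rightarrow> 'a" and F F' :: "real \<Rightarrow> real" and t :: real
    assume "t > 0" and "\<forall>r\<in>{0..t}. (F has_real_derivative F' r) (at r) \<and>
      (norm (\<Sum>j<Suc n. r ^ j *\<^sub>R a j))\<^sup>2 \<le> F' r"
    then have "(\<Sum>j<Suc n. t ^ (2 * j + 1) * (norm (a j))\<^sup>2) \<le> (k + l) * (F t - F 0)"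
      by (intro bound) blast+
    then show "1 / (k + l) * (\<Sum>j<Suc n. t ^ (2 * j + 1) * (norm (a j))\<^sup>2) \<le> F t - F 0"
      using k l by (simp add: divide_le_eq mult.commute del: sum.lessThan_Suc)
  qed (use k l in simp)
qed

section \<open>Positive definite matrices\<close>

lemma norm_matrix_le_op:
  fixes A :: "real^'n^'m"
  assumes "\<And>v. norm (A *v v) \<le> c * norm v"
  shows "norm A \<le> real (CARD('m) * CARD('n)) * c"
proof -
  have entry: "\<bar>A $ i $ j\<bar> \<le> c" for i j
  proof -
    have "A $ i $ j = (A *v axis j 1) $ i" by (simp add: matrix_vector_mult_basis column_def)
    then have "\<bar>A $ i $ j\<bar> \<le> norm (A *v axis j 1)" using component_le_norm_cart by metis
    then show ?thesis using assms[of "axis j 1"] by simp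
  qed
  have "norm A \<le> (\<Sum>a\<in>UNIV. norm (A $ a))" unfolding norm_vec_def by (rule L2_set_le_sum) auto
  also have "\<dots> \<le> (\<Sum>a\<in>UNIV. \<Sum>b\<in>UNIV. \<bar>A $ a $ b\<bar>)" by (intro sum_mono norm_le_l1_cart)
  also have "\<dots> \<le> (\<Sum>a\<in>(UNIV::'m set). \<Sum>b\<in>(UNIV::'n set). c)" by (intro sum_mono entry)
  finally show ?thesis by simp
qed

lemma has_vector_derivative_iff_quotient:
  fixes F :: "real \<Rightarrow> 'a::real_normed_vector"
  shows "(F has_vector_derivative F') (at r) \<longleftrightarrow> ((\<lambda>s. (1 / (s - r)) *\<^sub>R (F s - F r)) \<longlongrightarrow> F') (at r)"
proof -
  have "(F has_vector_derivative F') (at r) \<longleftrightarrow>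
     ((\<lambda>s. norm (F s - F r - (s - r) *\<^sub>R F') / norm (s - r)) \<longlongrightarrow> 0) (at r)"
    unfolding has_vector_derivative_def has_derivative_iff_norm
    by (auto simp: bounded_linear_scaleR_left)
  also have "\<dots> \<longleftrightarrow> ((\<lambda>s. norm ((1 / (s - r)) *\<^sub>R (F s - F r) - F')) \<longlongrightarrow> 0) (at r)"
  proof (intro tendsto_cong, unfold eventually_at, intro exI[of _ 1] conjI ballI impI)
    fix s :: real assume "s \<noteq> r \<and> dist s r < 1"
    then have s: "s \<noteq> r" by simp
    have "(1 / (s - r)) *\<^sub>R (F s - F r) - F' = (1 / (s - r)) *\<^sub>R (F s - F r - (s - r) *\<^sub>R F')"
      using s by (simp add: scaleR_diff_right)
    then show "norm (F s - F r - (s - r) *\<^sub>R F') / norm (s - r) = norm ((1 / (s - r)) *\<^sub>R (F s - F r) - F')"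
      by (simp add: divide_simps)
  qed simp
  also have "\<dots> \<longleftrightarrow> ((\<lambda>s. (1 / (s - r)) *\<^sub>R (F s - F r)) \<longlongrightarrow> F') (at r)"
    by (simp add: tendsto_norm_zero_iff LIM_zero_iff)
  finally show ?thesis .
qed

text \<open>Everything follows from J s - J r = - J s (F s - F r) J r. The local bound on J first
  yields continuity at r; dividing the identity by s - r then gives the derivative.\<close>

lemma has_vector_derivative_matrix_inverse:
  fixes F J :: "real \<Rightarrow> real^'n^'n"
  assumes F: "(F has_vector_derivative F') (at r)"
    and inv: "\<forall>\<^sub>F s in nhds r. F s ** J s = mat 1 \<and> J s ** F s = mat 1"
    and bound: "\<forall>\<^sub>F s in nhds r. norm (J s) \<le> c"
  shows "(J has_vector_derivative - (J r ** F' ** J r)) (at r)" "continuous (at r) J"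
proof -
  have invr: "F r ** J r = mat 1" using eventually_nhds_x_imp_x[OF inv] by simp
  have inv': "\<forall>\<^sub>F s in at r. F s ** J s = mat 1 \<and> J s ** F s = mat 1"
    using inv by (simp add: eventually_at_filter eventually_mono)
  have bound': "\<forall>\<^sub>F s in at r. norm (J s) \<le> c"
    using bound by (simp add: eventually_at_filter eventually_mono)
  have diff: "\<forall>\<^sub>F s in at r. J s - J r = - (J s ** (F s - F r) ** J r)"
    using inv'
  proof eventually_elim
    case (elim s)
    have "J s ** (F s - F r) ** J r = (J s ** F s) ** J r - J s ** (F r ** J r)"
      by (simp add: matrix_mul_assoc bounded_bilinear.diff_left[OF bounded_bilinear_matrix_matrix]
          bounded_bilinear.diff_right[OF bounded_bilinear_matrix_matrix])
    then show ?case using elim invr by simp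
  qed
  obtain B where B: "\<And>(X :: real^'n^'n) (Y :: real^'n^'n). norm (X ** Y) \<le> norm X * norm Y * B" "B > 0"
    using bounded_bilinear.pos_bounded[OF bounded_bilinear_matrix_matrix] by blast
  have Fc: "(F \<longlongrightarrow> F r) (at r)"
    using F has_vector_derivative_continuous isCont_def by (metis continuous_at)
  have "((\<lambda>s. J s - J r) \<longlongrightarrow> 0) (at r)"
  proof (rule Lim_null_comparison)
    show "\<forall>\<^sub>F s in at r. norm (J s - J r) \<le> c * norm (F s - F r) * B * norm (J r) * B"
      using diff bound'
    proof eventually_elim
      case (elim s)
      have "norm (J s - J r) \<le> norm (J s ** (F s - F r)) * norm (J r) * B"
          using elim B(1)[of "J s ** (F s - F r)" "J r"] by simp
      also have "\<dots> \<le> (norm (J s) * norm (F s - F r) * B) * norm (J r) * B"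
        using B by (intro mult_right_mono) auto
      also have "\<dots> \<le> c * norm (F s - F r) * B * norm (J r) * B"
        using B elim by (intro mult_right_mono) auto
      finally show ?case .
    qed
    have "((\<lambda>s. c * norm (F s - F r) * B * norm (J r) * B) \<longlongrightarrow> c * norm (F r - F r) * B * norm (J r) * B) (at r)"
      by (intro tendsto_intros Fc)
    then show "((\<lambda>s. c * norm (F s - F r) * B * norm (J r) * B) \<longlongrightarrow> 0) (at r)" by simp
  qed
  then have Jc: "(J \<longlongrightarrow> J r) (at r)" by (simp add: LIM_zero_iff)
  then show "continuous (at r) J" by (simp add: continuous_at)
  have "((\<lambda>s. - (J s ** ((1 / (s - r)) *\<^sub>R (F s - F r)) ** J r)) \<longlongrightarrow> - (J r ** F' ** J r)) (at r)"
    using F unfolding has_vector_derivative_iff_quotient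
    by (intro tendsto_intros Jc) 
  moreover have "\<forall>\<^sub>F s in at r. - (J s ** ((1 / (s - r)) *\<^sub>R (F s - F r)) ** J r) = (1 / (s - r)) *\<^sub>R (J s - J r)"
    using diff
    by eventually_elim (simp add: bounded_bilinear.scaleR_left[OF bounded_bilinear_matrix_matrix]
        bounded_bilinear.scaleR_right[OF bounded_bilinear_matrix_matrix])
  ultimately show "(J has_vector_derivative - (J r ** F' ** J r)) (at r)"
    unfolding has_vector_derivative_iff_quotient by (rule Lim_transform_eventually)
qed

lemma quadratic_form_le: "v \<bullet> (A *v v) \<le> norm A * (norm v)\<^sup>2" for A :: "real^'n^'n"
proof -
  have "v \<bullet> (A *v v) \<le> norm v * norm (A *v v)" by (rule norm_cauchy_schwarz)
  also have "\<dots> \<le> norm v * (norm A * norm v)" by (intro mult_left_mono norm_matrix_vector_le) auto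
  finally show ?thesis by (simp add: power2_eq_square mult_ac)
qed

lemma quadratic_form_coercive:
  fixes A :: "real^'n^'n"
  assumes "\<And>v. v \<noteq> 0 \<Longrightarrow> v \<bullet> (A *v v) > 0"
  obtains c where "c > 0" "\<And>v. c * (norm v)\<^sup>2 \<le> v \<bullet> (A *v v)"
proof -
  let ?S = "sphere (0 :: real^'n) 1"
  have "continuous_on ?S (\<lambda>v. v \<bullet> (A *v v))" by (intro continuous_intros)
  moreover have "?S \<noteq> {}" using vector_choose_size[of 1] by force
  ultimately obtain u where u: "u \<in> ?S" and min: "\<And>v. v \<in> ?S \<Longrightarrow> u \<bullet> (A *v u) \<le> v \<bullet> (A *v v)"
    using continuous_attains_inf[of ?S "\<lambda>v. v \<bullet> (A *v v)"] by auto
  have "u \<bullet> (A *v u) * (norm v)\<^sup>2 \<le> v \<bullet> (A *v v)" for v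
  proof (cases "v = 0")
    case False
    define w where "w = (1 / norm v) *\<^sub>R v"
    have v: "v = norm v *\<^sub>R w" and w: "w \<in> ?S" using False by (auto simp: w_def)
    have "v \<bullet> (A *v v) = (norm v)\<^sup>2 * (w \<bullet> (A *v w))"
      by (subst (1 2) v) (simp add: matrix_vector_mult_scaleR power2_eq_square)
    then show ?thesis using min[OF w] by (simp add: mult.commute mult_right_mono)
  qed simp
  moreover have "u \<bullet> (A *v u) > 0" using assms[of u] u by force
  ultimately show thesis using that by blast
qed

lemma spd_inverse:
  fixes A :: "real^'n^'n"
  assumes "sym_pos_def A"
  shows "A ** matrix_inv A = mat 1" "matrix_inv A ** A = mat 1"
    "transpose (matrix_inv A) = matrix_inv A"
    "A *v (matrix_inv A *v v) = v" "matrix_inv A *v (A *v v) = v"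
    "v \<bullet> (matrix_inv A *v v) = (matrix_inv A *v v) \<bullet> (A *v (matrix_inv A *v v))"
proof -
  have "v = 0" if "A *v v = 0" for v
    using assms that unfolding sym_pos_def_def by (metis inner_zero_right less_irrefl)
  then have "invertible A"
    by (simp add: invertible_left_inverse matrix_left_invertible_ker)
  then have *: "A ** matrix_inv A = mat 1 \<and> matrix_inv A ** A = mat 1"
    unfolding invertible_def matrix_inv_def by (rule someI_ex)
  then show i: "A ** matrix_inv A = mat 1" "matrix_inv A ** A = mat 1" by auto
  have tA: "transpose A = A" using assms by (simp add: sym_pos_def_def)
  have "transpose (matrix_inv A) = transpose (matrix_inv A) ** (A ** matrix_inv A)" by (simp add: i)
  also have "\<dots> = transpose (A ** matrix_inv A) ** matrix_inv A"
    by (simp add: matrix_mul_assoc matrix_transpose_mul tA)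
  finally show "transpose (matrix_inv A) = matrix_inv A" by (simp add: i)
  show a: "A *v (matrix_inv A *v v) = v" "matrix_inv A *v (A *v v) = v"
    by (simp_all add: matrix_vector_mul_assoc i)
  show "v \<bullet> (matrix_inv A *v v) = (matrix_inv A *v v) \<bullet> (A *v (matrix_inv A *v v))"
    by (simp add: a inner_commute)
qed

lemma spd_inverse_spd:
  assumes "sym_pos_def A" shows "sym_pos_def (matrix_inv A)"
  unfolding sym_pos_def_def
proof (intro conjI allI impI)
  show "transpose (matrix_inv A) = matrix_inv A" using spd_inverse(3)[OF assms] .
  fix v :: "real^'a" assume "v \<noteq> 0"
  then have "matrix_inv A *v v \<noteq> 0" using spd_inverse(4)[OF assms, of v] by force
  then show "v \<bullet> (matrix_inv A *v v) > 0"
    using assms unfolding spd_inverse(6)[OF assms, of v] sym_pos_def_def by blast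
qed

lemma spd_inverse_upper:
  fixes A :: "real^'n^'n"
  assumes A: "sym_pos_def A" and c: "c > 0" "\<And>v. c * (norm v)\<^sup>2 \<le> v \<bullet> (A *v v)"
  shows "c * (norm (matrix_inv A *v v))\<^sup>2 \<le> v \<bullet> (matrix_inv A *v v)"
    and "norm (matrix_inv A *v v) \<le> (1 / c) * norm v"
    and "v \<bullet> (matrix_inv A *v v) \<le> (norm v)\<^sup>2 / c"
proof -
  let ?u = "matrix_inv A *v v"
  show 1: "c * (norm ?u)\<^sup>2 \<le> v \<bullet> ?u" using c(2)[of ?u] spd_inverse(6)[OF A, of v] by simp
  have cs: "v \<bullet> ?u \<le> norm v * norm ?u" by (rule norm_cauchy_schwarz)
  show 2: "norm ?u \<le> (1 / c) * norm v"
  proof (cases "norm ?u = 0")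
    case False
    have "(c * norm ?u) * norm ?u \<le> norm v * norm ?u" using 1 cs by (simp add: power2_eq_square)
    then have "c * norm ?u \<le> norm v" using False by (simp add: mult_le_cancel_right)
    then show ?thesis using c by (simp add: field_simps)
  qed (use c in simp)
  have "norm v * norm ?u \<le> norm v * ((1 / c) * norm v)" using 2 by (intro mult_left_mono) auto
  then show "v \<bullet> ?u \<le> (norm v)\<^sup>2 / c" using cs by (simp add: power2_eq_square)
qed

text \<open>Expand the quadratic form of A at A^-1 v - v / b, which is nonnegative, and bound its
  last term by the hypothesis; this avoids diagonalising A.\<close>

lemma spd_inverse_lower:
  fixes A :: "real^'n^'n"
  assumes A: "sym_pos_def A" and b: "b > 0" "\<And>v. v \<bullet> (A *v v) \<le> b * (norm v)\<^sup>2"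
  shows "(norm v)\<^sup>2 / b \<le> v \<bullet> (matrix_inv A *v v)"
proof -
  let ?u = "matrix_inv A *v v" and ?w = "matrix_inv A *v v - (1 / b) *\<^sub>R v"
  have tA: "transpose A = A" using A by (simp add: sym_pos_def_def)
  have "0 \<le> ?w \<bullet> (A *v ?w)" using A unfolding sym_pos_def_def by (cases "?w = 0") (auto simp: less_imp_le)
  also have "\<dots> = ?u \<bullet> v - (1 / b) * (v \<bullet> v) - (1 / b) * (?u \<bullet> (A *v v)) + (1 / b)\<^sup>2 * (v \<bullet> (A *v v))"
    by (simp add: matrix_vector_mult_diff_distrib matrix_vector_mult_scaleR inner_diff spd_inverse(4)[OF A]
        power2_eq_square algebra_simps)
  also have "?u \<bullet> (A *v v) = v \<bullet> v"
    unfolding inner_matrix_right tA spd_inverse(4)[OF A] ..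
  also have "(1 / b)\<^sup>2 * (v \<bullet> (A *v v)) \<le> (1 / b)\<^sup>2 * (b * (norm v)\<^sup>2)" by (intro mult_left_mono b) auto
  also have "\<dots> = (1 / b) * (v \<bullet> v)" using b unfolding power2_norm_eq_inner by (simp add: power2_eq_square)
  finally show ?thesis by (simp add: inner_commute power2_norm_eq_inner)
qed

section \<open>The covariance of the fundamental solution\<close>

lemmas has_vector_derivative_matrix_matrix =
  bounded_bilinear.has_vector_derivative[OF bounded_bilinear_matrix_matrix]
lemmas has_vector_derivative_matrix_vector =
  bounded_bilinear.has_vector_derivative[OF bounded_bilinear_matrix_vector]
lemmas has_vector_derivative_transpose =
  bounded_linear.has_vector_derivative[OF bounded_linear_transpose]

lemma has_real_derivative_inner:
  assumes "(f has_vector_derivative f') (at r)" "(g has_vector_derivative g') (at r)"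
  shows "((\<lambda>r. f r \<bullet> g r) has_real_derivative f r \<bullet> g' + f' \<bullet> g r) (at r)"
  using bounded_bilinear.has_vector_derivative[OF bounded_bilinear_inner assms]
  by (simp add: has_real_derivative_iff_has_vector_derivative)

lemma mexp_derivative: "(mexp A has_vector_derivative A ** mexp A r) (at r)"
  by (rule has_vector_derivative_matrix_iff) (rule mexp_derivative_entry)

lemma matpow_minus: "matpow (- A) j = (- 1) ^ j *\<^sub>R matpow A j"
proof (induction j)
  case (Suc j)
  have "(- A) ** (c *\<^sub>R X) = (- c) *\<^sub>R (A ** X)" for c and X :: "real^'a^'a"
    by (simp add: bounded_bilinear.minus_left[OF bounded_bilinear_matrix_matrix]
        bounded_bilinear.scaleR_right[OF bounded_bilinear_matrix_matrix])
  then show ?case using Suc by simp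
qed simp

text \<open>\<open>D\<close> is a diagonal of zeros and ones, hence an orthogonal projection, so
  that v . D v can be written as a squared norm. \<open>hypo\<close> is the quantitative rank
  condition in that form; the bound \<open>Suc tau\<close> is exclusive, so j runs from 0 to
  \<open>tau\<close>.\<close>

locale fokker_planck =
  fixes C K D :: "real^'n^'n" and d :: "'n \<Rightarrow> real" and tau :: nat and kappa :: real
  assumes D_diag: "D $ i $ j = (if i = j then d i else 0)"
    and d01: "d i = 0 \<or> d i = 1"
    and K_spd: "sym_pos_def K"
    and K_eq: "2 *\<^sub>R D = C ** K + K ** transpose C"
    and kappa: "kappa > 0"
    and hypo: "kappa * (norm v)\<^sup>2 \<le> (\<Sum>j<Suc tau. (norm (D *v (matpow (transpose C) j *v v)))\<^sup>2)"
begin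

definition E :: "real \<Rightarrow> real^'n^'n" where "E r = mexp (- C) r"
definition W :: "real \<Rightarrow> real^'n^'n" where "W r = K - E r ** K ** transpose (E r)"
definition R :: "real \<Rightarrow> real^'n^'n" where "R r = matrix_inv (W r)"

lemma D_component: "(D *v w) $ i = d i * w $ i"
  by (simp add: matrix_vector_mult_def D_diag if_distrib if_distribR cong: if_cong)

lemma D_inner: "v \<bullet> (D *v w) = (\<Sum>i\<in>UNIV. d i * v $ i * w $ i)"
  by (simp add: inner_vec_def D_component mult_ac)

lemma d_sq: "d i * d i = d i" using d01[of i] by auto

lemma D_norm: "(norm (D *v w))\<^sup>2 = w \<bullet> (D *v w)"
proof -
  have "(norm (D *v w))\<^sup>2 = (\<Sum>i\<in>UNIV. (d i * d i) * w $ i * w $ i)"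
    unfolding power2_norm_eq_inner by (simp add: inner_vec_def D_component mult_ac)
  then show ?thesis by (simp add: D_inner d_sq)
qed

lemma K_sym: "transpose K = K" using K_spd by (simp add: sym_pos_def_def)

lemma E_0 [simp]: "E 0 = mat 1" by (simp add: E_def)

lemma E_derivative: "(E has_vector_derivative - (E r ** C)) (at r)"
proof -
  have "(- C) ** mexp (- C) r = - (mexp (- C) r ** C)"
    unfolding mexp_commute by (simp add: bounded_bilinear.minus_right[OF bounded_bilinear_matrix_matrix])
  then show ?thesis using mexp_derivative[of "- C" r] by (simp add: E_def[abs_def])
qed

lemma continuous_on_E [continuous_intros]: "continuous_on S E"
  by (meson E_derivative continuous_at_imp_continuous_on has_vector_derivative_continuous)

lemma W_0 [simp]: "W 0 = 0" by (simp add: W_def)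

lemma W_sym: "transpose (W r) = W r"
proof -
  have "transpose (X - Y) = transpose X - transpose Y" for X Y :: "real^'n^'n"
    by (simp add: transpose_def vec_eq_iff)
  then show ?thesis by (simp add: W_def matrix_transpose_mul K_sym matrix_mul_assoc)
qed

text \<open>Differentiating E K E^T produces E (C K + K C^T) E^T, which the Lyapunov equation turns
  into 2 E D E^T. Together with W 0 = 0 this identifies W as the covariance integral, without any
  matrix-valued integration.\<close>

lemma W_derivative: "(W has_vector_derivative 2 *\<^sub>R (E r ** D ** transpose (E r))) (at r)"
proof -
  note bb = bounded_bilinear_matrix_matrix
  have "(W has_vector_derivative 0 - ((E r ** K) ** transpose (- (E r ** C))
      + (E r ** 0 + - (E r ** C) ** K) ** transpose (E r))) (at r)"
    unfolding W_def[abs_def]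
    by (intro has_vector_derivative_diff has_vector_derivative_const has_vector_derivative_matrix_matrix
        has_vector_derivative_transpose E_derivative)
  also have "0 - ((E r ** K) ** transpose (- (E r ** C)) + (E r ** 0 + - (E r ** C) ** K) ** transpose (E r))
    = E r ** (C ** K + K ** transpose C) ** transpose (E r)"
  proof -
    have t: "transpose (- (E r ** C)) = - (transpose C ** transpose (E r))"
      by (simp add: matrix_transpose_mul[symmetric]) (simp add: transpose_def vec_eq_iff)
    show ?thesis unfolding t
      by (simp add: bounded_bilinear.minus_left[OF bb] bounded_bilinear.minus_right[OF bb]
          bounded_bilinear.add_left[OF bb] bounded_bilinear.add_right[OF bb] bounded_bilinear.zero_right[OF bb]
          matrix_mul_assoc)
  qed
  also have "\<dots> = 2 *\<^sub>R (E r ** D ** transpose (E r))"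
    unfolding K_eq[symmetric]
    by (simp add: bounded_bilinear.scaleR_left[OF bb] bounded_bilinear.scaleR_right[OF bb])
  finally show ?thesis .
qed

lemma W_form_derivative:
  "((\<lambda>r. v \<bullet> (W r *v v)) has_real_derivative 2 * (norm (D *v (transpose (E r) *v v)))\<^sup>2) (at r)"
proof -
  have "((\<lambda>r. v \<bullet> (W r *v v)) has_real_derivative
      v \<bullet> (W r *v 0 + (2 *\<^sub>R (E r ** D ** transpose (E r))) *v v) + 0 \<bullet> (W r *v v)) (at r)"
    by (intro has_real_derivative_inner has_vector_derivative_matrix_vector W_derivative
        has_vector_derivative_const)
  also have "v \<bullet> (W r *v 0 + (2 *\<^sub>R (E r ** D ** transpose (E r))) *v v) + 0 \<bullet> (W r *v v)
     = 2 * (v \<bullet> (E r *v (D *v (transpose (E r) *v v))))"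
    by (simp add: bounded_bilinear.scaleR_left[OF bounded_bilinear_matrix_vector] matrix_vector_mul_assoc matrix_mul_assoc
        del: transpose_matrix_vector)
  also have "\<dots> = 2 * (norm (D *v (transpose (E r) *v v)))\<^sup>2"
    by (simp add: D_norm inner_matrix_right del: transpose_matrix_vector)
  finally show ?thesis .
qed

lemma W_form_mono: "r \<le> s \<Longrightarrow> v \<bullet> (W r *v v) \<le> v \<bullet> (W s *v v)"
  by (rule DERIV_nonneg_imp_nondecreasing[of r s "\<lambda>r. v \<bullet> (W r *v v)"])
    (auto intro!: exI[of _ "2 * (norm (D *v (transpose (E _) *v v)))\<^sup>2"] W_form_derivative
      simp del: transpose_matrix_vector)

text \<open>By \<open>W_form_derivative\<close> the form grows at the rate 2 |D E^T v|^2. Up to a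
  Taylor remainder, D E^T v is a polynomial in r with coefficients D (-C^T)^j v / j!, so
  \<open>polynomial_energy_bound\<close> and \<open>hypo\<close> give the order 2 tau + 1. The
  remainder is absorbed for small t only; monotonicity of W carries the bound on to t = 1.\<close>

lemma W_lower:
  obtains c where "c > 0" "\<And>t v. 0 < t \<Longrightarrow> t \<le> 1 \<Longrightarrow> c * t ^ (2 * tau + 1) * (norm v)\<^sup>2 \<le> v \<bullet> (W t *v v)"
proof -
  let ?A = "- transpose C"
  define n where "n = Suc tau"
  have Et: "transpose (E r) = mexp ?A r" for r
  proof -
    have "transpose (- C) = ?A" by (simp add: transpose_def vec_eq_iff)
    then show ?thesis by (simp add: E_def transpose_mexp)
  qed
  obtain b where b: "b > 0" and taylor: "\<And>r v. 0 \<le> r \<Longrightarrow> r \<le> 1 \<Longrightarrow>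
      norm (mexp ?A r *v v - (\<Sum>j<n. (r ^ j / fact j) *\<^sub>R (matpow ?A j *v v))) \<le> b * r ^ n * norm v"
    using mexp_taylor[of ?A n] by blast
  obtain c where c: "c > 0" and poly: "\<And>(a :: nat \<Rightarrow> real^'n) F F' t. t > 0 \<Longrightarrow>
     (\<forall>r\<in>{0..t}. (F has_real_derivative F' r) (at r) \<and> F' r \<ge> (norm (\<Sum>j<n. r ^ j *\<^sub>R a j))\<^sup>2) \<Longrightarrow>
     F t - F 0 \<ge> c * (\<Sum>j<n. t ^ (2 * j + 1) * (norm (a j))\<^sup>2)"
    using polynomial_energy_bound[where ?'a = "real^'n" and n = n] by blast
  define L where "L = 1 + norm D"
  have L: "L > 0" "\<And>w. norm (D *v w) \<le> L * norm w"
  proof -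
    show "L > 0" unfolding L_def by (smt (verit) norm_ge_zero)
    show "norm (D *v w) \<le> L * norm w" for w
      using norm_matrix_vector_le[of D w] unfolding L_def by (simp add: distrib_right add_increasing)
  qed
  \<comment> \<open>e is the squared bound of the remainder with the factor 2 of
    \<open>norm_add_square_le\<close>. k collects the constant of the polynomial estimate,
    \<open>kappa\<close>, and 1 / (n!)^2 as a common lower bound for the weights 1 / (j!)^2.\<close>
  define e where "e = 2 * (L * b)\<^sup>2"
  define k where "k = c * kappa / (fact n)\<^sup>2"
  have e: "e > 0" and k: "k > 0" unfolding e_def k_def using L b c kappa by auto
  have main: "k * t ^ (2 * tau + 1) * (norm v)\<^sup>2 \<le> v \<bullet> (W t *v v) + e * t ^ (2 * tau + 3) * (norm v)\<^sup>2"
    if t: "0 < t" "t \<le> 1" for t v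
  proof -
    define a where "a j = (1 / fact j) *\<^sub>R (D *v (matpow ?A j *v v))" for j
    \<comment> \<open>The second term is the primitive of the remainder energy, so that F' dominates
      the square of the Taylor polynomial itself. As n = tau + 1, its order is t^(2 tau + 3), two
      powers better than the main term.\<close>
    define F where "F r = v \<bullet> (W r *v v) + e * (norm v)\<^sup>2 * (r ^ (2 * n + 1) / real (2 * n + 1))" for r
    have "c * (\<Sum>j<n. t ^ (2 * j + 1) * (norm (a j))\<^sup>2) \<le> F t - F 0"
    proof (rule poly[OF t(1)], intro ballI conjI)
      fix r assume "r \<in> {0..t}"
      then have r: "0 \<le> r" "r \<le> 1" using t by auto
      have "((\<lambda>r. r ^ (2 * n + 1) / real (2 * n + 1)) has_real_derivative
          real (2 * n + 1) * r ^ (2 * n) / real (2 * n + 1)) (at r)"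
        using DERIV_pow[of "2 * n + 1" r] by (intro DERIV_cdivide) simp
      then have "((\<lambda>r. r ^ (2 * n + 1) / real (2 * n + 1)) has_real_derivative r ^ (2 * n)) (at r)" by simp
      then show "(F has_real_derivative 2 * (norm (D *v (transpose (E r) *v v)))\<^sup>2 + e * (norm v)\<^sup>2 * r ^ (2 * n)) (at r)"
        unfolding F_def by (intro DERIV_add W_form_derivative DERIV_cmult)
      define rem where "rem = mexp ?A r *v v - (\<Sum>j<n. (r ^ j / fact j) *\<^sub>R (matpow ?A j *v v))"
      have sum: "(\<Sum>j<n. r ^ j *\<^sub>R a j) = D *v (transpose (E r) *v v) + - (D *v rem)"
        unfolding rem_def Et
        by (simp add: a_def matrix_vector_mult_diff_distrib matrix_vector_mult_scaleR
            linear_sum[OF matrix_vector_mul_linear])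
      have "(norm (\<Sum>j<n. r ^ j *\<^sub>R a j))\<^sup>2 \<le> 2 * (norm (D *v (transpose (E r) *v v)))\<^sup>2 + 2 * (norm (D *v rem))\<^sup>2"
        unfolding sum using norm_add_square_le[of "D *v (transpose (E r) *v v)" "- (D *v rem)"] by simp
      also have "norm (D *v rem) \<le> L * (b * r ^ n * norm v)"
        using L(2)[of rem] taylor[OF r, of v] L(1) unfolding rem_def
        by (meson less_imp_le mult_left_mono order_trans)
      then have "2 * (norm (D *v rem))\<^sup>2 \<le> 2 * (L * (b * r ^ n * norm v))\<^sup>2"
        by (intro mult_left_mono power_mono) auto
      also have "\<dots> = e * (norm v)\<^sup>2 * r ^ (2 * n)"
        by (simp add: e_def power_mult_distrib power_mult[symmetric] mult_ac)
      finally show "(norm (\<Sum>j<n. r ^ j *\<^sub>R a j))\<^sup>2 \<le> 2 * (norm (D *v (transpose (E r) *v v)))\<^sup>2 + e * (norm v)\<^sup>2 * r ^ (2 * n)"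
        by simp
    qed
    also have "F t - F 0 \<le> v \<bullet> (W t *v v) + e * t ^ (2 * tau + 3) * (norm v)\<^sup>2"
    proof -
      have "t ^ (2 * n + 1) / real (2 * n + 1) \<le> t ^ (2 * n + 1)"
        using t mult_left_mono[of 1 "real (2 * n + 1)" "t ^ (2 * n + 1)"]
        by (simp add: pos_divide_le_eq del: power_Suc of_nat_add of_nat_Suc)
      then have "e * (norm v)\<^sup>2 * (t ^ (2 * n + 1) / real (2 * n + 1)) \<le> e * (norm v)\<^sup>2 * t ^ (2 * n + 1)"
        using e by (intro mult_left_mono) auto
      moreover have "t ^ (2 * n + 1) = t ^ (2 * tau + 3)" by (rule arg_cong) (simp add: n_def)
      moreover have "F t - F 0 = v \<bullet> (W t *v v) + e * (norm v)\<^sup>2 * (t ^ (2 * n + 1) / real (2 * n + 1))"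
        by (simp add: F_def)
      ultimately show ?thesis by (simp only: mult_ac)
    qed
    also have "k * t ^ (2 * tau + 1) * (norm v)\<^sup>2 \<le> c * (\<Sum>j<n. t ^ (2 * j + 1) * (norm (a j))\<^sup>2)"
    proof -
      have "k * t ^ (2 * tau + 1) * (norm v)\<^sup>2 = c * (t ^ (2 * tau + 1) * (1 / (fact n)\<^sup>2) * (kappa * (norm v)\<^sup>2))"
        by (simp add: k_def)
      also have "\<dots> \<le> c * (t ^ (2 * tau + 1) * (1 / (fact n)\<^sup>2) * (\<Sum>j<n. (norm (D *v (matpow (transpose C) j *v v)))\<^sup>2))"
        unfolding n_def using c t hypo[of v] by (intro mult_left_mono) auto
      also have "\<dots> = c * (\<Sum>j<n. t ^ (2 * tau + 1) * ((1 / (fact n)\<^sup>2) * (norm (D *v (matpow (transpose C) j *v v)))\<^sup>2))"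
        by (simp only: sum_distrib_left mult.assoc)
      also have "\<dots> \<le> c * (\<Sum>j<n. t ^ (2 * j + 1) * (norm (a j))\<^sup>2)"
      proof (intro mult_left_mono sum_mono mult_mono)
        fix j assume j: "j \<in> {..<n}"
        show "t ^ (2 * tau + 1) \<le> t ^ (2 * j + 1)"
          using j t by (intro power_decreasing) (auto simp: n_def)
        have "norm (a j) = 1 / fact j * norm (D *v (matpow (transpose C) j *v v))"
          by (simp add: a_def matpow_minus bounded_bilinear.scaleR_left[OF bounded_bilinear_matrix_vector]
              matrix_vector_mult_scaleR power_abs)
        then have "(norm (a j))\<^sup>2 = 1 / (fact j)\<^sup>2 * (norm (D *v (matpow (transpose C) j *v v)))\<^sup>2"
          by (simp add: power_mult_distrib power_divide)
        moreover have "1 / (fact n)\<^sup>2 \<le> 1 / (fact j :: real)\<^sup>2"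
          using j by (intro divide_left_mono power_mono fact_mono) auto
        ultimately show "1 / (fact n)\<^sup>2 * (norm (D *v (matpow (transpose C) j *v v)))\<^sup>2 \<le> (norm (a j))\<^sup>2"
          by (simp only: mult_right_mono zero_le_power2)
      qed (use c t in auto)
      finally show ?thesis .
    qed
    finally show ?thesis .
  qed
  \<comment> \<open>Below t0 one has e * t^2 \<le> k / 2, so the remainder takes away at most half
    of the main term.\<close>
  define t0 where "t0 = min 1 (sqrt (k / (2 * e)))"
  have t0: "0 < t0" "t0 \<le> 1" "t0\<^sup>2 \<le> k / (2 * e)"
  proof -
    show "0 < t0" "t0 \<le> 1" using e k by (auto simp: t0_def)
    then have "t0\<^sup>2 \<le> (sqrt (k / (2 * e)))\<^sup>2" by (intro power_mono) (auto simp: t0_def)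
    then show "t0\<^sup>2 \<le> k / (2 * e)" using e k by simp
  qed
  have small: "k / 2 * t ^ (2 * tau + 1) * (norm v)\<^sup>2 \<le> v \<bullet> (W t *v v)" if t: "0 < t" "t \<le> t0" for t v
  proof -
    have "t\<^sup>2 \<le> t0\<^sup>2" using t by (intro power_mono) auto
    then have "t\<^sup>2 \<le> k / (2 * e)" using t0 by linarith
    then have "e * t\<^sup>2 \<le> k / 2" using e by (simp add: field_simps)
    define X where "X = t ^ (2 * tau + 1) * (norm v)\<^sup>2"
    have "X \<ge> 0" using t by (simp add: X_def)
    then have "(e * t\<^sup>2) * X \<le> k / 2 * X" using \<open>e * t\<^sup>2 \<le> k / 2\<close> by (rule mult_right_mono[rotated])
    moreover have "e * t ^ (2 * tau + 3) * (norm v)\<^sup>2 = (e * t\<^sup>2) * X"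
    proof -
      have "t ^ (2 * tau + 3) = t\<^sup>2 * t ^ (2 * tau + 1)"
        unfolding power_add[symmetric] by (rule arg_cong) simp
      then show ?thesis by (simp only: X_def mult_ac)
    qed
    moreover have "k * X \<le> v \<bullet> (W t *v v) + e * t ^ (2 * tau + 3) * (norm v)\<^sup>2"
      using main[of t v] t t0 by (simp only: X_def mult.assoc)
    moreover have "k / 2 * X = k * X / 2" by simp
    ultimately have "k / 2 * X \<le> v \<bullet> (W t *v v)" by linarith
    then show ?thesis by (simp only: X_def mult.assoc)
  qed
  \<comment> \<open>Between t0 and 1 the form is at least its value at t0, while t^(2 tau + 1) \<le>
    1; hence the constant reached at t0 works on the whole interval.\<close>
  define c' where "c' = k / 2 * t0 ^ (2 * tau + 1)"
  show thesis
  proof (rule that[of c'])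
    show "c' > 0" using k t0 by (simp add: c'_def)
    fix t v assume t: "0 < t" "t \<le> (1::real)"
    show "c' * t ^ (2 * tau + 1) * (norm v)\<^sup>2 \<le> v \<bullet> (W t *v v)"
    proof (cases "t \<le> t0")
      case True
      have "t0 ^ (2 * tau + 1) \<le> 1" using t0 by (intro power_le_one) auto
      then have "c' \<le> k / 2" using k by (simp add: c'_def mult_left_le)
      then have "c' * t ^ (2 * tau + 1) * (norm v)\<^sup>2 \<le> k / 2 * t ^ (2 * tau + 1) * (norm v)\<^sup>2"
        using t by (intro mult_right_mono) auto
      then show ?thesis using small[of t v] True t by linarith
    next
      case False
      have "t ^ (2 * tau + 1) \<le> 1" using t by (intro power_le_one) auto
      moreover have "c' \<ge> 0" using k t0 by (simp add: c'_def)
      ultimately have "c' * t ^ (2 * tau + 1) * (norm v)\<^sup>2 \<le> c' * 1 * (norm v)\<^sup>2"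
        by (intro mult_right_mono mult_left_mono) auto
      also have "\<dots> \<le> v \<bullet> (W t0 *v v)" using small[of t0 v] t0 by (simp add: c'_def)
      also have "\<dots> \<le> v \<bullet> (W t *v v)" using False by (intro W_form_mono) auto
      finally show ?thesis .
    qed
  qed
qed

lemma W_spd: "t > 0 \<Longrightarrow> sym_pos_def (W t)"
  unfolding sym_pos_def_def
proof (intro conjI allI impI W_sym)
  fix v :: "real^'n" assume t: "t > 0" and v: "v \<noteq> 0"
  obtain c where c: "c > 0" "\<And>t v. 0 < t \<Longrightarrow> t \<le> 1 \<Longrightarrow> c * t ^ (2 * tau + 1) * (norm v)\<^sup>2 \<le> v \<bullet> (W t *v v)"
    using W_lower by blast
  have "0 < c * (min t 1) ^ (2 * tau + 1) * (norm v)\<^sup>2" using t v c(1) by simp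
  also have "\<dots> \<le> v \<bullet> (W (min t 1) *v v)" using t by (intro c(2)) auto
  also have "\<dots> \<le> v \<bullet> (W t *v v)" by (rule W_form_mono) simp
  finally show "v \<bullet> (W t *v v) > 0" .
qed

lemma R_bound:
  assumes "t > 0"
  obtains c where "c > 0" "\<And>s v. s \<ge> t \<Longrightarrow> c * (norm v)\<^sup>2 \<le> v \<bullet> (W s *v v)"
proof -
  obtain c where c: "c > 0" "\<And>v. c * (norm v)\<^sup>2 \<le> v \<bullet> (W t *v v)"
    using quadratic_form_coercive[of "W t"] W_spd[OF assms] unfolding sym_pos_def_def by blast
  then show thesis using that W_form_mono order_trans by meson
qed

text \<open>Coercivity of W at time t / 2 persists at all later times by monotonicity. This bounds
  the inverses in a neighbourhood of t, which is what
  \<open>has_vector_derivative_matrix_inverse\<close> asks for.\<close>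

lemma R_derivative_continuous:
  assumes t: "t > 0"
  shows "(R has_vector_derivative - (R t ** (2 *\<^sub>R (E t ** D ** transpose (E t))) ** R t)) (at t)"
    and "continuous (at t) R"
proof -
  obtain c where c: "c > 0" "\<And>s v. s \<ge> t / 2 \<Longrightarrow> c * (norm v)\<^sup>2 \<le> v \<bullet> (W s *v v)"
    using R_bound[of "t / 2"] t by auto
  have ev: "\<forall>\<^sub>F s in nhds t. s > t / 2" using t by (intro order_tendstoD(1)[OF filterlim_ident]) auto
  have 1: "\<forall>\<^sub>F s in nhds t. W s ** R s = mat 1 \<and> R s ** W s = mat 1"
    using ev by eventually_elim (use t in \<open>auto simp: R_def spd_inverse W_spd\<close>)
  have 2: "\<forall>\<^sub>F s in nhds t. norm (R s) \<le> real (CARD('n) * CARD('n)) * (1 / c)"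
    using ev
  proof eventually_elim
    case (elim s)
    then show ?case unfolding R_def
      using spd_inverse_upper(2)[OF W_spd c(1) c(2), of s] t by (intro norm_matrix_le_op) auto
  qed
  show "(R has_vector_derivative - (R t ** (2 *\<^sub>R (E t ** D ** transpose (E t))) ** R t)) (at t)"
    by (rule has_vector_derivative_matrix_inverse(1)[OF W_derivative 1 2])
  show "continuous (at t) R"
    by (rule has_vector_derivative_matrix_inverse(2)[OF W_derivative 1 2])
qed

lemma continuous_on_R: "S \<subseteq> {0<..} \<Longrightarrow> continuous_on S R"
  by (metis R_derivative_continuous(2) continuous_at_imp_continuous_on greaterThan_iff subsetD)

text \<open>W starts at 0 and has a bounded derivative on the unit interval. The linear rate in t is
  what makes the Gaussian tails in \<open>q_tail\<close> exponentially small in 1 / r.\<close>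

lemma W_upper:
  obtains b where "b > 0" "\<And>t v. 0 \<le> t \<Longrightarrow> t \<le> 1 \<Longrightarrow> v \<bullet> (W t *v v) \<le> b * t * (norm v)\<^sup>2"
proof -
  have "compact ((\<lambda>r. D ** transpose (E r)) ` {0..1})"
    by (intro compact_continuous_image continuous_intros) auto
  then obtain a where a: "a > 0" "\<And>r. r \<in> {0..1} \<Longrightarrow> norm (D ** transpose (E r)) \<le> a"
    using compact_imp_bounded bounded_pos by (metis (no_types, lifting) image_eqI)
  define b where "b = 2 * a\<^sup>2"
  show thesis
  proof (rule that[of b])
    show "b > 0" using a by (simp add: b_def)
    fix t v assume t: "0 \<le> t" "t \<le> (1::real)"
    define F where "F r = b * r * (norm v)\<^sup>2 - v \<bullet> (W r *v v)" for r
    have "F 0 \<le> F t"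
    proof (rule DERIV_nonneg_imp_nondecreasing[of 0 t F])
      fix r assume r: "0 \<le> r" "r \<le> t"
      have "(F has_real_derivative b * (norm v)\<^sup>2 - 2 * (norm (D *v (transpose (E r) *v v)))\<^sup>2) (at r)"
        unfolding F_def by (intro DERIV_diff W_form_derivative) (auto intro!: derivative_eq_intros)
      moreover have "(norm (D *v (transpose (E r) *v v)))\<^sup>2 \<le> (a * norm v)\<^sup>2"
      proof (intro power_mono)
        have "norm (D *v (transpose (E r) *v v)) \<le> norm (D ** transpose (E r)) * norm v"
          unfolding matrix_vector_mul_assoc by (rule norm_matrix_vector_le)
        also have "\<dots> \<le> a * norm v" using a(2)[of r] r t by (intro mult_right_mono) auto
        finally show "norm (D *v (transpose (E r) *v v)) \<le> a * norm v" .
      qed simp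
      ultimately show "\<exists>D. (F has_real_derivative D) (at r) \<and> 0 \<le> D"
        by (intro exI[of _ "b * (norm v)\<^sup>2 - 2 * (norm (D *v (transpose (E r) *v v)))\<^sup>2"])
          (simp add: b_def power_mult_distrib del: transpose_matrix_vector)
    qed (use t in simp)
    then show "v \<bullet> (W t *v v) \<le> b * t * (norm v)\<^sup>2" by (simp add: F_def)
  qed
qed

end

section \<open>Weak formulation and cutoff\<close>

lemma compact_support_integral:
  fixes g :: "'a::euclidean_space \<Rightarrow> real"
  assumes cont: "continuous_on UNIV g" and supp: "\<And>x. x \<notin> cbox a b \<Longrightarrow> g x = 0"
  shows "integrable lborel g" "integral\<^sup>L lborel g = integral (cbox a b) g"
proof -
  have eq: "(\<lambda>x. indicator (cbox a b) x *\<^sub>R g x) = g"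
    by (rule ext, case_tac "x \<in> cbox a b") (auto simp: supp)
  have si: "set_integrable lborel (cbox a b) g"
    unfolding set_integrable_def
    by (intro borel_integrable_compact continuous_on_subset[OF cont]) auto
  then show "integrable lborel g" unfolding set_integrable_def eq .
  show "integral\<^sup>L lborel g = integral (cbox a b) g"
    using set_borel_integral_eq_integral(2)[OF si] unfolding set_lebesgue_integral_def eq .
qed

lemma lborel_integral_translate:
  fixes g :: "'a::euclidean_space \<Rightarrow> real"
  assumes "g \<in> borel_measurable borel"
  shows "integral\<^sup>L lborel (\<lambda>x. g (x + c)) = integral\<^sup>L lborel g"
proof -
  have "integral\<^sup>L lborel g = integral\<^sup>L (distr lborel borel ((+) c)) g" by (simp add: lborel_distr_plus)
  also have "\<dots> = integral\<^sup>L lborel (\<lambda>x. g (c + x))" using assms by (intro integral_distr) auto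
  finally show ?thesis by (simp add: add.commute)
qed

lemma cball_subset_cbox_cart:
  obtains a b :: "'a::euclidean_space" where "cball 0 r \<subseteq> cbox a b"
  using bounded_subset_cbox_symmetric[OF bounded_cball] by blast

text \<open>The integral of the translate G (x + h e_i) over the whole space does not depend on h;
  differentiation under the integral at h = 0 gives the result without slicing the space into
  lines.\<close>

lemma integral_partial_derivative_eq_0:
  fixes G G' :: "real^'n \<Rightarrow> real"
  assumes d: "\<And>x. ((\<lambda>h. G (x + h *\<^sub>R axis i 1)) has_real_derivative G' x) (at 0)"
    and cG: "continuous_on UNIV G" and cG': "continuous_on UNIV G'"
    and supp: "\<And>x. norm x \<ge> r \<Longrightarrow> G x = 0 \<and> G' x = 0"
  shows "integral\<^sup>L lborel G' = 0"
proof -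
  \<comment> \<open>The margin 1 lets one box contain the supports of all translates with
    \<bar>h\<bar> \<le> 1, since the Leibniz rule works on a fixed domain.\<close>
  obtain a b :: "real^'n" where ab: "cball 0 (r + 1) \<subseteq> cbox a b"
    using cball_subset_cbox_cart by blast
  have out: "G (x + h *\<^sub>R axis i 1) = 0 \<and> G' (x + h *\<^sub>R axis i 1) = 0" if "x \<notin> cbox a b" "h \<in> {-1..1}" for x h
  proof (rule supp)
    have "norm x > r + 1" using that ab by (force simp: mem_cball)
    moreover have "norm x \<le> norm (x + h *\<^sub>R axis i (1::real)) + norm (h *\<^sub>R axis i (1::real) :: real^'n)"
      by (metis add_diff_cancel_right' norm_triangle_ineq4)
    moreover have "norm (h *\<^sub>R axis i (1::real) :: real^'n) \<le> 1" using that by (simp add: abs_le_iff)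
    ultimately show "norm (x + h *\<^sub>R axis i 1) \<ge> r" by linarith
  qed
  have cont: "continuous_on UNIV (\<lambda>x. G (x + h *\<^sub>R axis i 1))" for h
    by (intro continuous_on_compose2[OF cG] continuous_intros) auto
  have dh: "((\<lambda>h. G (x + h *\<^sub>R axis i 1)) has_real_derivative G' (x + h *\<^sub>R axis i 1)) (at h)" for x h
  proof -
    have "((\<lambda>k. G ((x + h *\<^sub>R axis i 1) + k *\<^sub>R axis i 1)) has_real_derivative G' (x + h *\<^sub>R axis i 1)) (at 0)"
      by (rule d)
    then have "((\<lambda>k. G (x + (k + h) *\<^sub>R axis i 1)) has_real_derivative G' (x + h *\<^sub>R axis i 1)) (at 0)"
      by (simp add: algebra_simps)
    then show ?thesis
      using DERIV_at_within_shift[of "\<lambda>h. G (x + h *\<^sub>R axis i 1)" "G' (x + h *\<^sub>R axis i 1)" h 0 UNIV]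
      by (simp add: add.commute)
  qed
  have "((\<lambda>h. integral (cbox a b) (\<lambda>x. G (x + h *\<^sub>R axis i 1))) has_field_derivative
     integral (cbox a b) (\<lambda>x. G' (x + 0 *\<^sub>R axis i 1))) (at 0 within {-1..1})"
  proof (rule leibniz_rule_field_derivative)
    show "((\<lambda>h. G (x + h *\<^sub>R axis i 1)) has_real_derivative G' (x + h *\<^sub>R axis i 1)) (at h within {-1..1})" for x h
      by (rule has_field_derivative_at_within[OF dh])
    show "(\<lambda>x. G (x + h *\<^sub>R axis i 1)) integrable_on cbox a b" for h
      by (intro integrable_continuous continuous_on_subset[OF cont]) auto
    show "continuous_on ({- 1..1} \<times> cbox a b) (\<lambda>(h, x). G' (x + h *\<^sub>R axis i 1))"
      unfolding split_beta by (intro continuous_on_compose2[OF cG'] continuous_intros) auto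
  qed auto
  moreover have const: "integral (cbox a b) (\<lambda>x. G (x + h *\<^sub>R axis i 1)) = integral\<^sup>L lborel G" if "h \<in> {-1..1}" for h
  proof -
    have "integral (cbox a b) (\<lambda>x. G (x + h *\<^sub>R axis i 1)) = integral\<^sup>L lborel (\<lambda>x. G (x + h *\<^sub>R axis i 1))"
      by (intro compact_support_integral(2)[symmetric] cont) (use out that in blast)
    then show ?thesis
      using lborel_integral_translate[of G] borel_measurable_continuous_onI[OF cG] by simp
  qed
  ultimately have "((\<lambda>h. integral\<^sup>L lborel G) has_field_derivative integral (cbox a b) G') (at 0 within {-1..1})"
    by (subst (asm) has_field_derivative_cong_eventually[where g = "\<lambda>h. integral\<^sup>L lborel G"])
      (use const[of 0] in \<open>auto simp: eventually_at intro!: exI[of _ 1]\<close>)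
  then have "((\<lambda>h. integral\<^sup>L lborel G) has_field_derivative integral (cbox a b) G') (at 0)"
    by (simp add: at_within_Icc_at)
  then have "integral (cbox a b) G' = 0" using DERIV_const DERIV_unique by blast
  moreover have "integral\<^sup>L lborel G' = integral (cbox a b) G'"
    by (intro compact_support_integral(2) cG') (use out[of _ 0] in auto)
  ultimately show ?thesis by simp
qed

text \<open>Two integrations by parts, each as the vanishing integral of a total derivative: first
  flux times \<phi>, then f times \<phi>1. The flux is differentiated as a whole, in agreement with
  the regularity of the solution class, so no separate second derivative of f is called for.\<close>

lemma weak_form_fixed_time:
  fixes f \<phi> :: "real^'n \<Rightarrow> real" and gf :: "real^'n \<Rightarrow> real^'n" and dF \<phi>1 \<phi>2 :: "'n \<Rightarrow> real^'n \<Rightarrow> real"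
    and b :: "real^'n \<Rightarrow> real^'n"
  assumes df: "\<And>x j. ((\<lambda>h. f (x + h *\<^sub>R axis j 1)) has_real_derivative gf x $ j) (at 0)"
    and dF: "\<And>x i. ((\<lambda>h. d i * gf (x + h *\<^sub>R axis i 1) $ i + f (x + h *\<^sub>R axis i 1) * b (x + h *\<^sub>R axis i 1) $ i)
                          has_real_derivative dF i x) (at 0)"
    and d1: "\<And>x i. ((\<lambda>h. \<phi> (x + h *\<^sub>R axis i 1)) has_real_derivative \<phi>1 i x) (at 0)"
    and d2: "\<And>x i. ((\<lambda>h. \<phi>1 i (x + h *\<^sub>R axis i 1)) has_real_derivative \<phi>2 i x) (at 0)"
    and [continuous_intros]: "continuous_on UNIV f" "continuous_on UNIV gf" "\<And>i. continuous_on UNIV (dF i)"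
      "continuous_on UNIV \<phi>" "\<And>i. continuous_on UNIV (\<phi>1 i)" "\<And>i. continuous_on UNIV (\<phi>2 i)" "continuous_on UNIV b"
    and supp: "\<And>x i. norm x \<ge> r \<Longrightarrow> \<phi> x = 0 \<and> \<phi>1 i x = 0 \<and> \<phi>2 i x = 0"
  shows "(\<integral>x. (\<Sum>i\<in>UNIV. dF i x) * \<phi> x \<partial>lborel) =
    (\<integral>x. f x * ((\<Sum>i\<in>UNIV. d i * \<phi>2 i x) - (\<Sum>i\<in>UNIV. b x $ i * \<phi>1 i x)) \<partial>lborel)"
proof -
  obtain l u :: "real^'n" where lu: "cball 0 r \<subseteq> cbox l u" using cball_subset_cbox_cart by blast
  have int: "integrable lborel g" if "continuous_on UNIV g" "\<And>x. norm x \<ge> r \<Longrightarrow> g x = 0" for g :: "real^'n \<Rightarrow> real"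
  proof (rule compact_support_integral(1)[OF that(1)])
    fix x assume "x \<notin> cbox l u"
    then have "norm x \<ge> r" using lu by (force simp: mem_cball)
    then show "g x = 0" by (rule that(2))
  qed
  have i1: "integrable lborel (\<lambda>x. dF i x * \<phi> x)" for i by (intro int continuous_intros) (simp add: supp)
  have i2: "integrable lborel (\<lambda>x. f x * b x $ i * \<phi>1 i x)" for i by (intro int continuous_intros) (simp add: supp)
  have i3: "integrable lborel (\<lambda>x. gf x $ i * \<phi>1 i x)" for i by (intro int continuous_intros) (simp add: supp)
  have i4: "integrable lborel (\<lambda>x. f x * \<phi>2 i x)" for i by (intro int continuous_intros) (simp add: supp)
  have each: "(\<integral>x. dF i x * \<phi> x \<partial>lborel) = d i * (\<integral>x. f x * \<phi>2 i x \<partial>lborel) - (\<integral>x. f x * b x $ i * \<phi>1 i x \<partial>lborel)" for i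
  proof -
    have "(\<integral>x. dF i x * \<phi> x + (d i * gf x $ i + f x * b x $ i) * \<phi>1 i x \<partial>lborel) = 0"
    proof (rule integral_partial_derivative_eq_0[where r = r and i = i and G = "\<lambda>x. (d i * gf x $ i + f x * b x $ i) * \<phi> x"])
      fix x
      show "((\<lambda>h. (d i * gf (x + h *\<^sub>R axis i 1) $ i + f (x + h *\<^sub>R axis i 1) * b (x + h *\<^sub>R axis i 1) $ i) *
              \<phi> (x + h *\<^sub>R axis i 1)) has_real_derivative
         dF i x * \<phi> x + (d i * gf x $ i + f x * b x $ i) * \<phi>1 i x) (at 0)"
        by (rule DERIV_cong[OF DERIV_mult[OF dF d1]]) simp
    qed (auto intro!: continuous_intros simp: supp)
    then have "(\<integral>x. dF i x * \<phi> x + (d i * (gf x $ i * \<phi>1 i x) + f x * b x $ i * \<phi>1 i x) \<partial>lborel) = 0"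
      by (simp add: algebra_simps)
    then have 1: "(\<integral>x. dF i x * \<phi> x \<partial>lborel) + (d i * (\<integral>x. gf x $ i * \<phi>1 i x \<partial>lborel) + (\<integral>x. f x * b x $ i * \<phi>1 i x \<partial>lborel)) = 0"
      using i1[of i] i2[of i] i3[of i] by simp
    have "(\<integral>x. gf x $ i * \<phi>1 i x + f x * \<phi>2 i x \<partial>lborel) = 0"
    proof (rule integral_partial_derivative_eq_0[where r = r and i = i and G = "\<lambda>x. f x * \<phi>1 i x"])
      fix x
      show "((\<lambda>h. f (x + h *\<^sub>R axis i 1) * \<phi>1 i (x + h *\<^sub>R axis i 1)) has_real_derivative
         gf x $ i * \<phi>1 i x + f x * \<phi>2 i x) (at 0)"
        by (rule DERIV_cong[OF DERIV_mult[OF df d2]]) simp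
    qed (auto intro!: continuous_intros simp: supp)
    then have "(\<integral>x. gf x $ i * \<phi>1 i x \<partial>lborel) = - (\<integral>x. f x * \<phi>2 i x \<partial>lborel)"
      using i3[of i] i4[of i] by simp
    then show ?thesis using 1 by simp
  qed
  have "(\<integral>x. (\<Sum>i\<in>UNIV. dF i x) * \<phi> x \<partial>lborel) = (\<Sum>i\<in>UNIV. \<integral>x. dF i x * \<phi> x \<partial>lborel)"
    by (simp add: sum_distrib_right i1)
  also have "\<dots> = (\<integral>x. (\<Sum>i\<in>UNIV. d i * (f x * \<phi>2 i x) - f x * b x $ i * \<phi>1 i x) \<partial>lborel)"
    unfolding each using i2 i4 by simp
  also have "\<dots> = (\<integral>x. f x * ((\<Sum>i\<in>UNIV. d i * \<phi>2 i x) - (\<Sum>i\<in>UNIV. b x $ i * \<phi>1 i x)) \<partial>lborel)"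
    by (simp add: sum_subtractf right_diff_distrib sum_distrib_left mult_ac)
  finally show ?thesis .
qed


section \<open>Logarithmic cutoff functions\<close>

lemma DERIV_max0_power2: "((\<lambda>u. (max 0 u)^2) has_real_derivative 2 * max 0 u) (at u)" for u :: real
proof -
  consider "u > 0" | "u < 0" | "u = 0" by linarith
  then show ?thesis
  proof cases
    case 1
    have "((\<lambda>u. u^2) has_real_derivative 2 * u) (at u)" by (auto intro!: derivative_eq_intros)
    then have "((\<lambda>u. (max 0 u)^2) has_real_derivative 2 * u) (at u)"
      by (rule DERIV_cong_ev[THEN iffD1, OF refl _ refl, rotated])
        (use 1 in \<open>auto intro!: eventually_mono[OF order_tendstoD(1)[OF filterlim_ident 1]]\<close>)
    then show ?thesis using 1 by simp
  next
    case 2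
    have "((\<lambda>u::real. 0) has_real_derivative 0) (at u)" by simp
    then have "((\<lambda>u. (max 0 u)^2) has_real_derivative 0) (at u)"
      by (rule DERIV_cong_ev[THEN iffD1, OF refl _ refl, rotated])
        (use 2 in \<open>auto intro!: eventually_mono[OF order_tendstoD(2)[OF filterlim_ident 2]]\<close>)
    then show ?thesis using 2 by simp
  next
    case 3
    have "((\<lambda>h. ((max 0 (0 + h))^2 - (max 0 0)^2) / h) \<longlongrightarrow> 0) (at (0::real))"
    proof (rule Lim_null_comparison)
      show "\<forall>\<^sub>F h in at (0::real). norm (((max 0 (0 + h))^2 - (max 0 0)^2) / h) \<le> \<bar>h\<bar>"
        by (rule always_eventually) (auto simp: max_def power2_eq_square)
      show "((\<lambda>h. \<bar>h\<bar>) \<longlongrightarrow> 0) (at (0::real))" using tendsto_rabs_zero[OF tendsto_ident_at] .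
    qed
    then show ?thesis using 3 by (simp add: DERIV_def)
  qed
qed

text \<open>The cube is the lowest integer power of the positive part that is twice continuously
  differentiable, as the second derivatives of the cutoff have to be continuous.\<close>

lemma DERIV_max0_power3: "((\<lambda>u. (max 0 u)^3) has_real_derivative 3 * (max 0 u)^2) (at u)" for u :: real
proof -
  have eq: "(max 0 u)^3 = (max 0 u)^2 * u" for u :: real
    by (simp add: max_def power2_eq_square power3_eq_cube)
  have "((\<lambda>u. (max 0 u)^2 * u) has_real_derivative 2 * max 0 u * u + 1 * (max 0 u)^2) (at u)"
    by (rule DERIV_mult[OF DERIV_max0_power2 DERIV_ident])
  moreover have "2 * max 0 u * u + 1 * (max 0 u)^2 = 3 * (max 0 u)^2"
    by (simp add: max_def power2_eq_square)
  ultimately show ?thesis unfolding eq by (rule DERIV_cong)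
qed

text \<open>A logarithmic cutoff: \<open>\<bar>x\<bar> \<bar>\<nabla>\<chi>\<bar>\<close> is small uniformly in \<open>x\<close>, so that the linearly growing drift
  does no harm and no decay of the solution is needed.\<close>

definition cut_arg :: "real \<Rightarrow> real^'n \<Rightarrow> real" where
  "cut_arg e x = max 0 (1 - e * ln (1 + x \<bullet> x))"
definition cut :: "real \<Rightarrow> real^'n \<Rightarrow> real" where
  "cut e x = (cut_arg e x)^3"
definition cut1 :: "real \<Rightarrow> 'n \<Rightarrow> real^'n \<Rightarrow> real" where
  "cut1 e i x = - 3 * e * ((cut_arg e x)^2 * (2 * x $ i / (1 + x \<bullet> x)))"
definition cut2 :: "real \<Rightarrow> 'n \<Rightarrow> real^'n \<Rightarrow> real" where
  "cut2 e i x = - 3 * e * ((cut_arg e x)^2 * (2 / (1 + x \<bullet> x) - (2 * x $ i / (1 + x \<bullet> x))^2)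
     - 2 * e * cut_arg e x * (2 * x $ i / (1 + x \<bullet> x))^2)"

lemma one_plus_inner_pos: "1 + x \<bullet> x > 0" for x :: "real^'n"
  by (simp add: add_pos_nonneg)

lemma DERIV_one_plus_inner:
  "((\<lambda>h. 1 + (x + h *\<^sub>R axis i 1) \<bullet> (x + h *\<^sub>R axis i 1)) has_real_derivative 2 * x $ i) (at 0)"
  for x :: "real^'n"
proof -
  have eq: "1 + (x + h *\<^sub>R axis i 1) \<bullet> (x + h *\<^sub>R axis i 1) = 1 + x \<bullet> x + 2 * h * x $ i + h^2" for h
    by (simp add: inner_add inner_axis inner_axis' power2_eq_square algebra_simps)
  show ?thesis unfolding eq by (auto intro!: derivative_eq_intros)
qed

lemma DERIV_cut_inner:
  "((\<lambda>h. 1 - e * ln (1 + (x + h *\<^sub>R axis i 1) \<bullet> (x + h *\<^sub>R axis i 1)))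
     has_real_derivative - e * (2 * x $ i / (1 + x \<bullet> x))) (at 0)" for x :: "real^'n"
proof -
  have "((\<lambda>h. ln (1 + (x + h *\<^sub>R axis i 1) \<bullet> (x + h *\<^sub>R axis i 1))) has_real_derivative
      inverse (1 + (x + 0 *\<^sub>R axis i 1) \<bullet> (x + 0 *\<^sub>R axis i 1)) * (2 * x $ i)) (at 0)"
    by (rule DERIV_chain2[OF DERIV_ln DERIV_one_plus_inner]) (rule one_plus_inner_pos)
  then show ?thesis
    by (intro DERIV_cong[OF DERIV_diff[OF DERIV_const DERIV_cmult]]) (auto simp: divide_inverse)
qed

lemma DERIV_cut: "((\<lambda>h. cut e (x + h *\<^sub>R axis i 1)) has_real_derivative cut1 e i x) (at 0)"
  unfolding cut_def cut_arg_def cut1_def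
  by (rule DERIV_cong[OF DERIV_chain2[OF DERIV_max0_power3 DERIV_cut_inner]]) simp

lemma DERIV_cut1: "((\<lambda>h. cut1 e i (x + h *\<^sub>R axis i 1)) has_real_derivative cut2 e i x) (at 0)"
proof -
  let ?q = "1 + x \<bullet> x"
  have D1: "((\<lambda>h. (cut_arg e (x + h *\<^sub>R axis i 1))^2) has_real_derivative
      2 * cut_arg e x * (- e * (2 * x $ i / ?q))) (at 0)"
    unfolding cut_arg_def by (rule DERIV_cong[OF DERIV_chain2[OF DERIV_max0_power2 DERIV_cut_inner]]) simp
  have D2: "((\<lambda>h. 2 * (x + h *\<^sub>R axis i 1) $ i / (1 + (x + h *\<^sub>R axis i 1) \<bullet> (x + h *\<^sub>R axis i 1)))
     has_real_derivative (2 / ?q - (2 * x $ i / ?q)^2)) (at 0)"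
  proof -
    have N: "((\<lambda>h. 2 * (x + h *\<^sub>R axis i 1) $ i) has_real_derivative 2) (at 0)"
      by (auto intro!: derivative_eq_intros)
    show ?thesis
      using one_plus_inner_pos[of x]
      by (intro DERIV_cong[OF DERIV_divide[OF N DERIV_one_plus_inner]])
        (auto simp: power2_eq_square divide_simps)
  qed
  show ?thesis
    unfolding cut1_def
    by (rule DERIV_cong[OF DERIV_cmult[OF DERIV_mult[OF D1 D2]]])
      (simp add: cut2_def power2_eq_square algebra_simps)
qed

lemma cut_continuous: "continuous_on UNIV (cut e)" "continuous_on UNIV (cut1 e i)" "continuous_on UNIV (cut2 e i)"
  unfolding cut_def[abs_def] cut1_def[abs_def] cut2_def[abs_def] cut_arg_def
  by (auto intro!: continuous_intros continuous_on_max simp: add_pos_nonneg add_nonneg_eq_0_iff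
      dest!: arg_cong[where f = "\<lambda>y. y > 0"])

lemma cut_support:
  assumes e: "e > 0" and x: "norm x \<ge> exp (1 / e)"
  shows "cut e x = 0 \<and> cut1 e i x = 0 \<and> cut2 e i x = 0"
proof -
  have "exp (1 / e) * 1 \<le> norm x * norm x" using e x
    by (intro mult_mono) (auto intro: order_trans[OF _ x])
  then have "exp (1 / e) \<le> 1 + x \<bullet> x" by (simp add: power2_norm_eq_inner[symmetric] power2_eq_square)
  then have "ln (exp (1 / e)) \<le> ln (1 + x \<bullet> x)"
    using one_plus_inner_pos[of x] by (subst ln_le_cancel_iff) auto
  then have "e * (1 / e) \<le> e * ln (1 + x \<bullet> x)" using e by (intro mult_left_mono) auto
  then have "cut_arg e x = 0" using e by (simp add: cut_arg_def)
  then show ?thesis by (simp add: cut_def cut1_def cut2_def)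
qed

lemma cut_arg_bounds: "e \<ge> 0 \<Longrightarrow> 0 \<le> cut_arg e x" "e \<ge> 0 \<Longrightarrow> cut_arg e x \<le> 1"
  by (auto simp: cut_arg_def)

lemma cut_bounds: "e \<ge> 0 \<Longrightarrow> 0 \<le> cut e x" "e \<ge> 0 \<Longrightarrow> cut e x \<le> 1"
  using cut_arg_bounds[of e x] by (auto simp: cut_def power_le_one)

lemma cut_ratio_bound: "\<bar>2 * x $ i / (1 + x \<bullet> x)\<bar> \<le> 1" "norm x * \<bar>2 * x $ i / (1 + x \<bullet> x)\<bar> \<le> 2"
proof -
  have q: "1 + x \<bullet> x = 1 + (norm x)^2" by (simp add: power2_norm_eq_inner)
  have xi: "\<bar>x $ i\<bar> \<le> norm x" by (rule component_le_norm_cart)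
  have "0 \<le> (1 - norm x)^2" by simp
  then have "2 * norm x \<le> 1 + (norm x)^2" by (simp add: power2_eq_square algebra_simps)
  then show "\<bar>2 * x $ i / (1 + x \<bullet> x)\<bar> \<le> 1"
    using xi one_plus_inner_pos[of x] by (simp add: q abs_mult)
  have "norm x * (2 * \<bar>x $ i\<bar>) \<le> norm x * (2 * norm x)" using xi by (intro mult_left_mono) auto
  also have "\<dots> \<le> 2 * (1 + (norm x)^2)" by (simp add: power2_eq_square)
  finally show "norm x * \<bar>2 * x $ i / (1 + x \<bullet> x)\<bar> \<le> 2"
    using one_plus_inner_pos[of x] by (simp add: q abs_mult divide_le_eq)
qed

lemma cut1_bound:
  assumes "e \<ge> 0"
  shows "\<bar>cut1 e i x\<bar> \<le> 3 * e" "norm x * \<bar>cut1 e i x\<bar> \<le> 6 * e"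
proof -
  have m: "(cut_arg e x)^2 \<le> 1" "0 \<le> (cut_arg e x)^2"
    using cut_arg_bounds[OF assms, of x] by (auto simp: power_le_one)
  have eq: "\<bar>cut1 e i x\<bar> = 3 * e * ((cut_arg e x)^2 * \<bar>2 * x $ i / (1 + x \<bullet> x)\<bar>)"
    using assms m by (simp add: cut1_def abs_mult)
  have "(cut_arg e x)^2 * \<bar>2 * x $ i / (1 + x \<bullet> x)\<bar> \<le> 1 * 1"
    using m cut_ratio_bound(1)[of x i] by (intro mult_mono) auto
  then have "3 * e * ((cut_arg e x)^2 * \<bar>2 * x $ i / (1 + x \<bullet> x)\<bar>) \<le> 3 * e * 1"
    using assms by (intro mult_left_mono) auto
  then show "\<bar>cut1 e i x\<bar> \<le> 3 * e" unfolding eq by simp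
  have "(cut_arg e x)^2 * (norm x * \<bar>2 * x $ i / (1 + x \<bullet> x)\<bar>) \<le> 1 * 2"
    using m cut_ratio_bound(2)[of x i] by (intro mult_mono) auto
  then have "3 * e * ((cut_arg e x)^2 * (norm x * \<bar>2 * x $ i / (1 + x \<bullet> x)\<bar>)) \<le> 3 * e * 2"
    using assms by (intro mult_left_mono) auto
  then show "norm x * \<bar>cut1 e i x\<bar> \<le> 6 * e" unfolding eq by (simp add: mult_ac)
qed

lemma cut2_bound:
  assumes "e \<ge> 0" "e \<le> 1"
  shows "\<bar>cut2 e i x\<bar> \<le> 15 * e"
proof -
  let ?m = "cut_arg e x" and ?q = "1 + x \<bullet> x" and ?s = "(2 * x $ i / (1 + x \<bullet> x))^2"
  have m: "?m^2 \<le> 1" "0 \<le> ?m^2" "0 \<le> ?m" "?m \<le> 1"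
    using cut_arg_bounds[OF assms(1), of x] by (auto simp: power_le_one)
  have s: "0 \<le> ?s" "?s \<le> 1" using cut_ratio_bound(1)[of x i] by (auto simp: abs_square_le_1)
  have q: "0 \<le> 2 / ?q" "2 / ?q \<le> 2" using one_plus_inner_pos[of x] by (auto simp: divide_le_eq)
  have "\<bar>2 / ?q - ?s\<bar> \<le> 3" using s q by linarith
  then have "\<bar>?m^2 * (2 / ?q - ?s)\<bar> \<le> 1 * 3"
    unfolding abs_mult using m s q by (intro mult_mono) auto
  moreover have "\<bar>2 * e * ?m * ?s\<bar> \<le> 2 * 1 * 1 * 1"
    unfolding abs_mult using m s assms by (intro mult_mono) auto
  ultimately have "\<bar>?m^2 * (2 / ?q - ?s) - 2 * e * ?m * ?s\<bar> \<le> 5" by linarith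
  then have "3 * e * \<bar>?m^2 * (2 / ?q - ?s) - 2 * e * ?m * ?s\<bar> \<le> 3 * e * 5"
    using assms by (intro mult_left_mono) auto
  then show ?thesis using assms by (simp add: cut2_def abs_mult)
qed

lemma cut_tendsto: "(\<lambda>n. cut (1 / real (Suc n)) x) \<longlonglongrightarrow> 1"
proof -
  have "(\<lambda>n. 1 / real (Suc n)) \<longlonglongrightarrow> 0" using LIMSEQ_inverse_real_of_nat by (simp add: inverse_eq_divide)
  then have "(\<lambda>n. (max 0 (1 - (1 / real (Suc n)) * ln (1 + x \<bullet> x)))^3) \<longlonglongrightarrow> (max 0 (1 - 0 * ln (1 + x \<bullet> x)))^3"
    by (intro tendsto_intros tendsto_max)
  then show ?thesis by (simp add: cut_def cut_arg_def)
qed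

section \<open>Pairing of solutions with the backward equation\<close>

context fokker_planck
begin

definition classical_data ::
  "(real \<Rightarrow> real^'n \<Rightarrow> real) \<Rightarrow> (real \<Rightarrow> real^'n \<Rightarrow> real) \<Rightarrow> (real \<Rightarrow> real^'n \<Rightarrow> real^'n) \<Rightarrow>
    (real \<Rightarrow> real^'n \<Rightarrow> 'n \<Rightarrow> real) \<Rightarrow> bool" where
  "classical_data f ft gf dF \<longleftrightarrow>
        (\<forall>t>0. \<forall>x. ((\<lambda>s. f s x) has_real_derivative ft t x) (at t))
      \<and> (\<forall>t>0. \<forall>x. \<forall>j. ((\<lambda>h. f t (x + h *\<^sub>R axis j 1)) has_real_derivative gf t x $ j) (at 0))
      \<and> (\<forall>t>0. \<forall>x. \<forall>i. ((\<lambda>h. (D *v gf t (x + h *\<^sub>R axis i 1)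
                                 + f t (x + h *\<^sub>R axis i 1) *\<^sub>R (C *v (x + h *\<^sub>R axis i 1))) $ i)
                          has_real_derivative dF t x i) (at 0))
      \<and> (\<forall>t>0. \<forall>x. ft t x = (\<Sum>i\<in>UNIV. dF t x i))
      \<and> continuous_on ({0<..} \<times> UNIV) (\<lambda>(t,x). f t x)
      \<and> continuous_on ({0<..} \<times> UNIV) (\<lambda>(t,x). ft t x)
      \<and> continuous_on ({0<..} \<times> UNIV) (\<lambda>(t,x). gf t x)
      \<and> (\<forall>i. continuous_on ({0<..} \<times> UNIV) (\<lambda>(t,x). dF t x i))"

text \<open>The initial datum is left out and the mass is only bounded, so that the stationary,
  unnormalised Gaussian falls under the same notion as f and can be compared with it.\<close>

definition classical :: "(real \<Rightarrow> real^'n \<Rightarrow> real) \<Rightarrow> bool" where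
  "classical f \<longleftrightarrow> (\<exists>ft gf dF. classical_data f ft gf dF)
   \<and> (\<forall>t>0. \<forall>x. f t x \<ge> 0)
   \<and> (\<exists>m. \<forall>t>0. integrable lborel (f t) \<and> (\<integral>x. f t x \<partial>lborel) \<le> m)"

lemma continuous_on_section:
  assumes "continuous_on (S \<times> UNIV) (\<lambda>(s, x). g s x)" "s \<in> S"
  shows "continuous_on UNIV (g s)"
proof -
  have "continuous_on UNIV (\<lambda>x. (s, x))" by (intro continuous_on_Pair continuous_on_const continuous_on_id)
  then show ?thesis using continuous_on_compose2[OF assms(1), of UNIV "\<lambda>x. (s, x)"] assms(2) by auto
qed

text \<open>Formally the s-derivative of the pairing is the integral of f times the left-hand side
  of the backward equation, hence 0. With the cutoff inserted only commutator terms survive; they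
  contain p or its first derivatives times derivatives of the cutoff and are at most e * L * f.
  Therefore bounds on p and p1 alone suffice, and the bounded mass of f lets e tend to 0.\<close>

lemma duality:
  fixes p ps :: "real \<Rightarrow> real^'n \<Rightarrow> real" and p1 p2 :: "'n \<Rightarrow> real \<Rightarrow> real^'n \<Rightarrow> real"
  assumes f: "classical f" and ab: "0 \<le> \<alpha>" "\<alpha> < s1" "s1 \<le> s2" "s2 < \<beta>"
    and ps: "\<And>s x. s \<in> {\<alpha><..<\<beta>} \<Longrightarrow> ((\<lambda>s. p s x) has_real_derivative ps s x) (at s)"
    and p1: "\<And>s x i. s \<in> {\<alpha><..<\<beta>} \<Longrightarrow> ((\<lambda>h. p s (x + h *\<^sub>R axis i 1)) has_real_derivative p1 i s x) (at 0)"
    and p2: "\<And>s x i. s \<in> {\<alpha><..<\<beta>} \<Longrightarrow> ((\<lambda>h. p1 i s (x + h *\<^sub>R axis i 1)) has_real_derivative p2 i s x) (at 0)"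
    and cp: "continuous_on ({\<alpha><..<\<beta>} \<times> UNIV) (\<lambda>(s, x). p s x)"
    and cps: "continuous_on ({\<alpha><..<\<beta>} \<times> UNIV) (\<lambda>(s, x). ps s x)"
    and cp1: "\<And>i. continuous_on ({\<alpha><..<\<beta>} \<times> UNIV) (\<lambda>(s, x). p1 i s x)"
    and cp2: "\<And>i. continuous_on ({\<alpha><..<\<beta>} \<times> UNIV) (\<lambda>(s, x). p2 i s x)"
    and eq: "\<And>s x. s \<in> {\<alpha><..<\<beta>} \<Longrightarrow> ps s x + (\<Sum>i\<in>UNIV. d i * p2 i s x) - (\<Sum>i\<in>UNIV. (C *v x) $ i * p1 i s x) = 0"
    and B: "\<And>s x. s \<in> {\<alpha><..<\<beta>} \<Longrightarrow> \<bar>p s x\<bar> \<le> B" "\<And>s x i. s \<in> {\<alpha><..<\<beta>} \<Longrightarrow> \<bar>p1 i s x\<bar> \<le> B"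
  shows "(\<integral>x. f s1 x * p s1 x \<partial>lborel) = (\<integral>x. f s2 x * p s2 x \<partial>lborel)"
proof -
  obtain ft gf dF where data: "classical_data f ft gf dF" using f unfolding classical_def by blast
  note data' = data[unfolded classical_data_def]
  note dft = data'[THEN conjunct1, rule_format]
  note dgf = data'[THEN conjunct2, THEN conjunct1, rule_format]
  note ddF = data'[THEN conjunct2, THEN conjunct2, THEN conjunct1, rule_format]
  note ft = data'[THEN conjunct2, THEN conjunct2, THEN conjunct2, THEN conjunct1, rule_format]
  note rest = data'[THEN conjunct2, THEN conjunct2, THEN conjunct2, THEN conjunct2]
  note cf = rest[THEN conjunct1] and cft = rest[THEN conjunct2, THEN conjunct1]
    and cgf = rest[THEN conjunct2, THEN conjunct2, THEN conjunct1]
    and cdF = rest[THEN conjunct2, THEN conjunct2, THEN conjunct2, rule_format]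
  have f0: "f t x \<ge> 0" if "t > 0" for t x using f that unfolding classical_def by blast
  obtain m where int_f: "\<And>t. t > 0 \<Longrightarrow> integrable lborel (f t)" and m: "\<And>t. t > 0 \<Longrightarrow> (\<integral>x. f t x \<partial>lborel) \<le> m"
    using f unfolding classical_def by blast
  have pos: "s > 0" if "s \<in> {\<alpha><..<\<beta>}" for s using that ab by simp
  have mem: "s1 \<in> {\<alpha><..<\<beta>}" "s2 \<in> {\<alpha><..<\<beta>}" using ab by auto
  have B0: "B \<ge> 0" using B(1)[OF mem(1), of 0] by linarith
  \<comment> \<open>Per coordinate, 21 = 6 + 15 comes from 2 * p1 * cut1 and p * cut2, and 6 * norm
    C from the drift through \<open>norm x * \<bar>cut1 e i x\<bar> \<le> 6 * e\<close>.\<close>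
  define L where "L = real CARD('n) * (21 * B) + real CARD('n) * (6 * norm C * B)"
  have L0: "L \<ge> 0" using B0 by (simp add: L_def)
  note sec = continuous_on_section
  define \<Phi> where "\<Phi> e s = (\<integral>x. f s x * (p s x * cut e x) \<partial>lborel)" for e s
  have main: "\<bar>\<Phi> e s2 - \<Phi> e s1\<bar> \<le> e * L * m * (s2 - s1)" if e: "0 < e" "e \<le> 1" for e
  proof -
    define \<phi>1 where "\<phi>1 i s x = p1 i s x * cut e x + p s x * cut1 e i x" for i s x
    define \<phi>2 where "\<phi>2 i s x = p2 i s x * cut e x + 2 * p1 i s x * cut1 e i x + p s x * cut2 e i x" for i s x
    obtain l u :: "real^'n" where lu: "cball 0 (exp (1 / e)) \<subseteq> cbox l u" using cball_subset_cbox_cart by blast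
    have out: "cut e x = 0" if "x \<notin> cbox l u" for x
    proof -
      have "norm x \<ge> exp (1 / e)" using that lu by (force simp: mem_cball)
      then show ?thesis using cut_support[OF e(1)] by blast
    qed
    define G' where "G' s x = ft s x * (p s x * cut e x) + f s x * (ps s x * cut e x)" for s x
    have deriv: "(\<Phi> e has_real_derivative (\<integral>x. G' s x \<partial>lborel)) (at s)" if s: "s \<in> {\<alpha><..<\<beta>}" for s
    proof -
      have "((\<lambda>s. integral (cbox l u) (\<lambda>x. f s x * (p s x * cut e x))) has_field_derivative
        integral (cbox l u) (G' s)) (at s within {\<alpha><..<\<beta>})"
      proof (rule leibniz_rule_field_derivative)
        fix s x assume s: "s \<in> {\<alpha><..<\<beta>}"
        show "((\<lambda>s. f s x * (p s x * cut e x)) has_real_derivative G' s x) (at s within {\<alpha><..<\<beta>})"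
          by (rule has_field_derivative_at_within, rule DERIV_cong[OF DERIV_mult[OF dft[OF pos[OF s]] DERIV_cmult_right[OF ps[OF s]]]])
            (simp add: G'_def)
      next
        fix s assume s: "s \<in> {\<alpha><..<\<beta>}"
        show "(\<lambda>x. f s x * (p s x * cut e x)) integrable_on cbox l u"
        proof (rule integrable_continuous, rule continuous_on_subset[OF _ subset_UNIV])
          show "continuous_on UNIV (\<lambda>x. f s x * (p s x * cut e x))"
            using pos[OF s] by (intro continuous_intros sec[OF cf] sec[OF cp s] cut_continuous) auto
        qed
      next
        have sub: "{\<alpha><..<\<beta>} \<times> cbox l u \<subseteq> {0<..} \<times> UNIV" "{\<alpha><..<\<beta>} \<times> cbox l u \<subseteq> {\<alpha><..<\<beta>} \<times> UNIV" using pos by auto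
        have ccut: "continuous_on ({\<alpha><..<\<beta>} \<times> cbox l u) (\<lambda>z. cut e (snd z))"
          by (intro continuous_on_compose2[OF cut_continuous(1)] continuous_intros) auto
        show "continuous_on ({\<alpha><..<\<beta>} \<times> cbox l u) (\<lambda>(s, x). G' s x)"
          unfolding G'_def split_beta
          by (intro continuous_intros ccut continuous_on_subset[OF cf[unfolded split_beta] sub(1)]
              continuous_on_subset[OF cft[unfolded split_beta] sub(1)]
              continuous_on_subset[OF cp[unfolded split_beta] sub(2)]
              continuous_on_subset[OF cps[unfolded split_beta] sub(2)])
      qed (use s in auto)
      moreover have "integral (cbox l u) (\<lambda>x. f s x * (p s x * cut e x)) = \<Phi> e s" if s: "s \<in> {\<alpha><..<\<beta>}" for s
        unfolding \<Phi>_def using pos[OF s]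
        by (intro compact_support_integral(2)[symmetric] continuous_intros sec[OF cf] sec[OF cp s] cut_continuous)
          (auto simp: out)
      moreover have "integral (cbox l u) (G' s) = (\<integral>x. G' s x \<partial>lborel)"
        unfolding G'_def using pos[OF s]
        by (intro compact_support_integral(2)[symmetric] continuous_intros sec[OF cf] sec[OF cft]
            sec[OF cp s] sec[OF cps s] cut_continuous)
          (auto simp: out)
      ultimately have "(\<Phi> e has_field_derivative (\<integral>x. G' s x \<partial>lborel)) (at s within {\<alpha><..<\<beta>})"
        using s by (auto intro: has_field_derivative_transform_within[OF _ zero_less_one])
      then show ?thesis using s by (simp add: at_within_open[OF s])
    qed
    have bound: "\<bar>\<integral>x. G' s x \<partial>lborel\<bar> \<le> e * L * m" if s: "s \<in> {\<alpha><..<\<beta>}" for s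
    proof -
      have s0: "s > 0" by (rule pos[OF s])
      have c: "continuous_on UNIV (f s)" "continuous_on UNIV (ft s)" "continuous_on UNIV (p s)" "continuous_on UNIV (ps s)"
        "continuous_on UNIV (gf s)" "\<And>i. continuous_on UNIV (\<lambda>x. dF s x i)"
        "\<And>i. continuous_on UNIV (p1 i s)" "\<And>i. continuous_on UNIV (p2 i s)"
        using s0 s sec[OF cf] sec[OF cft] sec[OF cgf] sec[OF cdF] sec[OF cp] sec[OF cps] sec[OF cp1] sec[OF cp2]
        by auto
      note [continuous_intros] = c cut_continuous
      have weak: "(\<integral>x. (\<Sum>i\<in>UNIV. dF s x i) * (p s x * cut e x) \<partial>lborel) =
        (\<integral>x. f s x * ((\<Sum>i\<in>UNIV. d i * \<phi>2 i s x) - (\<Sum>i\<in>UNIV. (C *v x) $ i * \<phi>1 i s x)) \<partial>lborel)"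
      proof (rule weak_form_fixed_time[where gf = "gf s" and r = "exp (1 / e)" and dF = "\<lambda>i x. dF s x i"])
        show "((\<lambda>h. d i * gf s (x + h *\<^sub>R axis i 1) $ i + f s (x + h *\<^sub>R axis i 1) * (C *v (x + h *\<^sub>R axis i 1)) $ i)
          has_real_derivative dF s x i) (at 0)" for x i
          using ddF[OF s0, of x i] by (simp add: D_component)
        show "((\<lambda>h. p s (x + h *\<^sub>R axis i 1) * cut e (x + h *\<^sub>R axis i 1)) has_real_derivative \<phi>1 i s x) (at 0)" for x i
          by (rule DERIV_cong[OF DERIV_mult[OF p1[OF s] DERIV_cut]]) (simp add: \<phi>1_def)
        show "((\<lambda>h. \<phi>1 i s (x + h *\<^sub>R axis i 1)) has_real_derivative \<phi>2 i s x) (at 0)" for x i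
          unfolding \<phi>1_def
          by (rule DERIV_cong[OF DERIV_add[OF DERIV_mult[OF p2[OF s] DERIV_cut] DERIV_mult[OF p1[OF s] DERIV_cut1]]])
            (simp add: \<phi>2_def)
        show "p s x * cut e x = 0 \<and> \<phi>1 i s x = 0 \<and> \<phi>2 i s x = 0" if "exp (1 / e) \<le> norm x" for x i
          using cut_support[OF e(1) that, where i = i] by (simp add: \<phi>1_def \<phi>2_def)
      qed (use dgf[OF s0] in \<open>auto intro!: continuous_intros simp: \<phi>1_def \<phi>2_def\<close>)
      define H where "H x = f s x * ((ps s x * cut e x + (\<Sum>i\<in>UNIV. d i * \<phi>2 i s x)) - (\<Sum>i\<in>UNIV. (C *v x) $ i * \<phi>1 i s x))" for x
      have out2: "\<phi>1 i s x = 0" "\<phi>2 i s x = 0" "cut e x = 0" if "x \<notin> cbox l u" for x i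
      proof -
        have "norm x \<ge> exp (1 / e)" using that lu by (force simp: mem_cball)
        then have "cut e x = 0 \<and> cut1 e i x = 0 \<and> cut2 e i x = 0" by (rule cut_support[OF e(1)])
        then show "\<phi>1 i s x = 0" "\<phi>2 i s x = 0" "cut e x = 0" by (auto simp: \<phi>1_def \<phi>2_def)
      qed
      have c\<phi>: "continuous_on UNIV (\<phi>1 i s)" "continuous_on UNIV (\<phi>2 i s)" for i
        unfolding \<phi>1_def[abs_def] \<phi>2_def[abs_def] by (auto intro!: continuous_intros)
      note [continuous_intros] = c\<phi>
      have i1: "integrable lborel (\<lambda>x. f s x * ((\<Sum>i\<in>UNIV. d i * \<phi>2 i s x) - (\<Sum>i\<in>UNIV. (C *v x) $ i * \<phi>1 i s x)))"
        by (rule compact_support_integral(1)[where a = l and b = u]) (auto intro!: continuous_intros simp: out2)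
      have i2: "integrable lborel (\<lambda>x. f s x * (ps s x * cut e x))"
        by (rule compact_support_integral(1)[where a = l and b = u]) (auto intro!: continuous_intros simp: out2)
      have i3: "integrable lborel (\<lambda>x. ft s x * (p s x * cut e x))"
        by (rule compact_support_integral(1)[where a = l and b = u]) (auto intro!: continuous_intros simp: out2)
      have "(\<integral>x. G' s x \<partial>lborel) = (\<integral>x. ft s x * (p s x * cut e x) \<partial>lborel) + (\<integral>x. f s x * (ps s x * cut e x) \<partial>lborel)"
        unfolding G'_def using i2 i3 by simp
      also have "(\<integral>x. ft s x * (p s x * cut e x) \<partial>lborel) =
         (\<integral>x. f s x * ((\<Sum>i\<in>UNIV. d i * \<phi>2 i s x) - (\<Sum>i\<in>UNIV. (C *v x) $ i * \<phi>1 i s x)) \<partial>lborel)"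
        unfolding weak[symmetric] using ft[OF s0] by simp
      also have "\<dots> + (\<integral>x. f s x * (ps s x * cut e x) \<partial>lborel) = (\<integral>x. H x \<partial>lborel)"
        unfolding Bochner_Integration.integral_add[OF i1 i2, symmetric] H_def by (simp add: algebra_simps)
      finally have GH: "(\<integral>x. G' s x \<partial>lborel) = (\<integral>x. H x \<partial>lborel)" .
      have Hb: "\<bar>H x\<bar> \<le> f s x * (e * L)" for x
      proof -
        let ?A = "\<Sum>i\<in>UNIV. d i * (2 * p1 i s x * cut1 e i x + p s x * cut2 e i x)"
        let ?B = "\<Sum>i\<in>UNIV. (C *v x) $ i * (p s x * cut1 e i x)"
        \<comment> \<open>The terms in which the cutoff is not differentiated add up to the backward
          equation times \<open>cut e x\<close> and vanish; ?A and ?B are the commutators with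
          diffusion and drift.\<close>
        have "(ps s x * cut e x + (\<Sum>i\<in>UNIV. d i * \<phi>2 i s x)) - (\<Sum>i\<in>UNIV. (C *v x) $ i * \<phi>1 i s x)
          = (ps s x + (\<Sum>i\<in>UNIV. d i * p2 i s x) - (\<Sum>i\<in>UNIV. (C *v x) $ i * p1 i s x)) * cut e x + ?A - ?B"
          by (simp add: \<phi>1_def \<phi>2_def sum.distrib distrib_left distrib_right left_diff_distrib sum_distrib_right mult.assoc)
        then have H: "H x = f s x * (?A - ?B)" unfolding H_def eq[OF s] by simp
        have "\<bar>?A\<bar> \<le> (\<Sum>i\<in>(UNIV::'n set). e * (21 * B))"
        proof (rule order_trans[OF sum_abs], rule sum_mono)
          fix i
          have "\<bar>2 * p1 i s x * cut1 e i x\<bar> \<le> 2 * B * (3 * e)"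
            unfolding abs_mult using B(2)[OF s, where x = x and i = i] cut1_bound(1)[where e = e and i = i and x = x] e B0 by (intro mult_mono) auto
          moreover have "\<bar>p s x * cut2 e i x\<bar> \<le> B * (15 * e)"
            unfolding abs_mult using B(1)[OF s, of x] cut2_bound[where e = e and i = i and x = x] e B0 by (intro mult_mono) auto
          moreover have "e * (21 * B) = 2 * B * (3 * e) + B * (15 * e)" by (simp add: algebra_simps)
          ultimately have "\<bar>2 * p1 i s x * cut1 e i x + p s x * cut2 e i x\<bar> \<le> e * (21 * B)" by linarith
          moreover have "\<bar>d i\<bar> \<le> 1" using d01[of i] by auto
          ultimately have "\<bar>d i\<bar> * \<bar>2 * p1 i s x * cut1 e i x + p s x * cut2 e i x\<bar> \<le> 1 * (e * (21 * B))"
            by (intro mult_mono) auto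
          then show "\<bar>d i * (2 * p1 i s x * cut1 e i x + p s x * cut2 e i x)\<bar> \<le> e * (21 * B)"
            by (simp add: abs_mult)
        qed
        moreover have "\<bar>?B\<bar> \<le> (\<Sum>i\<in>(UNIV::'n set). e * (6 * norm C * B))"
        proof (rule order_trans[OF sum_abs], rule sum_mono)
          fix i
          have "\<bar>(C *v x) $ i\<bar> \<le> norm C * norm x"
            using component_le_norm_cart[of "C *v x" i] norm_matrix_vector_le[of C x] by linarith
          then have "\<bar>(C *v x) $ i\<bar> * \<bar>cut1 e i x\<bar> \<le> (norm C * norm x) * \<bar>cut1 e i x\<bar>"
            by (intro mult_right_mono) auto
          also have "\<dots> = norm C * (norm x * \<bar>cut1 e i x\<bar>)" by simp
          also have "\<dots> \<le> norm C * (6 * e)" by (rule mult_left_mono[OF cut1_bound(2)]) (use e in auto)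
          finally have "\<bar>p s x\<bar> * (\<bar>(C *v x) $ i\<bar> * \<bar>cut1 e i x\<bar>) \<le> B * (norm C * (6 * e))"
            by (rule mult_mono[OF B(1)[OF s]]) (use B0 in auto)
          then show "\<bar>(C *v x) $ i * (p s x * cut1 e i x)\<bar> \<le> e * (6 * norm C * B)"
            by (simp add: abs_mult mult_ac)
        qed
        moreover have "e * L = (\<Sum>i\<in>(UNIV::'n set). e * (21 * B)) + (\<Sum>i\<in>(UNIV::'n set). e * (6 * norm C * B))"
          by (simp add: L_def algebra_simps)
        ultimately have "\<bar>?A - ?B\<bar> \<le> e * L" by linarith
        then show ?thesis unfolding H using f0[OF s0, of x] by (simp add: abs_mult mult_left_mono)
      qed
      have "\<bar>\<integral>x. H x \<partial>lborel\<bar> \<le> (\<integral>x. f s x * (e * L) \<partial>lborel)"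
      proof (rule order_trans[OF integral_abs_bound], rule integral_mono)
        show "integrable lborel (\<lambda>x. f s x * (e * L))" using int_f[OF s0] by simp
        have "continuous_on UNIV H" unfolding H_def[abs_def] by (intro continuous_intros)
        then show "integrable lborel (\<lambda>x. \<bar>H x\<bar>)"
          by (intro integrable_abs compact_support_integral(1)[where a = l and b = u]) (auto simp: H_def out2)
        show "\<bar>H x\<bar> \<le> f s x * (e * L)" for x by (rule Hb)
      qed
      also have "\<dots> = (e * L) * (\<integral>x. f s x \<partial>lborel)" by simp
      also have "\<dots> \<le> (e * L) * m" using m[OF s0] e L0 by (intro mult_left_mono) auto
      finally show ?thesis unfolding GH .
    qed
    have "norm (\<Phi> e s2 - \<Phi> e s1) \<le> (e * L * m) * norm (s2 - s1)"
      by (rule field_differentiable_bound[where S = "{\<alpha><..<\<beta>}"])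
        (use deriv bound mem in \<open>auto intro: has_field_derivative_at_within\<close>)
    then show ?thesis using ab by simp
  qed
  have lim: "(\<lambda>n. \<Phi> (1 / real (Suc n)) s) \<longlonglongrightarrow> (\<integral>x. f s x * p s x \<partial>lborel)" if s: "s \<in> {\<alpha><..<\<beta>}" for s
    unfolding \<Phi>_def
  proof (rule integral_dominated_convergence)
    have s0: "s > 0" by (rule pos[OF s])
    have c: "continuous_on UNIV (f s)" "continuous_on UNIV (p s)"
      using s0 s sec[OF cf] sec[OF cp] by auto
    note [continuous_intros] = c cut_continuous
    show "(\<lambda>x. f s x * p s x) \<in> borel_measurable lborel"
      using borel_measurable_continuous_onI[of "\<lambda>x. f s x * p s x"] by (auto intro: continuous_intros)
    show "(\<lambda>x. f s x * (p s x * cut (1 / real (Suc n)) x)) \<in> borel_measurable lborel" for n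
    proof -
      have "continuous_on UNIV (\<lambda>x. f s x * (p s x * cut (1 / real (Suc n)) x))" by (intro continuous_intros)
      from borel_measurable_continuous_onI[OF this] show ?thesis by (simp only: measurable_lborel2)
    qed
    show "integrable lborel (\<lambda>x. f s x * B)" using int_f[OF s0] by simp
    show "AE x in lborel. (\<lambda>n. f s x * (p s x * cut (1 / real (Suc n)) x)) \<longlonglongrightarrow> f s x * p s x"
    proof (rule AE_I2)
      fix x
      have "(\<lambda>n. f s x * (p s x * cut (1 / real (Suc n)) x)) \<longlonglongrightarrow> f s x * (p s x * 1)"
        by (intro tendsto_intros cut_tendsto)
      then show "(\<lambda>n. f s x * (p s x * cut (1 / real (Suc n)) x)) \<longlonglongrightarrow> f s x * p s x" by simp
    qed
    show "AE x in lborel. norm (f s x * (p s x * cut (1 / real (Suc n)) x)) \<le> f s x * B" for n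
    proof (rule AE_I2)
      fix x
      have "\<bar>p s x\<bar> * \<bar>cut (1 / real (Suc n)) x\<bar> \<le> B * 1"
        using B(1)[OF s, of x] cut_bounds[of "1 / real (Suc n)" x] B0 by (intro mult_mono) auto
      then show "norm (f s x * (p s x * cut (1 / real (Suc n)) x)) \<le> f s x * B"
        using f0[OF s0, of x] by (simp add: abs_mult mult_left_mono)
    qed
  qed
  have "(\<lambda>n. \<Phi> (1 / real (Suc n)) s2 - \<Phi> (1 / real (Suc n)) s1) \<longlonglongrightarrow> 0"
  proof (rule Lim_null_comparison)
    show "\<forall>\<^sub>F n in sequentially. norm (\<Phi> (1 / real (Suc n)) s2 - \<Phi> (1 / real (Suc n)) s1) \<le> inverse (real (Suc n)) * (L * m * (s2 - s1))"
      using main[of "1 / real (Suc n)" for n] by (intro always_eventually) (simp add: divide_simps mult_ac)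
    show "(\<lambda>n. inverse (real (Suc n)) * (L * m * (s2 - s1))) \<longlonglongrightarrow> 0"
      by (rule tendsto_mult_left_zero[OF LIMSEQ_inverse_real_of_nat])
  qed
  moreover have "(\<lambda>n. \<Phi> (1 / real (Suc n)) s2 - \<Phi> (1 / real (Suc n)) s1) \<longlonglongrightarrow>
      (\<integral>x. f s2 x * p s2 x \<partial>lborel) - (\<integral>x. f s1 x * p s1 x \<partial>lborel)"
    by (intro tendsto_diff lim mem)
  ultimately show ?thesis using LIMSEQ_unique by fastforce
qed

end

section \<open>Duality with the Gaussian kernel\<close>

lemma gaussian_integrable:
  fixes c :: real
  assumes c: "c > 0"
  shows "integrable lborel (\<lambda>x::'a::euclidean_space. exp (- (c * (x \<bullet> x))))"
proof (rule integrableI_bounded)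
  define \<sigma> where "\<sigma> = 1 / sqrt (2 * c)"
  have \<sigma>: "\<sigma> > 0" "2 * \<sigma>\<^sup>2 = 1 / c" using c by (auto simp: \<sigma>_def power_divide)
  have nd: "exp (- (c * y\<^sup>2)) = sqrt (2 * pi * \<sigma>\<^sup>2) * normal_density 0 \<sigma> y" for y
    using \<sigma> c by (simp add: normal_density_def)
  have "integrable lborel (\<lambda>y::real. exp (- (c * y\<^sup>2)))"
    unfolding nd using \<sigma>(1) by simp
  then have fin: "(\<integral>\<^sup>+y. ennreal (exp (- (c * y\<^sup>2))) \<partial>lborel) < \<infinity>"
    using nn_integral_eq_integral[of lborel "\<lambda>y::real. exp (- (c * y\<^sup>2))"] by simp
  have "(\<integral>\<^sup>+(x::'a). ennreal (norm (exp (- (c * (x \<bullet> x))))) \<partial>lborel)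
    = (\<integral>\<^sup>+(x::'a). (\<Prod>b\<in>Basis. ennreal (exp (- (c * (x \<bullet> b)\<^sup>2)))) \<partial>lborel)"
  proof (intro nn_integral_cong)
    fix x :: 'a
    have "- (c * (x \<bullet> x)) = (\<Sum>b\<in>Basis. - (c * (x \<bullet> b)\<^sup>2))"
      by (subst euclidean_inner) (simp add: sum_distrib_left sum_negf power2_eq_square)
    then have "exp (- (c * (x \<bullet> x))) = (\<Prod>b\<in>Basis. exp (- (c * (x \<bullet> b)\<^sup>2)))"
      by (simp only: exp_sum[OF finite_Basis])
    then show "ennreal (norm (exp (- (c * (x \<bullet> x))))) = (\<Prod>b\<in>Basis. ennreal (exp (- (c * (x \<bullet> b)\<^sup>2))))"
      by (simp add: prod_ennreal prod_nonneg)
  qed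
  also have "\<dots> = (\<Prod>b\<in>(Basis::'a set). (\<integral>\<^sup>+y. ennreal (exp (- (c * y\<^sup>2))) \<partial>lborel))"
    by (rule nn_integral_lborel_prod) auto
  also have "\<dots> < \<infinity>" using fin by (auto simp: less_top[symmetric] power_eq_top_ennreal)
  finally show "(\<integral>\<^sup>+(x::'a). ennreal (norm (exp (- (c * (x \<bullet> x))))) \<partial>lborel) < \<infinity>" .
qed (auto intro!: borel_measurable_continuous_onI continuous_intros)

lemma exp_quadratic_integrable:
  fixes A :: "real^'n^'n"
  assumes "c > 0" "\<And>v. c * (norm v)\<^sup>2 \<le> v \<bullet> (A *v v)"
  shows "integrable lborel (\<lambda>x. exp (- (x \<bullet> (A *v x)) / 2))"
proof (rule Bochner_Integration.integrable_bound)
  show "integrable lborel (\<lambda>x::real^'n. exp (- ((c / 2) * (x \<bullet> x))))"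
    using assms by (intro gaussian_integrable) auto
  have "continuous_on UNIV (\<lambda>x. exp (- (x \<bullet> (A *v x)) / 2))" by (intro continuous_intros) auto
  from borel_measurable_continuous_onI[OF this]
  show "(\<lambda>x. exp (- (x \<bullet> (A *v x)) / 2)) \<in> borel_measurable lborel" by (simp only: measurable_lborel2)
  show "AE x in lborel. norm (exp (- (x \<bullet> (A *v x)) / 2)) \<le> norm (exp (- ((c / 2) * (x \<bullet> x))))"
    using assms(2) by (intro AE_I2) (simp add: power2_norm_eq_inner)
qed

lemma mult_exp_bound:
  fixes u c :: real
  assumes "c > 0" "u \<ge> 0"
  shows "u * exp (- (c * u\<^sup>2) / 2) \<le> 1 + 2 / c"
proof -
  have "u \<le> (1 + 2 / c) * (1 + c * u\<^sup>2 / 2)"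
  proof (cases "u \<le> 1")
    case True
    have "1 * 1 \<le> (1 + 2 / c) * (1 + c * u\<^sup>2 / 2)" using assms by (intro mult_mono) auto
    then show ?thesis using True by simp
  next
    case False
    then have "u \<le> u\<^sup>2" by (simp add: power2_eq_square)
    also have "\<dots> = (2 / c) * (c * u\<^sup>2 / 2)" using assms by simp
    also have "\<dots> \<le> (1 + 2 / c) * (1 + c * u\<^sup>2 / 2)" using assms by (intro mult_mono) auto
    finally show ?thesis .
  qed
  also have "\<dots> \<le> (1 + 2 / c) * exp (c * u\<^sup>2 / 2)"
    using assms by (intro mult_left_mono exp_ge_add_one_self) auto
  finally have "u * exp (- (c * u\<^sup>2) / 2) \<le> (1 + 2 / c) * exp (c * u\<^sup>2 / 2) * exp (- (c * u\<^sup>2) / 2)"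
    by (rule mult_right_mono) simp
  also have "\<dots> = 1 + 2 / c" by (simp add: mult.assoc exp_add[symmetric])
  finally show ?thesis .
qed

lemma matrix_axis_component: "(A *v (axis i 1)) $ j = A $ j $ i" for A :: "real^'n^'m"
  by (simp add: matrix_vector_mult_basis column_def)

lemma has_real_derivative_affine_component:
  fixes A :: "real^'n^'m"
  shows "((\<lambda>h. (w + A *v (x + h *\<^sub>R axis i 1)) $ j) has_real_derivative A $ j $ i) (at 0)"
proof -
  have "(w + A *v (x + h *\<^sub>R axis i 1)) $ j = (w + A *v x) $ j + h * A $ j $ i" for h
    by (simp add: matrix_vector_right_distrib matrix_vector_mult_scaleR matrix_axis_component)
  then show ?thesis by (auto intro!: derivative_eq_intros)
qed

context fokker_planck
begin

text \<open>Up to normalisation, \<open>q r y x\<close> is the density at \<open>y\<close> of the diffusion started at \<open>x\<close> and run for time \<open>r\<close>;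
  \<open>score\<close> is the gradient of its logarithm in the initial point \<open>x\<close>.\<close>

definition z :: "real \<Rightarrow> real^'n \<Rightarrow> real^'n \<Rightarrow> real^'n" where "z r y x = y - E r *v x"
definition q :: "real \<Rightarrow> real^'n \<Rightarrow> real^'n \<Rightarrow> real" where
  "q r y x = exp (- (z r y x \<bullet> (R r *v z r y x)) / 2)"
definition score :: "real \<Rightarrow> real^'n \<Rightarrow> real^'n \<Rightarrow> real^'n" where
  "score r y x = transpose (E r) *v (R r *v z r y x)"

lemma R_sym: "r > 0 \<Longrightarrow> transpose (R r) = R r" unfolding R_def by (rule spd_inverse(3)[OF W_spd])

lemma R_nonneg: "r > 0 \<Longrightarrow> v \<bullet> (R r *v v) \<ge> 0"
  using spd_inverse_spd[OF W_spd, of r] unfolding R_def sym_pos_def_def by (cases "v = 0") (auto simp: less_imp_le)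

lemma q_bounds: "q r y x > 0" "r > 0 \<Longrightarrow> q r y x \<le> 1"
  using R_nonneg by (auto simp: q_def)

lemma q_axis_derivative:
  assumes r: "r > 0"
  shows "((\<lambda>h. q r y (x + h *\<^sub>R axis i 1)) has_real_derivative q r y x * score r y x $ i) (at 0)"
proof -
  let ?e = "axis i (1::real) :: real^'n"
  have eq: "z r y (x + h *\<^sub>R ?e) \<bullet> (R r *v z r y (x + h *\<^sub>R ?e))
    = z r y x \<bullet> (R r *v z r y x) - 2 * h * score r y x $ i + h\<^sup>2 * ((E r *v ?e) \<bullet> (R r *v (E r *v ?e)))" for h
  proof -
    have zz: "z r y (x + h *\<^sub>R ?e) = z r y x - h *\<^sub>R (E r *v ?e)"
      by (simp add: z_def matrix_vector_right_distrib matrix_vector_mult_scaleR)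
    have s1: "(E r *v ?e) \<bullet> (R r *v z r y x) = score r y x $ i"
      by (simp add: score_def inner_matrix_left inner_axis' del: transpose_matrix_vector)
    have s2: "z r y x \<bullet> (R r *v (E r *v ?e)) = score r y x $ i"
      using s1 inner_matrix_right[of "z r y x" "R r" "E r *v ?e"]
      by (simp add: R_sym[OF r] inner_commute del: transpose_matrix_vector)
    show ?thesis unfolding zz
      by (simp add: matrix_vector_mult_diff_distrib matrix_vector_mult_scaleR inner_diff s1 s2 power2_eq_square algebra_simps)
  qed
  have "((\<lambda>h. - (z r y x \<bullet> (R r *v z r y x) - 2 * h * score r y x $ i + h\<^sup>2 * ((E r *v ?e) \<bullet> (R r *v (E r *v ?e)))) / 2)
     has_real_derivative score r y x $ i) (at 0)"
    by (auto intro!: derivative_eq_intros)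
  then have "((\<lambda>h. - (z r y (x + h *\<^sub>R ?e) \<bullet> (R r *v z r y (x + h *\<^sub>R ?e))) / 2) has_real_derivative score r y x $ i) (at 0)"
    unfolding eq .
  from DERIV_chain2[OF DERIV_exp this] show ?thesis unfolding q_def by simp
qed

lemma score_axis_derivative:
  "((\<lambda>h. score r y (x + h *\<^sub>R axis i 1) $ i) has_real_derivative - (transpose (E r) ** R r ** E r) $ i $ i) (at 0)"
proof -
  have "score r y x = (transpose (E r) ** R r) *v y + (- (transpose (E r) ** R r ** E r)) *v x" for x
    by (simp add: score_def z_def matrix_vector_mul_assoc matrix_vector_mult_diff_distrib matrix_mul_assoc
        bounded_bilinear.minus_left[OF bounded_bilinear_matrix_vector] del: transpose_matrix_vector)
  then show ?thesis
    using has_real_derivative_affine_component[of "(transpose (E r) ** R r) *v y" "- (transpose (E r) ** R r ** E r)" x i i]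
    by simp
qed

text \<open>Since R' = - R W' R and W' = 2 E D E^T, the change of covariance contributes score . D
  score, and the motion of the mean contributes the drift. Compared with the backward equation only
  the trace part of the second derivatives of q is missing; it depends on r alone and is supplied by
  a scalar factor in \<open>duality_q\<close>.\<close>

lemma q_time_derivative:
  assumes r: "r > 0"
  shows "((\<lambda>r. q r y x) has_real_derivative
    q r y x * (score r y x \<bullet> (D *v score r y x) - (C *v x) \<bullet> score r y x)) (at r)"
proof -
  let ?z = "z r y x" and ?s = "score r y x"
  let ?z' = "E r *v (C *v x)" and ?R' = "- (R r ** (2 *\<^sub>R (E r ** D ** transpose (E r))) ** R r)"
  note bv = bounded_bilinear_matrix_vector
  have dz: "((\<lambda>r. z r y x) has_vector_derivative ?z') (at r)"
  proof -
    have "((\<lambda>r. z r y x) has_vector_derivative 0 - (E r *v 0 + (- (E r ** C)) *v x)) (at r)"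
      unfolding z_def by (intro has_vector_derivative_diff has_vector_derivative_const
          has_vector_derivative_matrix_vector E_derivative)
    then show ?thesis by (simp add: matrix_vector_mul_assoc bounded_bilinear.minus_left[OF bv])
  qed
  have "((\<lambda>r. z r y x \<bullet> (R r *v z r y x)) has_real_derivative
      ?z \<bullet> (R r *v ?z' + ?R' *v ?z) + ?z' \<bullet> (R r *v ?z)) (at r)"
    by (intro has_real_derivative_inner has_vector_derivative_matrix_vector dz R_derivative_continuous(1)[OF r])
  moreover have "?z' \<bullet> (R r *v ?z) = (C *v x) \<bullet> ?s"
    by (simp add: score_def inner_matrix_left del: transpose_matrix_vector)
  moreover have "?z \<bullet> (R r *v ?z') = (C *v x) \<bullet> ?s"
    using \<open>?z' \<bullet> (R r *v ?z) = (C *v x) \<bullet> ?s\<close> inner_matrix_right[of ?z "R r" ?z']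
    by (simp add: R_sym[OF r] inner_commute del: transpose_matrix_vector)
  moreover have "?z \<bullet> (?R' *v ?z) = - 2 * (?s \<bullet> (D *v ?s))"
  proof -
    have "?R' *v ?z = (- 2) *\<^sub>R (R r *v (E r *v (D *v ?s)))"
      by (simp add: score_def bounded_bilinear.minus_left[OF bv] bounded_bilinear.scaleR_left[OF bv]
          bounded_bilinear.scaleR_left[OF bounded_bilinear_matrix_matrix]
          bounded_bilinear.scaleR_right[OF bounded_bilinear_matrix_matrix]
          matrix_vector_mul_assoc matrix_mul_assoc del: transpose_matrix_vector)
    moreover have "?z \<bullet> (R r *v (E r *v (D *v ?s))) = ?s \<bullet> (D *v ?s)"
      by (simp add: score_def inner_matrix_right R_sym[OF r] del: transpose_matrix_vector)
    ultimately show ?thesis by simp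
  qed
  ultimately have "((\<lambda>r. z r y x \<bullet> (R r *v z r y x)) has_real_derivative
      2 * ((C *v x) \<bullet> ?s) - 2 * (?s \<bullet> (D *v ?s))) (at r)"
    by (simp add: inner_add_right)
  then have "((\<lambda>r. - (z r y x \<bullet> (R r *v z r y x)) / 2) has_real_derivative
      - (2 * ((C *v x) \<bullet> ?s) - 2 * (?s \<bullet> (D *v ?s))) / 2) (at r)"
    by (intro DERIV_cdivide DERIV_minus)
  from DERIV_chain2[OF DERIV_exp this] show ?thesis
    unfolding q_def by (rule DERIV_cong) (simp add: field_simps)
qed

lemma continuous_on_z:
  "continuous_on S r \<Longrightarrow> continuous_on S x \<Longrightarrow> continuous_on S (\<lambda>u. z (r u) y (x u))"
  unfolding z_def by (intro continuous_intros continuous_on_compose2[OF continuous_on_E[of UNIV]]) auto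

lemma continuous_on_score:
  assumes "continuous_on S r" "continuous_on S x" "\<And>u. u \<in> S \<Longrightarrow> r u > 0"
  shows "continuous_on S (\<lambda>u. score (r u) y (x u))"
  unfolding score_def
  by (intro continuous_intros continuous_on_z continuous_on_compose2[OF continuous_on_E[of UNIV]]
      continuous_on_compose2[OF continuous_on_R[OF subset_refl]] assms) (use assms in auto)

lemma continuous_on_q:
  assumes "continuous_on S r" "continuous_on S x" "\<And>u. u \<in> S \<Longrightarrow> r u > 0"
  shows "continuous_on S (\<lambda>u. q (r u) y (x u))"
  unfolding q_def
  by (intro continuous_intros continuous_on_z continuous_on_compose2[OF continuous_on_R[OF subset_refl]] assms)
    (use assms in auto)

text \<open>Measured in u = R z, the score grows at most linearly while q decays at least like exp
  (- c |u|^2 / 2), so the product is bounded independently of x and y. This is the gradient bound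
  that \<open>duality\<close> asks for.\<close>

lemma q_score_bound:
  assumes c: "c > 0" "\<And>v. c * (norm v)\<^sup>2 \<le> v \<bullet> (W r *v v)" and r: "r > 0"
  shows "\<bar>q r y x * score r y x $ i\<bar> \<le> norm (transpose (E r)) * (1 + 2 / c)"
proof -
  let ?u = "R r *v z r y x"
  have "c * (norm ?u)\<^sup>2 \<le> z r y x \<bullet> ?u"
    unfolding R_def by (rule spd_inverse_upper(1)[OF W_spd[OF r] c])
  then have q: "q r y x \<le> exp (- (c * (norm ?u)\<^sup>2) / 2)" by (simp add: q_def)
  have "\<bar>score r y x $ i\<bar> \<le> norm (transpose (E r)) * norm ?u"
    unfolding score_def using component_le_norm_cart norm_matrix_vector_le order_trans by blast
  then have "q r y x * \<bar>score r y x $ i\<bar> \<le> exp (- (c * (norm ?u)\<^sup>2) / 2) * (norm (transpose (E r)) * norm ?u)"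
    using q q_bounds(1)[of r y x] by (intro mult_mono) auto
  also have "\<dots> = norm (transpose (E r)) * (norm ?u * exp (- (c * (norm ?u)\<^sup>2) / 2))" by simp
  also have "\<dots> \<le> norm (transpose (E r)) * (1 + 2 / c)"
    by (intro mult_left_mono mult_exp_bound c) auto
  finally show ?thesis using q_bounds(1)[of r y x] by (simp add: abs_mult)
qed

text \<open>The factor \<open>e\<^sup>\<mu>\<close> in the proof plays the role of \<open>(det W)\<^sup>-\<^sup>1\<^sup>/\<^sup>2\<close>. As the constant \<open>a\<close> is the same for every
  solution, comparison with the stationary one eliminates it, and no determinant is ever computed.\<close>

lemma duality_q:
  assumes s: "0 < s1" "s1 < s2" "s2 < t"
  obtains a where "a > 0"
    "\<And>f y. classical f \<Longrightarrow> (\<integral>x. f s1 x * q (t - s1) y x \<partial>lborel) = a * (\<integral>x. f s2 x * q (t - s2) y x \<partial>lborel)"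
proof -
  \<comment> \<open>The margins confine r = t - s to a compact interval of positive times, on which
    E, the scalar factor and the coercivity of W have uniform bounds.\<close>
  define \<alpha> \<beta> where "\<alpha> = s1 / 2" and "\<beta> = (s2 + t) / 2"
  have ab: "0 \<le> \<alpha>" "\<alpha> < s1" "s1 \<le> s2" "s2 < \<beta>" "\<beta> < t" using s by (auto simp: \<alpha>_def \<beta>_def)
  define T where "T r = (\<Sum>i\<in>UNIV. d i * (transpose (E r) ** R r ** E r) $ i $ i)" for r
  let ?J = "{t - \<beta>..t - \<alpha>}"
  have Jpos: "?J \<subseteq> {0<..}" using ab by auto
  have cT: "continuous_on ?J (\<lambda>r. - T r)" unfolding T_def
    by (intro continuous_intros continuous_on_R Jpos)
  \<comment> \<open>An antiderivative of - T: under d/ds the factor exp (\<mu> (t - s)) acquires T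
    (t - s), which cancels the trace left over by the second derivatives of q.\<close>
  obtain \<mu> where \<mu>: "\<And>r. r \<in> ?J \<Longrightarrow> (\<mu> has_vector_derivative - T r) (at r within ?J)"
    using antiderivative_continuous[OF cT] by blast
  have \<mu>_deriv: "(\<mu> has_real_derivative - T r) (at r)" if "r \<in> {t - \<beta><..<t - \<alpha>}" for r
  proof -
    have "(\<mu> has_real_derivative - T r) (at r within ?J)"
      using \<mu>[of r] that by (simp add: has_real_derivative_iff_has_vector_derivative)
    then show ?thesis using that by (simp add: at_within_Icc_at)
  qed
  have c\<mu>: "continuous_on ?J \<mu>"
    using \<mu> has_vector_derivative_continuous continuous_on_eq_continuous_within by blast
  obtain b\<mu> where b\<mu>: "b\<mu> > 0" "\<And>r. r \<in> ?J \<Longrightarrow> exp (\<mu> r) \<le> b\<mu>"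
  proof -
    have "compact ((\<lambda>r. exp (\<mu> r)) ` ?J)" by (intro compact_continuous_image continuous_intros c\<mu>) auto
    then obtain b where "b > 0" "\<And>y. y \<in> (\<lambda>r. exp (\<mu> r)) ` ?J \<Longrightarrow> norm y \<le> b"
      using compact_imp_bounded bounded_pos by metis
    then show thesis using that[of b] by fastforce
  qed
  obtain bE where bE: "bE > 0" "\<And>r. r \<in> ?J \<Longrightarrow> norm (transpose (E r)) \<le> bE"
  proof -
    have "compact ((\<lambda>r. transpose (E r)) ` ?J)" by (intro compact_continuous_image continuous_intros) auto
    then obtain b where "b > 0" "\<And>y. y \<in> (\<lambda>r. transpose (E r)) ` ?J \<Longrightarrow> norm y \<le> b"
      using compact_imp_bounded bounded_pos by metis
    then show thesis using that[of b] by fastforce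
  qed
  obtain c where c: "c > 0" "\<And>s v. s \<ge> t - \<beta> \<Longrightarrow> c * (norm v)\<^sup>2 \<le> v \<bullet> (W s *v v)"
    using R_bound[of "t - \<beta>"] ab by auto
  define B where "B = b\<mu> * (1 + bE * (1 + 2 / c))"
  have rpos: "t - s > 0" "t - s \<in> ?J" "t - s \<in> {t - \<beta><..<t - \<alpha>}" if "s \<in> {\<alpha><..<\<beta>}" for s using that ab by auto
  have main: "(\<integral>x. f s1 x * (exp (\<mu> (t - s1)) * q (t - s1) y x) \<partial>lborel)
     = (\<integral>x. f s2 x * (exp (\<mu> (t - s2)) * q (t - s2) y x) \<partial>lborel)" if f: "classical f" for f y
  proof (rule duality[OF f ab(1-4), where B = B and
        ps = "\<lambda>s x. exp (\<mu> (t - s)) * q (t - s) y x *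
          (T (t - s) - (score (t - s) y x \<bullet> (D *v score (t - s) y x) - (C *v x) \<bullet> score (t - s) y x))" and
        ?p1.0 = "\<lambda>i s x. exp (\<mu> (t - s)) * (q (t - s) y x * score (t - s) y x $ i)" and
        ?p2.0 = "\<lambda>i s x. exp (\<mu> (t - s)) * (q (t - s) y x *
          (score (t - s) y x $ i * score (t - s) y x $ i - (transpose (E (t - s)) ** R (t - s) ** E (t - s)) $ i $ i))"])
    fix s x i assume s: "s \<in> {\<alpha><..<\<beta>}"
    note r = rpos[OF s]
    have ts: "((\<lambda>s. t - s) has_real_derivative - 1) (at s)" by (auto intro!: derivative_eq_intros)
    have d1: "((\<lambda>s. exp (\<mu> (t - s))) has_real_derivative exp (\<mu> (t - s)) * T (t - s)) (at s)"
      by (rule DERIV_cong[OF DERIV_chain2[OF DERIV_exp DERIV_chain2[OF \<mu>_deriv[OF r(3)] ts]]]) simp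
    show "((\<lambda>s. exp (\<mu> (t - s)) * q (t - s) y x) has_real_derivative exp (\<mu> (t - s)) * q (t - s) y x *
          (T (t - s) - (score (t - s) y x \<bullet> (D *v score (t - s) y x) - (C *v x) \<bullet> score (t - s) y x))) (at s)"
      by (rule DERIV_cong[OF DERIV_mult[OF d1 DERIV_chain2[OF q_time_derivative[OF r(1)] ts]]])
        (simp add: algebra_simps)
    show "((\<lambda>h. exp (\<mu> (t - s)) * q (t - s) y (x + h *\<^sub>R axis i 1)) has_real_derivative
        exp (\<mu> (t - s)) * (q (t - s) y x * score (t - s) y x $ i)) (at 0)"
      by (rule DERIV_cmult[OF q_axis_derivative[OF r(1)]])
    show "((\<lambda>h. exp (\<mu> (t - s)) * (q (t - s) y (x + h *\<^sub>R axis i 1) * score (t - s) y (x + h *\<^sub>R axis i 1) $ i))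
        has_real_derivative exp (\<mu> (t - s)) * (q (t - s) y x *
          (score (t - s) y x $ i * score (t - s) y x $ i - (transpose (E (t - s)) ** R (t - s) ** E (t - s)) $ i $ i))) (at 0)"
      by (rule DERIV_cmult, rule DERIV_cong[OF DERIV_mult[OF q_axis_derivative[OF r(1)] score_axis_derivative]])
        (simp add: algebra_simps)
    show "exp (\<mu> (t - s)) * q (t - s) y x *
          (T (t - s) - (score (t - s) y x \<bullet> (D *v score (t - s) y x) - (C *v x) \<bullet> score (t - s) y x)) +
       (\<Sum>i\<in>UNIV. d i * (exp (\<mu> (t - s)) * (q (t - s) y x *
          (score (t - s) y x $ i * score (t - s) y x $ i - (transpose (E (t - s)) ** R (t - s) ** E (t - s)) $ i $ i)))) -
       (\<Sum>i\<in>UNIV. (C *v x) $ i * (exp (\<mu> (t - s)) * (q (t - s) y x * score (t - s) y x $ i))) = 0"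
    proof -
      let ?p = "exp (\<mu> (t - s)) * q (t - s) y x" and ?s = "score (t - s) y x"
      have "(\<Sum>i\<in>UNIV. d i * (exp (\<mu> (t - s)) * (q (t - s) y x *
          (?s $ i * ?s $ i - (transpose (E (t - s)) ** R (t - s) ** E (t - s)) $ i $ i)))) = ?p * (?s \<bullet> (D *v ?s) - T (t - s))"
        by (simp add: D_inner T_def right_diff_distrib sum_subtractf sum_distrib_left mult_ac)
      moreover have "(\<Sum>i\<in>UNIV. (C *v x) $ i * (exp (\<mu> (t - s)) * (q (t - s) y x * ?s $ i))) = ?p * ((C *v x) \<bullet> ?s)"
        by (simp add: inner_vec_def sum_distrib_left mult_ac)
      ultimately show ?thesis by (simp add: algebra_simps)
    qed
    have "exp (\<mu> (t - s)) * q (t - s) y x \<le> b\<mu> * 1"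
      by (rule mult_mono) (use b\<mu>(1) b\<mu>(2)[OF r(2)] q_bounds[of "t - s" y x] r(1) in auto)
    then have "\<bar>exp (\<mu> (t - s)) * q (t - s) y x\<bar> \<le> b\<mu> * 1"
      using q_bounds(1)[of "t - s" y x] by (simp add: abs_mult)
    also have "\<dots> \<le> B" unfolding B_def using b\<mu>(1) bE(1) c(1) by (intro mult_left_mono) auto
    finally show "\<bar>exp (\<mu> (t - s)) * q (t - s) y x\<bar> \<le> B" .
    have "\<bar>exp (\<mu> (t - s)) * (q (t - s) y x * score (t - s) y x $ i)\<bar> = exp (\<mu> (t - s)) * \<bar>q (t - s) y x * score (t - s) y x $ i\<bar>"
      by (simp add: abs_mult)
    also have "\<dots> \<le> b\<mu> * (norm (transpose (E (t - s))) * (1 + 2 / c))"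
      using s by (intro mult_mono b\<mu>(2) r q_score_bound c) (use b\<mu> in auto)
    also have "\<dots> \<le> b\<mu> * (bE * (1 + 2 / c))"
      using bE(2)[OF r(2)] b\<mu>(1) c(1) by (intro mult_left_mono mult_right_mono) auto
    also have "\<dots> \<le> B" unfolding B_def using b\<mu>(1) by (intro mult_left_mono) auto
    finally show "\<bar>exp (\<mu> (t - s)) * (q (t - s) y x * score (t - s) y x $ i)\<bar> \<le> B" .
  next
    have p: "t - fst u > 0" if "u \<in> {\<alpha><..<\<beta>} \<times> UNIV" for u :: "real \<times> (real^'n)" using that ab by auto
    have c1: "continuous_on ({\<alpha><..<\<beta>} \<times> (UNIV :: (real^'n) set)) (\<lambda>u. t - fst u)" by (intro continuous_intros)
    have c2: "continuous_on ({\<alpha><..<\<beta>} \<times> (UNIV :: (real^'n) set)) (\<lambda>u. \<mu> (t - fst u))"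
      by (rule continuous_on_compose2[OF c\<mu> c1]) auto
    have c3: "continuous_on ({\<alpha><..<\<beta>} \<times> (UNIV :: (real^'n) set)) (\<lambda>u. q (t - fst u) y (snd u))"
      by (intro continuous_on_q c1 p continuous_intros)
    have c4: "continuous_on ({\<alpha><..<\<beta>} \<times> (UNIV :: (real^'n) set)) (\<lambda>u. score (t - fst u) y (snd u))"
      by (intro continuous_on_score c1 p continuous_intros)
    have c5: "continuous_on ({\<alpha><..<\<beta>} \<times> (UNIV :: (real^'n) set)) (\<lambda>u. transpose (E (t - fst u)) ** R (t - fst u) ** E (t - fst u))"
      by (intro continuous_intros continuous_on_compose2[OF continuous_on_E[of UNIV] c1]
          continuous_on_compose2[OF continuous_on_R[OF subset_refl] c1]) (use p in auto)
    have c6: "continuous_on ({\<alpha><..<\<beta>} \<times> (UNIV :: (real^'n) set)) (\<lambda>u. T (t - fst u))"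
      unfolding T_def by (intro continuous_intros c5)
    note cc = c2 c3 c4 c5 c6
    show "continuous_on ({\<alpha><..<\<beta>} \<times> UNIV) (\<lambda>(s, x). exp (\<mu> (t - s)) * q (t - s) y x)"
      unfolding split_beta by (intro continuous_intros cc)
    show "continuous_on ({\<alpha><..<\<beta>} \<times> UNIV) (\<lambda>(s, x). exp (\<mu> (t - s)) * q (t - s) y x *
          (T (t - s) - (score (t - s) y x \<bullet> (D *v score (t - s) y x) - (C *v x) \<bullet> score (t - s) y x)))"
      unfolding split_beta by (intro continuous_intros cc)
    show "continuous_on ({\<alpha><..<\<beta>} \<times> UNIV) (\<lambda>(s, x). exp (\<mu> (t - s)) * (q (t - s) y x * score (t - s) y x $ i))" for i
      unfolding split_beta by (intro continuous_intros cc)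
    show "continuous_on ({\<alpha><..<\<beta>} \<times> UNIV) (\<lambda>(s, x). exp (\<mu> (t - s)) * (q (t - s) y x *
          (score (t - s) y x $ i * score (t - s) y x $ i - (transpose (E (t - s)) ** R (t - s) ** E (t - s)) $ i $ i)))" for i
      unfolding split_beta by (intro continuous_intros cc)
  qed
  show thesis
  proof (rule that[of "exp (\<mu> (t - s2)) / exp (\<mu> (t - s1))"])
    fix f y assume "classical f"
    have pull: "(\<integral>x. f s x * (k * q r y x) \<partial>lborel) = k * (\<integral>x. f s x * q r y x \<partial>lborel)" for s k r
      by (simp only: mult.left_commute[of _ k] integral_mult_right_zero)
    show "(\<integral>x. f s1 x * q (t - s1) y x \<partial>lborel) =
       exp (\<mu> (t - s2)) / exp (\<mu> (t - s1)) * (\<integral>x. f s2 x * q (t - s2) y x \<partial>lborel)"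
      using main[OF \<open>classical f\<close>, of y] unfolding pull by (simp add: nonzero_eq_divide_eq mult.commute)
  qed simp
qed

end

section \<open>The equilibrium and the Markov kernel\<close>

lemma lborel_integrable_translate:
  fixes u :: "'a::euclidean_space \<Rightarrow> real"
  assumes "integrable lborel u"
  shows "integrable lborel (\<lambda>x. u (x + c))"
proof -
  have "integrable (distr lborel borel ((+) c)) u" using assms by (simp add: lborel_distr_plus)
  then have "integrable lborel (\<lambda>x. u (c + x))"
    by (subst (asm) integrable_distr_eq) (use assms in auto)
  then show ?thesis by (simp add: add.commute)
qed

lemma exp_quadratic_axis_derivative:
  fixes A :: "real^'n^'n"
  assumes A: "transpose A = A"
  shows "((\<lambda>h. exp (- ((x + h *\<^sub>R axis i 1) \<bullet> (A *v (x + h *\<^sub>R axis i 1))) / 2)) has_real_derivative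
    exp (- (x \<bullet> (A *v x)) / 2) * - (A *v x) $ i) (at 0)"
proof -
  let ?e = "axis i (1::real) :: real^'n"
  have s1: "?e \<bullet> (A *v x) = (A *v x) $ i" by (simp add: inner_axis')
  have s2: "x \<bullet> (A *v ?e) = (A *v x) $ i"
    using s1 inner_matrix_right[of x A ?e] by (simp add: A inner_commute)
  have eq: "(x + h *\<^sub>R ?e) \<bullet> (A *v (x + h *\<^sub>R ?e)) = x \<bullet> (A *v x) + 2 * h * (A *v x) $ i + h\<^sup>2 * (?e \<bullet> (A *v ?e))" for h
    by (simp add: matrix_vector_right_distrib matrix_vector_mult_scaleR inner_add s1 s2 power2_eq_square algebra_simps)
  have "((\<lambda>h. - (x \<bullet> (A *v x) + 2 * h * (A *v x) $ i + h\<^sup>2 * (?e \<bullet> (A *v ?e))) / 2)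
     has_real_derivative - (A *v x) $ i) (at 0)"
    by (auto intro!: derivative_eq_intros)
  then have "((\<lambda>h. - ((x + h *\<^sub>R ?e) \<bullet> (A *v (x + h *\<^sub>R ?e))) / 2) has_real_derivative - (A *v x) $ i) (at 0)"
    unfolding eq .
  from DERIV_chain2[OF DERIV_exp this] show ?thesis by simp
qed

context fokker_planck
begin

definition Kinv :: "real^'n^'n" where "Kinv = matrix_inv K"
definition g :: "real^'n \<Rightarrow> real" where "g x = exp (- (x \<bullet> (Kinv *v x)) / 2)"
text \<open>Conditional law in the equilibrium process: given the end point y after time r, the
  starting point is Gaussian with inverse covariance \<open>M r\<close>, mean
  \<open>B r *v y\<close> and density \<open>k r y\<close>. The mean is Cov(start, end) Var(end)^-1
  y with covariance K E^T. The normalising factor \<open>G r\<close> is kept as an integral, which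
  does not depend on y.\<close>

definition M :: "real \<Rightarrow> real^'n^'n" where "M r = Kinv + transpose (E r) ** R r ** E r"
definition B :: "real \<Rightarrow> real^'n^'n" where "B r = K ** transpose (E r) ** Kinv"
definition G :: "real \<Rightarrow> real" where "G r = (\<integral>x. exp (- (x \<bullet> (M r *v x)) / 2) \<partial>lborel)"
definition k :: "real \<Rightarrow> real^'n \<Rightarrow> real^'n \<Rightarrow> real" where
  "k r y x = exp (- ((x - B r *v y) \<bullet> (M r *v (x - B r *v y))) / 2) / G r"

lemma Kinv_sym: "transpose Kinv = Kinv" unfolding Kinv_def by (rule spd_inverse(3)[OF K_spd])

lemma Kinv_inverse: "K ** Kinv = mat 1" "Kinv ** K = mat 1"
  unfolding Kinv_def by (rule spd_inverse[OF K_spd])+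

lemma Kinv_coercive: obtains c where "c > 0" "\<And>v. c * (norm v)\<^sup>2 \<le> v \<bullet> (Kinv *v v)"
  using quadratic_form_coercive[of Kinv] spd_inverse_spd[OF K_spd] unfolding Kinv_def sym_pos_def_def by blast

lemma g_pos [simp]: "g x > 0" by (simp add: g_def)

lemma continuous_on_g: "continuous_on S x \<Longrightarrow> continuous_on S (\<lambda>u. g (x u))"
  unfolding g_def by (intro continuous_intros) auto

lemma g_integrable: "integrable lborel g"
proof -
  obtain c where c: "c > 0" "\<And>v. c * (norm v)\<^sup>2 \<le> v \<bullet> (Kinv *v v)" using Kinv_coercive by blast
  show ?thesis unfolding g_def[abs_def] by (rule exp_quadratic_integrable[OF c])
qed

lemma g_axis_derivative: "((\<lambda>h. g (x + h *\<^sub>R axis i 1)) has_real_derivative g x * - (Kinv *v x) $ i) (at 0)"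
  unfolding g_def by (rule exp_quadratic_axis_derivative[OF Kinv_sym])

text \<open>The flux of g is g A x with A = C - D K^-1 = S K^-1, and the Lyapunov equation says that
  S = C K - D is antisymmetric. Both parts of the divergence vanish for this reason: K^-1 x . A x is
  the form of S at K^-1 x, and the trace of A pairs an antisymmetric with a symmetric
  matrix.\<close>

lemma classical_g: "classical (\<lambda>t. g)"
proof -
  define A where "A = C - D ** Kinv"
  define S where "S = C ** K - D"
  have AS: "A = S ** Kinv"
    unfolding A_def S_def
    by (simp add: bounded_bilinear.diff_left[OF bounded_bilinear_matrix_matrix] matrix_mul_assoc[symmetric] Kinv_inverse)
  have D_sym: "transpose D = D" by (auto simp: transpose_def vec_eq_iff D_diag)
  have S_anti: "transpose S = - S"
  proof -
    have "transpose S = transpose (C ** K) - transpose D" unfolding S_def by (simp add: transpose_def vec_eq_iff)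
    also have "\<dots> = (2 *\<^sub>R D - C ** K) - D" unfolding K_eq by (simp add: matrix_transpose_mul K_sym D_sym)
    also have "\<dots> = - S" by (simp add: S_def scaleR_2)
    finally show ?thesis .
  qed
  have S_entry: "S $ j $ i = - S $ i $ j" for i j
  proof -
    have "S $ j $ i = transpose S $ i $ j" by (simp add: transpose_def)
    then show ?thesis by (simp add: S_anti)
  qed
  have orth: "(Kinv *v x) \<bullet> (A *v x) = 0" for x
  proof -
    let ?w = "Kinv *v x"
    have "?w \<bullet> (S *v ?w) = (transpose S *v ?w) \<bullet> ?w" by (rule inner_matrix_right)
    also have "\<dots> = - (?w \<bullet> (S *v ?w))"
      unfolding S_anti by (simp add: bounded_bilinear.minus_left[OF bounded_bilinear_matrix_vector] inner_commute)
    finally show ?thesis by (simp add: AS matrix_vector_mul_assoc)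
  qed
  have Kinv_entry: "Kinv $ j $ i = Kinv $ i $ j" for i j
  proof -
    have "Kinv $ j $ i = transpose Kinv $ i $ j" by (simp add: transpose_def)
    then show ?thesis by (simp only: Kinv_sym)
  qed
  have trace: "(\<Sum>i\<in>UNIV. A $ i $ i) = 0"
  proof -
    have "(\<Sum>i\<in>UNIV. A $ i $ i) = (\<Sum>i\<in>UNIV. \<Sum>j\<in>UNIV. S $ i $ j * Kinv $ j $ i)"
      by (simp add: AS matrix_matrix_mult_def)
    also have "\<dots> = (\<Sum>j\<in>UNIV. \<Sum>i\<in>UNIV. S $ i $ j * Kinv $ j $ i)" by (rule sum.swap)
    also have "\<dots> = (\<Sum>j\<in>UNIV. \<Sum>i\<in>UNIV. - (S $ j $ i * Kinv $ i $ j))"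
    proof (intro sum.cong refl)
      fix i j
      show "S $ i $ j * Kinv $ j $ i = - (S $ j $ i * Kinv $ i $ j)"
        by (subst S_entry[of j i], subst Kinv_entry[of i j]) simp
    qed
    also have "\<dots> = - (\<Sum>i\<in>UNIV. A $ i $ i)" by (simp add: AS matrix_matrix_mult_def sum_negf)
    finally show ?thesis by simp
  qed
  have flux: "(D *v (- g x *\<^sub>R (Kinv *v x)) + g x *\<^sub>R (C *v x)) $ i = g x * (0 + A *v x) $ i" for x i
    by (simp add: A_def matrix_vector_mult_scaleR matrix_vector_mult_diff_rdistrib matrix_vector_mul_assoc
        bounded_bilinear.minus_right[OF bounded_bilinear_matrix_vector] right_diff_distrib)
  have "classical_data (\<lambda>t. g) (\<lambda>t x. 0) (\<lambda>t x. - g x *\<^sub>R (Kinv *v x))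
     (\<lambda>t x i. g x * - (Kinv *v x) $ i * (0 + A *v x) $ i + A $ i $ i * g x)"
    unfolding classical_data_def
  proof (intro conjI allI impI)
    fix t :: real and x :: "real^'n" and i
    show "((\<lambda>h. g (x + h *\<^sub>R axis i 1)) has_real_derivative (- g x *\<^sub>R (Kinv *v x)) $ i) (at 0)"
      using g_axis_derivative[of x i] by simp
    show "((\<lambda>h. (D *v (- g (x + h *\<^sub>R axis i 1) *\<^sub>R (Kinv *v (x + h *\<^sub>R axis i 1))) +
        g (x + h *\<^sub>R axis i 1) *\<^sub>R (C *v (x + h *\<^sub>R axis i 1))) $ i) has_real_derivative
        g x * - (Kinv *v x) $ i * (0 + A *v x) $ i + A $ i $ i * g x) (at 0)"
      unfolding flux
      by (rule DERIV_cong[OF DERIV_mult[OF g_axis_derivative has_real_derivative_affine_component]]) simp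
    have "(\<Sum>i\<in>UNIV. g x * - (Kinv *v x) $ i * (0 + A *v x) $ i + A $ i $ i * g x)
      = g x * - ((Kinv *v x) \<bullet> (A *v x)) + (\<Sum>i\<in>UNIV. A $ i $ i) * g x"
      by (simp add: sum.distrib sum_subtractf inner_vec_def sum_distrib_left sum_distrib_right sum_negf mult.assoc)
    then show "0 = (\<Sum>i\<in>UNIV. g x * - (Kinv *v x) $ i * (0 + A *v x) $ i + A $ i $ i * g x)"
      by (simp add: orth trace)
  qed (auto simp: split_beta intro!: continuous_intros continuous_on_g)
  moreover have "\<exists>m. \<forall>t>0::real. integrable lborel g \<and> (\<integral>x. g x \<partial>lborel) \<le> m"
    using g_integrable by auto
  ultimately show ?thesis unfolding classical_def by (auto simp: less_imp_le)
qed

text \<open>Follows from E K E^T = K - W and R W = 1. It matches the cross terms in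
  \<open>complete_square\<close>, that is, it identifies B y as the conditional mean.\<close>

lemma MB: assumes r: "r > 0" shows "M r *v (B r *v y) = transpose (E r) *v (R r *v y)"
proof -
  note bm = bounded_bilinear_matrix_matrix
  have EKE: "E r ** K ** transpose (E r) = K - W r" by (simp add: W_def)
  have RW: "R r ** W r = mat 1" unfolding R_def by (rule spd_inverse(2)[OF W_spd[OF r]])
  have "M r ** B r = Kinv ** K ** transpose (E r) ** Kinv + transpose (E r) ** R r ** (E r ** K ** transpose (E r)) ** Kinv"
    by (simp add: M_def B_def bounded_bilinear.add_left[OF bm] matrix_mul_assoc)
  also have "\<dots> = transpose (E r) ** Kinv + (transpose (E r) ** R r ** K ** Kinv - transpose (E r) ** (R r ** W r) ** Kinv)"
    unfolding EKE by (simp add: Kinv_inverse bounded_bilinear.diff_right[OF bm] bounded_bilinear.diff_left[OF bm] matrix_mul_assoc)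
  also have "\<dots> = transpose (E r) ** R r"
    unfolding RW by (simp add: matrix_mul_assoc[symmetric] Kinv_inverse)
  finally show ?thesis by (simp add: matrix_vector_mul_assoc del: transpose_matrix_vector)
qed

text \<open>The left-hand side is the variance, under \<open>k r y\<close>, of the linear functional
  that generates the shift of y along v. Its bound by v . R v is the source of the rate in
  time.\<close>

lemma BMB: assumes r: "r > 0" shows "(B r *v v) \<bullet> (M r *v (B r *v v)) = v \<bullet> (R r *v v) - v \<bullet> (Kinv *v v)"
proof -
  note bm = bounded_bilinear_matrix_matrix
  have "E r ** B r = (E r ** K ** transpose (E r)) ** Kinv" by (simp add: B_def matrix_mul_assoc)
  also have "\<dots> = mat 1 - W r ** Kinv"
    by (simp add: W_def bounded_bilinear.diff_left[OF bm] Kinv_inverse matrix_mul_assoc)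
  finally have EB: "E r *v (B r *v v) = v - W r *v (Kinv *v v)"
    by (simp add: matrix_vector_mul_assoc matrix_vector_mult_diff_rdistrib)
  have "(B r *v v) \<bullet> (M r *v (B r *v v)) = (E r *v (B r *v v)) \<bullet> (R r *v v)"
    unfolding MB[OF r] by (simp add: inner_matrix_left del: transpose_matrix_vector)
  also have "\<dots> = v \<bullet> (R r *v v) - (Kinv *v v) \<bullet> (W r *v (R r *v v))"
    unfolding EB by (simp add: inner_diff_left inner_matrix_left[of "W r"] W_sym del: transpose_matrix_vector)
  also have "W r *v (R r *v v) = v" unfolding R_def by (rule spd_inverse(4)[OF W_spd[OF r]])
  finally show ?thesis by (simp add: inner_commute)
qed

lemma M_sym: "r > 0 \<Longrightarrow> transpose (M r) = M r"
proof -
  assume r: "r > 0"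
  have "transpose (X + Y) = transpose X + transpose Y" for X Y :: "real^'n^'n"
    by (simp add: transpose_def vec_eq_iff)
  then show "transpose (M r) = M r"
    by (simp add: M_def matrix_transpose_mul Kinv_sym R_sym[OF r] matrix_mul_assoc)
qed

lemma M_form: "x \<bullet> (M r *v x) = x \<bullet> (Kinv *v x) + (E r *v x) \<bullet> (R r *v (E r *v x))"
  by (simp add: M_def matrix_vector_mult_add_rdistrib inner_add_right inner_matrix_left
      matrix_vector_mul_assoc matrix_mul_assoc del: transpose_matrix_vector)

text \<open>Bayes' formula in the exponents: the joint equilibrium density of start and end point is
  factored once from the start and once from the end. That the end point has the same Gaussian
  exponent as the start expresses invariance.\<close>

lemma complete_square:
  assumes r: "r > 0"
  shows "x \<bullet> (Kinv *v x) + z r y x \<bullet> (R r *v z r y x)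
    = y \<bullet> (Kinv *v y) + (x - B r *v y) \<bullet> (M r *v (x - B r *v y))"
proof -
  let ?By = "B r *v y" and ?Ex = "E r *v x"
  have c1: "x \<bullet> (M r *v ?By) = ?Ex \<bullet> (R r *v y)"
    unfolding MB[OF r] by (simp add: inner_matrix_left del: transpose_matrix_vector)
  have c2: "?By \<bullet> (M r *v x) = ?Ex \<bullet> (R r *v y)"
    using c1 inner_matrix_right[of ?By "M r" x] by (simp add: M_sym[OF r] inner_commute del: transpose_matrix_vector)
  have c3: "y \<bullet> (R r *v ?Ex) = ?Ex \<bullet> (R r *v y)"
    using inner_matrix_right[of y "R r" ?Ex] by (simp add: R_sym[OF r] inner_commute del: transpose_matrix_vector)
  have "(x - ?By) \<bullet> (M r *v (x - ?By)) = x \<bullet> (M r *v x) - 2 * (?Ex \<bullet> (R r *v y)) + ?By \<bullet> (M r *v ?By)"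
    by (simp add: matrix_vector_mult_diff_distrib inner_diff c1 c2)
  moreover have "z r y x \<bullet> (R r *v z r y x) = y \<bullet> (R r *v y) - 2 * (?Ex \<bullet> (R r *v y)) + ?Ex \<bullet> (R r *v ?Ex)"
    by (simp add: z_def matrix_vector_mult_diff_distrib inner_diff c3)
  ultimately show ?thesis by (simp only: BMB[OF r] M_form[of x])
qed

lemma M_integrable: assumes r: "r > 0" shows "integrable lborel (\<lambda>x. exp (- (x \<bullet> (M r *v x)) / 2))"
proof -
  obtain c where c: "c > 0" "\<And>v. c * (norm v)\<^sup>2 \<le> v \<bullet> (Kinv *v v)" using Kinv_coercive by blast
  have "c * (norm v)\<^sup>2 \<le> v \<bullet> (M r *v v)" for v
    using c(2)[of v] R_nonneg[OF r, of "E r *v v"] by (simp add: M_form)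
  then show ?thesis by (rule exp_quadratic_integrable[OF c(1)])
qed

lemma integrable_pos_integral_pos:
  fixes u :: "real^'n \<Rightarrow> real"
  assumes "integrable lborel u" "\<And>x. u x > 0"
  shows "(\<integral>x. u x \<partial>lborel) > 0"
proof -
  have "(\<integral>x. u x \<partial>lborel) \<noteq> 0"
  proof
    assume "(\<integral>x. u x \<partial>lborel) = 0"
    then have "AE x in lborel. u x = 0"
      using integral_nonneg_eq_0_iff_AE[OF assms(1)] assms(2) by (simp add: less_imp_le)
    then have "AE x in (lborel :: (real^'n) measure). False"
      by (rule AE_mp) (use assms(2) in \<open>auto intro!: AE_I2 simp: less_le\<close>)
    then show False
      using AE_iff_measurable[of UNIV "lborel :: (real^'n) measure" "\<lambda>x. False"] by simp
  qed
  moreover have "(\<integral>x. u x \<partial>lborel) \<ge> 0" using assms(2) by (intro integral_nonneg_AE AE_I2) (simp add: less_imp_le)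
  ultimately show ?thesis by simp
qed

lemma G_pos: "r > 0 \<Longrightarrow> G r > 0"
  unfolding G_def by (intro integrable_pos_integral_pos M_integrable) auto

lemma k_pos: "r > 0 \<Longrightarrow> k r y x > 0" by (simp add: k_def G_pos)

lemma g_q: "r > 0 \<Longrightarrow> g x * q r y x = g y * G r * k r y x"
  using complete_square[of r x y] G_pos[of r]
  by (simp add: g_def q_def k_def exp_add[symmetric] add_divide_distrib[symmetric] less_imp_neq[symmetric])

lemma k_prob: assumes r: "r > 0" shows "integrable lborel (k r y)" "(\<integral>x. k r y x \<partial>lborel) = 1"
proof -
  let ?u = "\<lambda>x. exp (- (x \<bullet> (M r *v x)) / 2)"
  have k: "k r y = (\<lambda>x. ?u (x + - (B r *v y)) / G r)" by (simp add: k_def fun_eq_iff)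
  have "integrable lborel (\<lambda>x. ?u (x + - (B r *v y)))"
    by (rule lborel_integrable_translate[OF M_integrable[OF r]])
  then show "integrable lborel (k r y)" unfolding k by simp
  have "?u \<in> borel_measurable borel" using M_integrable[OF r] by auto
  then have "(\<integral>x. ?u (x + - (B r *v y)) \<partial>lborel) = G r"
    unfolding G_def by (rule lborel_integral_translate)
  then show "(\<integral>x. k r y x \<partial>lborel) = 1" unfolding k using G_pos[OF r] by simp
qed

text \<open>Cameron-Martin formula: y enters the density only through the mean, and translating a
  Gaussian multiplies it by the exponential of a linear function with the matching quadratic
  correction.\<close>

lemma k_shift:
  assumes r: "r > 0"
  shows "k r (y + l *\<^sub>R v) x = k r y x *
    exp (l * ((x - B r *v y) \<bullet> (M r *v (B r *v v))) - l\<^sup>2 * ((B r *v v) \<bullet> (M r *v (B r *v v))) / 2)"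
proof -
  let ?w = "x - B r *v y" and ?b = "B r *v v"
  have w: "x - B r *v (y + l *\<^sub>R v) = ?w - l *\<^sub>R ?b"
    by (simp add: matrix_vector_right_distrib matrix_vector_mult_scaleR)
  have "(w - l *\<^sub>R b) \<bullet> (M r *v (w - l *\<^sub>R b)) = w \<bullet> (M r *v w) - 2 * l * (w \<bullet> (M r *v b)) + l\<^sup>2 * (b \<bullet> (M r *v b))" for w b
  proof -
    have c: "b \<bullet> (M r *v w) = w \<bullet> (M r *v b)"
      using inner_matrix_right[of b "M r" w] by (simp add: M_sym[OF r] inner_commute del: transpose_matrix_vector)
    show ?thesis
      by (simp add: matrix_vector_mult_diff_distrib matrix_vector_mult_scaleR inner_diff c power2_eq_square algebra_simps)
  qed
  from this[of ?w ?b] have e: "- ((?w - l *\<^sub>R ?b) \<bullet> (M r *v (?w - l *\<^sub>R ?b))) / 2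
    = - (?w \<bullet> (M r *v ?w)) / 2 + (l * (?w \<bullet> (M r *v ?b)) - l\<^sup>2 * (?b \<bullet> (M r *v ?b)) / 2)"
    by simp
  show ?thesis unfolding k_def w e exp_add by simp
qed

lemma q_measurable [measurable]: "r > 0 \<Longrightarrow> q r y \<in> borel_measurable borel"
  by (intro borel_measurable_continuous_onI continuous_on_q) (auto intro: continuous_on_id)

lemma integrable_mult_q: "r > 0 \<Longrightarrow> integrable lborel u \<Longrightarrow> integrable lborel (\<lambda>x. u x * q r y x)"
  for u :: "real^'n \<Rightarrow> real"
proof (rule Bochner_Integration.integrable_bound[of lborel u])
  assume r: "r > 0" and u: "integrable lborel u"
  show "(\<lambda>x. u x * q r y x) \<in> borel_measurable lborel"
    using borel_measurable_integrable[OF u] q_measurable[OF r, of y] by simp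
  show "AE x in lborel. norm (u x * q r y x) \<le> norm (u x)"
    using q_bounds[of r y] r by (intro AE_I2) (simp add: abs_mult mult_left_le less_imp_le)
qed

lemma integral_g_q: "r > 0 \<Longrightarrow> (\<integral>x. g x * q r y x \<partial>lborel) = g y * G r"
  using k_prob(2)[of r y] by (simp add: g_q)

text \<open>Inserting the equilibrium, for which \<open>integral_g_q\<close> evaluates both
  pairings, gives a = G (t - s1) / G (t - s2).\<close>

lemma ratio_constant:
  assumes f: "classical f" and s: "0 < s1" "s1 < s2" "s2 < t"
  shows "(\<integral>x. f s1 x * q (t - s1) y x \<partial>lborel) / G (t - s1) = (\<integral>x. f s2 x * q (t - s2) y x \<partial>lborel) / G (t - s2)"
proof -
  obtain a where a: "a > 0" and dual: "\<And>f y. classical f \<Longrightarrow>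
      (\<integral>x. f s1 x * q (t - s1) y x \<partial>lborel) = a * (\<integral>x. f s2 x * q (t - s2) y x \<partial>lborel)"
    using duality_q[OF s] by blast
  have "g y * G (t - s1) = a * (g y * G (t - s2))"
    using dual[OF classical_g, of y] s by (simp add: integral_g_q)
  then have "G (t - s1) = a * G (t - s2)" using g_pos[of y] by simp
  then show ?thesis using dual[OF f, of y] a by simp
qed

lemma integral_q_tendsto:
  fixes u :: "real^'n \<Rightarrow> real"
  assumes u: "integrable lborel u" and r: "r > 0" "\<And>n. rn n > 0" "rn \<longlonglongrightarrow> r"
  shows "(\<lambda>n. \<integral>x. u x * q (rn n) y x \<partial>lborel) \<longlonglongrightarrow> (\<integral>x. u x * q r y x \<partial>lborel)"
proof (rule integral_dominated_convergence[where w = "\<lambda>x. norm (u x)"])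
  show "(\<lambda>x. u x * q r y x) \<in> borel_measurable lborel" "(\<lambda>x. u x * q (rn n) y x) \<in> borel_measurable lborel" for n
    using integrable_mult_q[OF _ u] r by (auto intro: borel_measurable_integrable)
  show "AE x in lborel. (\<lambda>n. u x * q (rn n) y x) \<longlonglongrightarrow> u x * q r y x"
  proof (intro AE_I2 tendsto_intros)
    fix x
    have "continuous_on {0<..} (\<lambda>r. q r y x)" by (intro continuous_on_q continuous_intros) auto
    then have "isCont (\<lambda>r. q r y x) r" using r by (simp add: continuous_on_eq_continuous_at)
    then show "(\<lambda>n. q (rn n) y x) \<longlonglongrightarrow> q r y x" using r(3) by (rule isCont_tendsto_compose)
  qed
  show "AE x in lborel. norm (u x * q (rn n) y x) \<le> norm (u x)" for n
    using q_bounds[of "rn n" y] r(2)[of n] by (intro AE_I2) (simp add: abs_mult mult_left_le less_imp_le)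
qed (use u in simp)

lemma G_tendsto:
  assumes r: "r > 0" "\<And>n. rn n > 0" "rn \<longlonglongrightarrow> r"
  shows "(\<lambda>n. G (rn n)) \<longlonglongrightarrow> G r"
proof -
  have "(\<lambda>n. \<integral>x. g x * q (rn n) 0 x \<partial>lborel) \<longlonglongrightarrow> (\<integral>x. g x * q r 0 x \<partial>lborel)"
    by (rule integral_q_tendsto[OF g_integrable r])
  moreover have "g 0 = 1" by (simp add: g_def)
  ultimately show ?thesis using r by (simp add: integral_g_q)
qed

end

section \<open>Representation of solutions\<close>

context fokker_planck
begin

lemma R_upper:
  obtains c where "c > 0" "\<And>r v. 0 < r \<Longrightarrow> r \<le> 1 \<Longrightarrow> v \<bullet> (R r *v v) \<le> (norm v)\<^sup>2 / (c * r ^ (2 * tau + 1))"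
proof -
  obtain c where c: "c > 0" "\<And>t v. 0 < t \<Longrightarrow> t \<le> 1 \<Longrightarrow> c * t ^ (2 * tau + 1) * (norm v)\<^sup>2 \<le> v \<bullet> (W t *v v)"
    using W_lower by blast
  show thesis
  proof (rule that[OF c(1)])
    fix r v assume r: "0 < r" "r \<le> (1::real)"
    show "v \<bullet> (R r *v v) \<le> (norm v)\<^sup>2 / (c * r ^ (2 * tau + 1))"
      unfolding R_def
      by (rule spd_inverse_upper(3)[OF W_spd[OF r(1)] _ c(2)[OF r]]) (use c(1) r in simp)
  qed
qed

lemma E_bounded: obtains b where "b > 0" "\<And>r. 0 \<le> r \<Longrightarrow> r \<le> 1 \<Longrightarrow> norm (E r) \<le> b"
proof -
  have "compact (E ` {0..1})" by (intro compact_continuous_image continuous_on_E) auto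
  then obtain b where "b > 0" "\<And>y. y \<in> E ` {0..1} \<Longrightarrow> norm y \<le> b"
    using compact_imp_bounded bounded_pos by metis
  then show thesis using that[of b] by fastforce
qed

text \<open>On the ball of radius r^p, with p the exponent of the bound on R, one has |x|^2 \<le>
  r^p, which compensates R \<le> 1 / (c r^p); the exponent stays bounded there and G is at least a
  multiple of the volume. The crude power is enough because it only competes with exponentially
  small tails.\<close>

lemma G_lower:
  obtains a N where "a > 0" "\<And>r. 0 < r \<Longrightarrow> r \<le> 1 \<Longrightarrow> a * r ^ N \<le> G r"
proof -
  obtain c where c: "c > 0" "\<And>r v. 0 < r \<Longrightarrow> r \<le> 1 \<Longrightarrow> v \<bullet> (R r *v v) \<le> (norm v)\<^sup>2 / (c * r ^ (2 * tau + 1))"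
    using R_upper by blast
  obtain b where b: "b > 0" "\<And>r. 0 \<le> r \<Longrightarrow> r \<le> 1 \<Longrightarrow> norm (E r) \<le> b" using E_bounded by blast
  define p where "p = 2 * tau + 1"
  define c0 where "c0 = norm Kinv + b\<^sup>2 / c"
  have c0: "c0 \<ge> 0" using c by (simp add: c0_def)
  define a where "a = exp (- c0 / 2) * unit_ball_vol (real CARD('n))"
  show thesis
  proof (rule that[of a "p * CARD('n)"])
    show "a > 0" by (simp add: a_def)
    fix r :: real assume r: "0 < r" "r \<le> 1"
    let ?\<rho> = "r ^ p"
    have \<rho>: "0 < ?\<rho>" "?\<rho> \<le> 1" using r by (auto simp: power_le_one)
    have form: "x \<bullet> (M r *v x) \<le> c0" if x: "norm x \<le> ?\<rho>" for x
    proof -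
      have x2: "(norm x)\<^sup>2 \<le> ?\<rho>\<^sup>2" using x by (intro power_mono) auto
      have "?\<rho>\<^sup>2 \<le> ?\<rho>" using \<rho> by (simp add: power2_eq_square mult_left_le)
      then have x1: "(norm x)\<^sup>2 \<le> ?\<rho>" using x2 by linarith
      have "norm (E r *v x) \<le> b * norm x"
        using norm_matrix_vector_le[of "E r" x] b(2)[of r] r mult_right_mono[of "norm (E r)" b "norm x"] by simp
      then have "(norm (E r *v x))\<^sup>2 \<le> (b * norm x)\<^sup>2" by (intro power_mono) auto
      also have "\<dots> = b\<^sup>2 * (norm x)\<^sup>2" by (simp add: power_mult_distrib)
      also have "\<dots> \<le> b\<^sup>2 * ?\<rho>" using x1 by (intro mult_left_mono) auto
      finally have Ex: "(norm (E r *v x))\<^sup>2 \<le> b\<^sup>2 * ?\<rho>" .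
      have "(E r *v x) \<bullet> (R r *v (E r *v x)) \<le> (norm (E r *v x))\<^sup>2 / (c * ?\<rho>)"
        using c(2)[OF r] by (simp add: p_def)
      also have "\<dots> \<le> b\<^sup>2 * ?\<rho> / (c * ?\<rho>)" using Ex c(1) \<rho> by (intro divide_right_mono) auto
      also have "\<dots> = b\<^sup>2 / c" using r by simp
      finally have 2: "(E r *v x) \<bullet> (R r *v (E r *v x)) \<le> b\<^sup>2 / c" .
      have "x \<bullet> (Kinv *v x) \<le> norm Kinv * (norm x)\<^sup>2" by (rule quadratic_form_le)
      also have "\<dots> \<le> norm Kinv * 1" using x1 \<rho> by (intro mult_left_mono) auto
      finally show ?thesis using 2 by (simp add: M_form c0_def)
    qed
    have "a * r ^ (p * CARD('n)) = (\<integral>x. indicator (cball (0::real^'n) ?\<rho>) x * exp (- c0 / 2) \<partial>lborel)"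
      using \<rho> by (simp add: a_def content_cball power_mult)
    also have "\<dots> \<le> G r"
      unfolding G_def
    proof (rule integral_mono[OF _ M_integrable[OF r(1)]])
      show "integrable lborel (\<lambda>x::real^'n. indicator (cball 0 ?\<rho>) x * exp (- c0 / 2))"
        by (intro integrable_mult_left integrable_real_indicator) (use emeasure_bounded_finite[OF bounded_cball] in auto)
      show "indicator (cball 0 ?\<rho>) x * exp (- c0 / 2) \<le> exp (- (x \<bullet> (M r *v x)) / 2)" for x
        using form[of x] by (auto simp: indicator_def)
    qed
    finally show "a * r ^ (p * CARD('n)) \<le> G r" .
  qed
qed

text \<open>Away from y the kernel q is at most exp (- \<delta>^2 / (8 b r)), whereas G r decays no
  faster than a power of r. Hence q / G concentrates at y, uniformly over unbounded x.\<close>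

lemma q_tail:
  assumes \<delta>: "\<delta> > 0" and \<eta>: "\<eta> > 0"
  obtains r0 where "r0 > 0" "\<And>r x. 0 < r \<Longrightarrow> r < r0 \<Longrightarrow> norm (x - y) \<ge> \<delta> \<Longrightarrow> q r y x \<le> \<eta> * G r"
proof -
  obtain a N where a: "a > 0" "\<And>r. 0 < r \<Longrightarrow> r \<le> 1 \<Longrightarrow> a * r ^ N \<le> G r" using G_lower by blast
  obtain b where b: "b > 0" "\<And>t v. 0 \<le> t \<Longrightarrow> t \<le> 1 \<Longrightarrow> v \<bullet> (W t *v v) \<le> b * t * (norm v)\<^sup>2" using W_upper by blast
  \<comment> \<open>If E r is w-close to the identity, then \<bar>E r x - x\<bar> \<le> w (|x - y| +
    |y|) \<le> |x - y| / 4 + \<delta> / 4, so |z| \<ge> \<delta> / 2. Making w depend on |y| is what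
    allows arbitrarily large x.\<close>
  define w where "w = min (1/4) (\<delta> / (4 * (1 + norm y)))"
  have w: "w > 0" "w \<le> 1/4" "w * norm y \<le> \<delta> / 4"
  proof -
    have n: "1 + norm y > 0" by (smt (verit) norm_ge_zero)
    show "w > 0" using \<delta> n by (auto simp: w_def)
    show "w \<le> 1/4" unfolding w_def by (rule min.cobounded1)
    have "w * (1 + norm y) \<le> \<delta> / (4 * (1 + norm y)) * (1 + norm y)"
      using n by (intro mult_right_mono) (auto simp: w_def)
    also have "\<dots> = \<delta> / 4" using n by (simp add: divide_simps)
    finally show "w * norm y \<le> \<delta> / 4" using \<open>w > 0\<close> by (simp add: distrib_left)
  qed
  have "isCont E 0" using continuous_on_E[of UNIV] by (simp add: continuous_on_eq_continuous_at)
  then obtain r1 where r1: "r1 > 0" "\<And>r. norm (r - 0) < r1 \<Longrightarrow> norm (E r - E 0) < w"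
    using w(1) unfolding isCont_def LIM_eq by (metis diff_self norm_zero)
  \<comment> \<open>From exp (- u) \<le> (N+1)! / u^(N+1) with u = \<delta>^2 / (8 b r): one power
    of r more than in the lower bound of G, and this spare factor r supplies the smallness.\<close>
  define L where "L = fact (Suc N) * (8 * b / \<delta>\<^sup>2) ^ Suc N"
  have L: "L > 0" using b \<delta> by (simp add: L_def)
  define r0 where "r0 = min 1 (min r1 (\<eta> * a / L))"
  show thesis
  proof (rule that[of r0])
    show "r0 > 0" using r1 \<eta> a L by (simp add: r0_def)
    fix r x assume r: "0 < r" "r < r0" and x: "norm (x - y) \<ge> \<delta>"
    then have r': "r \<le> 1" "r < r1" "r * L \<le> \<eta> * a" using L by (auto simp: r0_def field_simps)
    have "norm (z r y x) \<ge> \<delta> / 2"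
    proof -
      have "x - y = (- z r y x) + (- ((E r - mat 1) *v x))"
        by (simp add: z_def matrix_vector_mult_diff_rdistrib)
      then have "norm (x - y) \<le> norm (z r y x) + norm ((E r - mat 1) *v x)"
        using norm_triangle_ineq[of "- z r y x" "- ((E r - mat 1) *v x)"] by simp
      also have "norm ((E r - mat 1) *v x) \<le> norm (E r - mat 1) * norm x" by (rule norm_matrix_vector_le)
      also have "\<dots> \<le> w * norm x" using r1(2)[of r] r r' by (intro mult_right_mono) auto
      also have "\<dots> \<le> w * (norm (x - y) + norm y)"
        using w norm_triangle_ineq[of "x - y" y] by (intro mult_left_mono) auto
      also have "\<dots> \<le> norm (x - y) / 4 + \<delta> / 4"
        using w mult_right_mono[of w "1/4" "norm (x - y)"] by (simp add: distrib_left)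
      finally show ?thesis using x by linarith
    qed
    then have z2: "(\<delta> / 2)\<^sup>2 \<le> (norm (z r y x))\<^sup>2" using \<delta> by (intro power_mono) auto
    define u where "u = \<delta>\<^sup>2 / (8 * b * r)"
    have u: "u > 0" using \<delta> b r by (simp add: u_def)
    have "(norm (z r y x))\<^sup>2 / (b * r) \<le> z r y x \<bullet> (R r *v z r y x)"
      unfolding R_def by (rule spd_inverse_lower[OF W_spd[OF r(1)]]) (use b r r' in auto)
    moreover have "(\<delta> / 2)\<^sup>2 / (b * r) \<le> (norm (z r y x))\<^sup>2 / (b * r)"
      using z2 b r by (intro divide_right_mono) auto
    moreover have "(\<delta> / 2)\<^sup>2 / (b * r) = 2 * u" by (simp add: u_def power_divide)
    ultimately have "q r y x \<le> exp (- u)" by (simp add: q_def)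
    also have "\<dots> \<le> fact (Suc N) / u ^ Suc N"
    proof -
      have "(\<Sum>n\<in>{Suc N}. u ^ n /\<^sub>R fact n) \<le> (\<Sum>n. u ^ n /\<^sub>R fact n)"
        using u sums_summable[OF exp_converges[of u]] by (intro sum_le_suminf) auto
      also have "\<dots> = exp u" using sums_unique[OF exp_converges[of u]] by simp
      finally have "u ^ Suc N / fact (Suc N) \<le> exp u"
        by (simp add: divide_inverse mult.commute del: fact_Suc power_Suc)
      then have "u ^ Suc N \<le> exp u * fact (Suc N)"
        by (subst (asm) pos_divide_le_eq) (simp_all del: fact_Suc power_Suc)
      moreover have "u ^ Suc N > 0" using u by simp
      ultimately show ?thesis
        by (simp add: exp_minus field_simps del: fact_Suc power_Suc)
    qed
    also have "\<dots> = L * r ^ Suc N"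
    proof -
      have "inverse u = (8 * b / \<delta>\<^sup>2) * r" using \<delta> b r by (simp add: u_def field_simps)
      then have "inverse u ^ Suc N = (8 * b / \<delta>\<^sup>2) ^ Suc N * r ^ Suc N" by (simp only: power_mult_distrib)
      then show ?thesis unfolding L_def divide_inverse power_inverse by (simp only: mult.assoc)
    qed
    also have "\<dots> = (r * L) * r ^ N" by simp
    also have "\<dots> \<le> (\<eta> * a) * r ^ N" using r'(3) r by (intro mult_right_mono) auto
    also have "\<dots> \<le> \<eta> * G r" using a(2)[OF r(1) r'(1)] \<eta> by (simp add: mult.assoc)
    finally show "q r y x \<le> \<eta> * G r" .
  qed
qed

lemma classical_continuous:
  assumes "classical f"
  shows "continuous_on ({0<..} \<times> UNIV) (\<lambda>(t, x). f t x)"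
  using assms unfolding classical_def classical_data_def by (elim conjE exE) assumption

lemma classical_nonneg: "classical f \<Longrightarrow> t > 0 \<Longrightarrow> f t x \<ge> 0"
  unfolding classical_def by blast

text \<open>An approximate-identity argument without a sup bound on f. The comparison function is H
  g with H = f t y / g y, whose pairing with q is exactly f t y * G. Near y continuity of f / g
  makes the difference small relative to g; far away \<open>q_tail\<close> needs only the masses of
  f and g.\<close>

lemma limit_at_t:
  assumes f: "classical f" and t: "t > 0" and rn: "\<And>n. 0 < rn n" "\<And>n. rn n < t" "rn \<longlonglongrightarrow> 0"
  shows "(\<lambda>n. (\<integral>x. f (t - rn n) x * q (rn n) y x \<partial>lborel) / G (rn n)) \<longlonglongrightarrow> f t y"
proof (rule LIMSEQ_I)
  fix e :: real assume e: "e > 0"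
  obtain m0 where int: "\<And>t. t > 0 \<Longrightarrow> integrable lborel (f t)" and m0: "\<And>t. t > 0 \<Longrightarrow> (\<integral>x. f t x \<partial>lborel) \<le> m0"
    using f unfolding classical_def by blast
  define H where "H = f t y / g y"
  have H: "H \<ge> 0" using classical_nonneg[OF f t, of y] g_pos[of y] by (simp add: H_def less_imp_le)
  \<comment> \<open>Bounds the mass of f s + H g for every s > 0; the summand 1 keeps it
    positive.\<close>
  define m where "m = 1 + \<bar>m0\<bar> + H * (\<integral>x. g x \<partial>lborel)"
  have gi: "(\<integral>x. g x \<partial>lborel) \<ge> 0" by (intro integral_nonneg_AE AE_I2) (simp add: less_imp_le)
  have m: "m > 0" using H gi by (simp add: m_def add_pos_nonneg)
  define \<eta> where "\<eta> = e / (4 * g y)"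
  have \<eta>: "\<eta> > 0" using e g_pos[of y] by (simp add: \<eta>_def)
  have cont: "continuous_on ({0<..} \<times> UNIV) (\<lambda>p. f (fst p) (snd p) / g (snd p))"
    using classical_continuous[OF f] unfolding split_beta
    by (intro continuous_intros continuous_on_g) (auto simp: less_imp_neq[symmetric])
  then obtain \<delta> where \<delta>: "\<delta> > 0" and close: "\<And>p. p \<in> {0<..} \<times> UNIV \<Longrightarrow> dist p (t, y) < \<delta> \<Longrightarrow>
      dist (f (fst p) (snd p) / g (snd p)) H < \<eta>"
    using t \<eta> unfolding continuous_on_iff H_def by (metis (no_types, lifting) SigmaI UNIV_I fst_conv greaterThan_iff snd_conv)
  obtain r0 where r0: "r0 > 0" "\<And>r x. 0 < r \<Longrightarrow> r < r0 \<Longrightarrow> norm (x - y) \<ge> \<delta> / 2 \<Longrightarrow> q r y x \<le> e / (4 * m) * G r"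
    using q_tail[of "\<delta> / 2" "e / (4 * m)" y] \<delta> e m by auto
  obtain n0 where n0: "\<And>n. n \<ge> n0 \<Longrightarrow> norm (rn n - 0) < min r0 (\<delta> / 2)"
    using LIMSEQ_D[OF rn(3), of "min r0 (\<delta> / 2)"] r0 \<delta> by auto
  show "\<exists>no. \<forall>n\<ge>no. norm ((\<integral>x. f (t - rn n) x * q (rn n) y x \<partial>lborel) / G (rn n) - f t y) < e"
  proof (intro exI[of _ n0] allI impI)
    fix n assume "n \<ge> n0"
    then have r: "0 < rn n" "rn n < r0" "rn n < \<delta> / 2" using n0[of n] rn(1)[of n] by auto
    define r s where "r = rn n" and "s = t - rn n"
    have s: "s > 0" using rn(2)[of n] by (simp add: s_def)
    have r': "0 < r" "r < r0" using r by (auto simp: r_def)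
    note Gp = G_pos[OF r'(1)]
    \<comment> \<open>One majorant for both regions: the first term pays for points near y, the
      second for the tail. After integration each costs e / 4 times G r.\<close>
    have pw: "\<bar>(f s x - H * g x) * q r y x\<bar> \<le> \<eta> * (g x * q r y x) + (f s x + H * g x) * (e / (4 * m) * G r)" for x
    proof (cases "norm (x - y) \<ge> \<delta> / 2")
      case True
      have "\<bar>f s x - H * g x\<bar> \<le> f s x + H * g x"
        using classical_nonneg[OF f s, of x] H g_pos[of x] by (simp add: abs_le_iff less_imp_le)
      then have "\<bar>f s x - H * g x\<bar> * q r y x \<le> (f s x + H * g x) * (e / (4 * m) * G r)"
        using r0(2)[OF r' True] q_bounds(1)[of r y x] by (intro mult_mono) auto
      moreover have "\<eta> * (g x * q r y x) \<ge> 0"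
        by (rule less_imp_le[OF mult_pos_pos[OF \<eta> mult_pos_pos[OF g_pos q_bounds(1)]]])
      ultimately show ?thesis using q_bounds(1)[of r y x] by (simp add: abs_mult)
    next
      case False
      have "dist (s, x) (t, y) \<le> dist s t + dist x y"
        unfolding dist_Pair_Pair by (rule sqrt_sum_squares_le_sum) auto
      also have "\<dots> < \<delta>" using False r by (simp add: dist_norm s_def)
      finally have "\<bar>f s x / g x - H\<bar> < \<eta>" using close[of "(s, x)"] s by (simp add: dist_real_def)
      then have "\<bar>f s x / g x - H\<bar> * g x \<le> \<eta> * g x" by (intro mult_right_mono) (auto simp: less_imp_le)
      moreover have "\<bar>f s x / g x - H\<bar> * g x = \<bar>f s x - H * g x\<bar>"
        using g_pos[of x] by (simp add: abs_mult[symmetric, of _ "g x", simplified abs_of_pos[OF g_pos]] left_diff_distrib less_imp_neq[symmetric])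
      ultimately have "\<bar>f s x - H * g x\<bar> * q r y x \<le> (\<eta> * g x) * q r y x"
        using q_bounds(1)[of r y x] by (intro mult_right_mono) auto
      moreover have "(f s x + H * g x) * (e / (4 * m) * G r) \<ge> 0"
        using classical_nonneg[OF f s, of x] H e m Gp
        by (intro mult_nonneg_nonneg add_nonneg_nonneg) (auto simp: less_imp_le)
      moreover have "\<bar>(f s x - H * g x) * q r y x\<bar> = \<bar>f s x - H * g x\<bar> * q r y x"
        using q_bounds(1)[of r y x] by (simp add: abs_mult)
      ultimately show ?thesis unfolding mult.assoc[of \<eta>] by linarith
    qed
    have i1: "integrable lborel (\<lambda>x. f s x * q r y x)" "integrable lborel (\<lambda>x. g x * q r y x)"
      by (intro integrable_mult_q r' int s g_integrable)+
    have "(\<integral>x. f s x * q r y x \<partial>lborel) - H * (\<integral>x. g x * q r y x \<partial>lborel) = (\<integral>x. (f s x - H * g x) * q r y x \<partial>lborel)"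
      using i1 by (simp add: left_diff_distrib mult.assoc)
    moreover have "H * (\<integral>x. g x * q r y x \<partial>lborel) = f t y * G r"
      using integral_g_q[OF r'(1), of y] g_pos[of y] by (simp add: H_def less_imp_neq[symmetric])
    ultimately have eq: "(\<integral>x. f s x * q r y x \<partial>lborel) - f t y * G r = (\<integral>x. (f s x - H * g x) * q r y x \<partial>lborel)" by simp
    have "\<bar>\<integral>x. (f s x - H * g x) * q r y x \<partial>lborel\<bar> \<le>
       (\<integral>x. \<eta> * (g x * q r y x) + (f s x + H * g x) * (e / (4 * m) * G r) \<partial>lborel)"
    proof (rule order_trans[OF integral_abs_bound], rule integral_mono)
      show "integrable lborel (\<lambda>x. \<bar>(f s x - H * g x) * q r y x\<bar>)"
        by (intro integrable_abs integrable_mult_q r' Bochner_Integration.integrable_diff int s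
            integrable_mult_right g_integrable)
      show "integrable lborel (\<lambda>x. \<eta> * (g x * q r y x) + (f s x + H * g x) * (e / (4 * m) * G r))"
        by (intro Bochner_Integration.integrable_add integrable_mult_right integrable_mult_left i1 int s g_integrable)
    qed (rule pw)
    also have "\<dots> = \<eta> * (g y * G r) + ((\<integral>x. f s x \<partial>lborel) + H * (\<integral>x. g x \<partial>lborel)) * (e / (4 * m) * G r)"
      using i1 int[OF s] g_integrable integral_g_q[OF r'(1), of y] by simp
    also have "\<dots> \<le> \<eta> * (g y * G r) + m * (e / (4 * m) * G r)"
      using m0[OF s] e m Gp by (intro add_left_mono mult_right_mono) (auto simp: m_def)
    also have "\<dots> = (e / 2) * G r" using m g_pos[of y] by (simp add: \<eta>_def less_imp_neq[symmetric])
    finally have "\<bar>(\<integral>x. f s x * q r y x \<partial>lborel) - f t y * G r\<bar> \<le> (e / 2) * G r" unfolding eq .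
    then have "\<bar>(\<integral>x. f s x * q r y x \<partial>lborel) / G r - f t y\<bar> \<le> e / 2"
    proof -
      assume *: "\<bar>(\<integral>x. f s x * q r y x \<partial>lborel) - f t y * G r\<bar> \<le> (e / 2) * G r"
      have "(\<integral>x. f s x * q r y x \<partial>lborel) / G r - f t y = ((\<integral>x. f s x * q r y x \<partial>lborel) - f t y * G r) / G r"
        using Gp by (simp add: diff_divide_distrib)
      then have "\<bar>(\<integral>x. f s x * q r y x \<partial>lborel) / G r - f t y\<bar> = \<bar>(\<integral>x. f s x * q r y x \<partial>lborel) - f t y * G r\<bar> / G r"
        using Gp by simp
      then show ?thesis using * Gp by (simp add: pos_divide_le_eq)
    qed
    then show "norm ((\<integral>x. f (t - rn n) x * q (rn n) y x \<partial>lborel) / G (rn n) - f t y) < e"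
      using e by (simp add: r_def s_def)
  qed
qed

text \<open>\<open>ratio_constant\<close> makes J constant on the open interval from 0 to t, so its
  limits at both ends agree. At t the kernel concentrates and gives f t y; at 0 the L^1 convergence
  together with q \<le> 1 gives the pairing with f0.\<close>

lemma representation_q:
  assumes f: "classical f" and t: "t > 0" and f0: "integrable lborel f0"
    and L1: "((\<lambda>t. \<integral>x. \<bar>f t x - f0 x\<bar> \<partial>lborel) \<longlongrightarrow> 0) (at_right 0)"
  shows "f t y = (\<integral>x. f0 x * q t y x \<partial>lborel) / G t"
proof -
  define J where "J s = (\<integral>x. f s x * q (t - s) y x \<partial>lborel) / G (t - s)" for s
  have int: "\<And>t. t > 0 \<Longrightarrow> integrable lborel (f t)" using f unfolding classical_def by blast
  \<comment> \<open>The offset 3 keeps \<open>a n < t / 2\<close> from n = 0 on, so that both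
    \<open>a n\<close> and \<open>t - a n\<close> can be compared with the midpoint.\<close>
  define a where "a n = t / (real n + 3)" for n
  have a: "0 < a n" "a n < t / 2" for n using t by (auto simp: a_def field_simps add_pos_nonneg)
  have a0: "a \<longlonglongrightarrow> 0"
  proof -
    have "(\<lambda>n. t * inverse (real (n + 3))) \<longlonglongrightarrow> t * 0"
      by (intro tendsto_mult tendsto_const LIMSEQ_ignore_initial_segment[OF lim_inverse_n])
    then show ?thesis by (simp add: a_def[abs_def] divide_inverse)
  qed
  have Jc: "J (a n) = J (t / 2)" for n
    unfolding J_def using ratio_constant[OF f, of "a n" "t / 2" t y] a[of n] t by simp
  have Jc': "J (t - a n) = J (t / 2)" for n
    unfolding J_def using ratio_constant[OF f, of "t / 2" "t - a n" t y] a[of n] t by simp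
  have "(\<lambda>n. J (t - a n)) \<longlonglongrightarrow> f t y"
    unfolding J_def using limit_at_t[OF f t, of a y] a a0 t by (simp add: less_trans[of _ "t / 2" t])
  then have 1: "J (t / 2) = f t y" unfolding Jc' by (simp add: LIMSEQ_const_iff)
  have ta: "(\<lambda>n. t - a n) \<longlonglongrightarrow> t" using tendsto_diff[OF tendsto_const a0, of t] by simp
  have tp: "t - a n > 0" for n using a[of n] t by linarith
  have "(\<lambda>n. \<integral>x. f (a n) x * q (t - a n) y x \<partial>lborel) \<longlonglongrightarrow> (\<integral>x. f0 x * q t y x \<partial>lborel)"
  proof -
    have "filterlim a (at_right 0) sequentially"
      using a0 a(1) by (intro tendsto_imp_filterlim_at_right) auto
    from filterlim_compose[OF L1 this]
    have L: "(\<lambda>n. \<integral>x. \<bar>f (a n) x - f0 x\<bar> \<partial>lborel) \<longlonglongrightarrow> 0" .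
    have "(\<lambda>n. (\<integral>x. f (a n) x * q (t - a n) y x \<partial>lborel) - (\<integral>x. f0 x * q (t - a n) y x \<partial>lborel)) \<longlonglongrightarrow> 0"
    proof (rule Lim_null_comparison[OF always_eventually L], rule allI)
      fix n
      have i: "integrable lborel (\<lambda>x. f (a n) x - f0 x)" using int[OF a(1)] f0 by simp
      have "(\<integral>x. f (a n) x * q (t - a n) y x \<partial>lborel) - (\<integral>x. f0 x * q (t - a n) y x \<partial>lborel)
        = (\<integral>x. (f (a n) x - f0 x) * q (t - a n) y x \<partial>lborel)"
        using integrable_mult_q[OF tp[of n] int[OF a(1)[of n]], of y] integrable_mult_q[OF tp[of n] f0, of y]
        by (simp add: left_diff_distrib)
      also have "\<bar>\<dots>\<bar> \<le> (\<integral>x. \<bar>f (a n) x - f0 x\<bar> \<partial>lborel)"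
      proof (rule order_trans[OF integral_abs_bound], rule integral_mono)
        show "integrable lborel (\<lambda>x. \<bar>(f (a n) x - f0 x) * q (t - a n) y x\<bar>)"
          by (intro integrable_abs integrable_mult_q tp i)
        show "\<bar>(f (a n) x - f0 x) * q (t - a n) y x\<bar> \<le> \<bar>f (a n) x - f0 x\<bar>" for x
          using q_bounds[of "t - a n" y x] tp[of n] by (simp add: abs_mult mult_left_le)
      qed (intro integrable_abs i)
      finally show "norm ((\<integral>x. f (a n) x * q (t - a n) y x \<partial>lborel) - (\<integral>x. f0 x * q (t - a n) y x \<partial>lborel))
         \<le> (\<integral>x. \<bar>f (a n) x - f0 x\<bar> \<partial>lborel)" by simp
    qed
    from tendsto_add[OF this integral_q_tendsto[OF f0 t tp ta, of y]] show ?thesis by simp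
  qed
  then have "(\<lambda>n. J (a n)) \<longlonglongrightarrow> (\<integral>x. f0 x * q t y x \<partial>lborel) / G t"
    unfolding J_def using G_pos[OF t] by (intro tendsto_divide G_tendsto t tp ta) auto
  then have "J (t / 2) = (\<integral>x. f0 x * q t y x \<partial>lborel) / G t" unfolding Jc by (simp add: LIMSEQ_const_iff)
  then show ?thesis using 1 by simp
qed

lemma representation:
  assumes f: "classical f" and t: "t > 0" and f0: "integrable lborel f0"
    and L1: "((\<lambda>t. \<integral>x. \<bar>f t x - f0 x\<bar> \<partial>lborel) \<longlongrightarrow> 0) (at_right 0)"
  shows "f t y / g y = (\<integral>x. f0 x / g x * k t y x \<partial>lborel)" "integrable lborel (\<lambda>x. f0 x / g x * k t y x)"
proof -
  have eq: "f0 x / g x * k t y x = f0 x * q t y x / (g y * G t)" for x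
    using g_q[OF t, of x y] g_pos[of x] g_pos[of y] G_pos[OF t] by (simp add: field_simps less_imp_neq[symmetric])
  show "f t y / g y = (\<integral>x. f0 x / g x * k t y x \<partial>lborel)"
    unfolding eq using representation_q[OF assms, of y] by simp
  show "integrable lborel (\<lambda>x. f0 x / g x * k t y x)"
    unfolding eq using integrable_mult_q[OF t f0] by simp
qed

end

section \<open>The local entropy inequality\<close>

lemma continuous_borel_measurable_pair:
  fixes u :: "'a::euclidean_space \<Rightarrow> 'b::euclidean_space \<Rightarrow> real"
  assumes "continuous_on UNIV (\<lambda>p. u (fst p) (snd p))"
  shows "(\<lambda>p. u (fst p) (snd p)) \<in> borel_measurable (lborel \<Otimes>\<^sub>M lborel)"
proof -
  have "sets (lborel \<Otimes>\<^sub>M lborel) = sets (borel :: ('a \<times> 'b) measure)"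
    by (metis borel_prod sets_lborel sets_pair_measure_cong)
  then show ?thesis
    using borel_measurable_continuous_onI[OF assms] by (simp cong: measurable_cong_sets)
qed

context fokker_planck
begin

lemma continuous_on_k:
  assumes "r > 0" "continuous_on S y" "continuous_on S x"
  shows "continuous_on S (\<lambda>u. k r (y u) (x u))"
  unfolding k_def using G_pos[OF assms(1)] by (intro continuous_intros assms(2,3)) auto

lemma k_measurable_pair:
  assumes r: "r > 0"
  shows "(\<lambda>p. k r (fst p) (snd p)) \<in> borel_measurable (lborel \<Otimes>\<^sub>M lborel)"
  by (intro continuous_borel_measurable_pair continuous_on_k r continuous_intros)

lemma g_measurable: "g \<in> borel_measurable borel"
  by (intro borel_measurable_continuous_onI continuous_on_g continuous_on_id)

text \<open>The mass does not depend on \<open>x\<close> up to the factor \<open>g x\<close>; computing the total mass in both orders of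
  integration shows that it is exactly \<open>g x\<close>.\<close>

lemma k_mass_left:
  assumes r: "r > 0"
  shows "(\<integral>\<^sup>+y. ennreal (g y * k r y x) \<partial>lborel) = ennreal (g x)"
proof -
  let ?u = "\<lambda>v. exp (- (v \<bullet> (R r *v v)) / 2)"
  define N where "N = (\<integral>v. ?u v \<partial>lborel)"
  have "sym_pos_def (R r)" unfolding R_def by (rule spd_inverse_spd[OF W_spd[OF r]])
  then obtain c where c: "c > 0" "\<And>v. c * (norm v)\<^sup>2 \<le> v \<bullet> (R r *v v)"
    using quadratic_form_coercive[of "R r"] unfolding sym_pos_def_def by blast
  have ui: "integrable lborel ?u" by (rule exp_quadratic_integrable[OF c])
  have gk: "g y * k r y x = g x * ?u (y + - (E r *v x)) / G r" for x y
  proof -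
    have "g x * q r y x = g y * k r y x * G r" using g_q[OF r, of x y] by (simp add: mult_ac)
    then show ?thesis using G_pos[OF r] by (simp add: q_def z_def field_simps)
  qed
  have inner: "(\<integral>\<^sup>+y. ennreal (g y * k r y x) \<partial>lborel) = ennreal (g x * (N / G r))" for x
  proof -
    have i: "integrable lborel (\<lambda>y. ?u (y + - (E r *v x)))" by (rule lborel_integrable_translate[OF ui])
    have v: "(\<integral>y. ?u (y + - (E r *v x)) \<partial>lborel) = N"
      unfolding N_def by (rule lborel_integral_translate) (use ui in auto)
    have "(\<integral>\<^sup>+y. ennreal (g y * k r y x) \<partial>lborel) = ennreal (\<integral>y. g x * ?u (y + - (E r *v x)) / G r \<partial>lborel)"
      unfolding gk using i g_pos[of x] G_pos[OF r]
      by (intro nn_integral_eq_integral AE_I2) (auto simp: less_imp_le)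
    also have "\<dots> = ennreal (g x * (N / G r))" using v by simp
    finally show ?thesis .
  qed
  let ?F = "\<integral>x. g x \<partial>lborel"
  have F: "?F > 0" by (rule integrable_pos_integral_pos[OF g_integrable g_pos])
  have N: "N \<ge> 0" unfolding N_def by simp
  have "ennreal (?F * (N / G r)) = (\<integral>\<^sup>+x. ennreal (g x * (N / G r)) \<partial>lborel)"
    using g_integrable N G_pos[OF r]
    by (subst nn_integral_eq_integral) (auto simp: less_imp_le)
  also have "\<dots> = (\<integral>\<^sup>+x. (\<integral>\<^sup>+y. ennreal (g y * k r y x) \<partial>lborel) \<partial>lborel)" by (simp only: inner)
  also have "\<dots> = (\<integral>\<^sup>+y. (\<integral>\<^sup>+x. ennreal (g y * k r y x) \<partial>lborel) \<partial>lborel)"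
  proof -
    have "continuous_on UNIV (\<lambda>p. g (snd p) * k r (snd p) (fst p))"
      by (intro continuous_intros continuous_on_g continuous_on_k r)
    then have "(\<lambda>p. g (snd p) * k r (snd p) (fst p)) \<in> borel_measurable (lborel \<Otimes>\<^sub>M lborel)"
      by (rule continuous_borel_measurable_pair)
    then have "(\<lambda>(x, y). ennreal (g y * k r y x)) \<in> borel_measurable (lborel \<Otimes>\<^sub>M lborel)"
      by (simp add: split_beta)
    from lborel_pair.Fubini'[OF this] show ?thesis by simp
  qed
  also have "\<dots> = (\<integral>\<^sup>+y. ennreal (g y) \<partial>lborel)"
  proof (intro nn_integral_cong)
    fix y
    have "(\<integral>\<^sup>+x. ennreal (g y * k r y x) \<partial>lborel) = ennreal (\<integral>x. g y * k r y x \<partial>lborel)"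
      using k_prob(1)[OF r, of y] k_pos[OF r, of y] g_pos[of y]
      by (intro nn_integral_eq_integral AE_I2) (auto simp: less_imp_le)
    then show "(\<integral>\<^sup>+x. ennreal (g y * k r y x) \<partial>lborel) = ennreal (g y)" using k_prob(2)[OF r, of y] by simp
  qed
  also have "\<dots> = ennreal ?F"
    using g_integrable by (intro nn_integral_eq_integral AE_I2) (auto simp: less_imp_le)
  finally have "?F * (N / G r) = ?F" using F N G_pos[OF r] by (simp add: ennreal_inj)
  then have "N / G r = 1" using F mult_cancel_left2[of ?F "N / G r"] by linarith
  then show ?thesis unfolding inner by simp
qed

text \<open>Under \<open>k r y\<close> the variable \<open>sg\<close> is a centred Gaussian with variance \<open>var\<close>, and \<open>e\<^sup>l\<^sup>s\<^sup>g\<close> amounts to a shift of \<open>y\<close>.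
  Replacing \<open>\<beta> sg\<close> by \<open>n (1 - e\<^sup>-\<^sup>\<beta>\<^sup>s\<^sup>g\<^sup>/\<^sup>n)\<close>, which lies below it, turns the test function into difference quotients of \<open>h\<close>,
  so that no differentiation under the integral is needed.\<close>

lemma entropy_gradient_bound:
  fixes u :: "real^'n \<Rightarrow> real" and v y :: "real^'n"
  assumes adm: "admissible psi" and r: "r > 0" and u: "\<And>x. u x \<ge> 0" "u \<in> borel_measurable borel"
    and int: "\<And>y. integrable lborel (\<lambda>x. u x * k r y x)"
    and h: "\<And>y. h y = (\<integral>x. u x * k r y x \<partial>lborel)"
    and hy: "h y > 0" and dh: "((\<lambda>l. h (y + l *\<^sub>R v)) has_real_derivative dh) (at 0)"
    and S: "S > 0" "v \<bullet> (R r *v v) \<le> S"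
  shows "ennreal ((deriv ^^ 2) psi (h y) * dh\<^sup>2) \<le> ennreal (4 * S) * (\<integral>\<^sup>+x. ennreal (psi (u x) * k r y x) \<partial>lborel)"
proof (cases "(\<integral>\<^sup>+x. ennreal (psi (u x) * k r y x) \<partial>lborel) = \<infinity>")
  case True
  then show ?thesis using S(1) by (simp add: ennreal_mult_top)
next
  case False
  define m where "m = h y"
  define c where "c = (deriv ^^ 2) psi m"
  \<comment> \<open>Maximiser of \<beta> dh - \<beta>^2 S m, the limit of the lower bounds with the
    variance replaced by S. The maximum dh^2 / (4 S m), multiplied by c m, produces the constant 4
    S.\<close>
  define \<beta> where "\<beta> = dh / (2 * m * S)"
  define sg where "sg x = (x - B r *v y) \<bullet> (M r *v (B r *v v))" for x
  define var where "var = (B r *v v) \<bullet> (M r *v (B r *v v))"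
  have m: "m > 0" using hy by (simp add: m_def)
  have c: "c \<ge> 0" using adm m by (simp add: c_def admissible_def)
  have psi0: "psi (u x) \<ge> 0" for x by (rule admissible_nonneg[OF adm u(1)])
  have k0: "k r y x > 0" for x y by (rule k_pos[OF r])
  have km: "k r y \<in> borel_measurable borel" for y using k_prob(1)[OF r, of y] by auto
  have pm: "(\<lambda>x. psi (u x) * k r y x) \<in> borel_measurable lborel"
    using admissible_measurable[OF adm u(2) u(1)] km by simp
  have pi: "integrable lborel (\<lambda>x. psi (u x) * k r y x)"
    using False pm psi0 k0[THEN less_imp_le]
    by (intro integrableI_nonneg AE_I2) (auto simp: top.not_eq_extremum)
  define I where "I = (\<integral>x. psi (u x) * k r y x \<partial>lborel)"
  have I: "(\<integral>\<^sup>+x. ennreal (psi (u x) * k r y x) \<partial>lborel) = ennreal I"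
    unfolding I_def using psi0 k0[THEN less_imp_le] by (intro nn_integral_eq_integral pi AE_I2) auto
  have I0: "I \<ge> 0" unfolding I_def using psi0 k0[THEN less_imp_le] by (intro integral_nonneg_AE AE_I2) auto
  have shift: "k r (y + l *\<^sub>R v) x = k r y x * exp (l * sg x - l\<^sup>2 * var / 2)" for l x
    unfolding sg_def var_def by (rule k_shift[OF r])
  \<comment> \<open>The integrated lower bound at stage n, without the factor c m; it tends to
    \<beta> dh - \<beta>^2 var m.\<close>
  define A where "A n = (real n - \<beta>\<^sup>2 * var / 2) * (2 * m)
      - real n * (exp ((\<beta> / real n)\<^sup>2 * var / 2) * (m + h (y + (- (\<beta> / real n)) *\<^sub>R v)))" for n
  have AI: "c * m * A n \<le> I" if n: "n > 0" for n
  proof -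
    define e where "e = - (\<beta> / real n)"
    \<comment> \<open>The trial function for \<open>entropy_young\<close>. It lies below \<beta> sg
      - \<beta>^2 var / 2, whose exponential is the density of the kernel at y + \<beta> v relative
      to the one at y, so the exponential moment is at most 1.\<close>
    define T where "T x = real n * (1 - exp (e * sg x)) - \<beta>\<^sup>2 * var / 2" for x
    have T: "T x \<le> \<beta> * sg x - \<beta>\<^sup>2 * var / 2" for x
    proof -
      have "1 + e * sg x \<le> exp (e * sg x)" by (rule exp_ge_add_one_self)
      then have "1 - exp (e * sg x) \<le> - e * sg x" by linarith
      then have "real n * (1 - exp (e * sg x)) \<le> real n * (- e * sg x)" by (rule mult_left_mono) simp
      also have "\<dots> = \<beta> * sg x" using n by (simp add: e_def)
      finally show ?thesis by (simp add: T_def)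
    qed
    have point: "(psi m + deriv psi m * (u x - m) + c * m * ((m + u x) * T x - 2 * m * exp (\<beta> * sg x - \<beta>\<^sup>2 * var / 2) + 2 * m)) * k r y x
        \<le> psi (u x) * k r y x" for x
    proof (intro mult_right_mono less_imp_le[OF k0])
      have w: "m + u x > 0" using m u(1)[of x] by linarith
      have "(m + u x) * T x - 2 * m * exp (T x) + (m + u x) \<le> (m + u x) * ln ((m + u x) / (2 * m))"
        using m by (intro entropy_young w) auto
      moreover have "2 * m * exp (T x) \<le> 2 * m * exp (\<beta> * sg x - \<beta>\<^sup>2 * var / 2)" using T[of x] m by simp
      ultimately have "(m + u x) * T x - 2 * m * exp (\<beta> * sg x - \<beta>\<^sup>2 * var / 2) + 2 * m
          \<le> (m + u x) * ln ((m + u x) / (2 * m)) - (u x - m)" by linarith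
      then have "c * m * ((m + u x) * T x - 2 * m * exp (\<beta> * sg x - \<beta>\<^sup>2 * var / 2) + 2 * m)
          \<le> c * m * ((m + u x) * ln ((m + u x) / (2 * m)) - (u x - m))"
        using c m by (intro mult_left_mono) auto
      then show "psi m + deriv psi m * (u x - m) + c * m * ((m + u x) * T x - 2 * m * exp (\<beta> * sg x - \<beta>\<^sup>2 * var / 2) + 2 * m) \<le> psi (u x)"
        using admissible_entropy_bound[OF adm m u(1)[of x]] by (simp add: c_def)
    qed
    let ?s = "real n - \<beta>\<^sup>2 * var / 2"
    let ?E = "exp (e\<^sup>2 * var / 2)"
    \<comment> \<open>Every summand is expressed by the kernels at y, y + e v and y + \<beta> v.
      Each of these is integrable against 1, and the first two also against u; a product of u with
      the linear function sg never appears.\<close>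
    have eq: "(psi m + deriv psi m * (u x - m) + c * m * ((m + u x) * T x - 2 * m * exp (\<beta> * sg x - \<beta>\<^sup>2 * var / 2) + 2 * m)) * k r y x
      = (psi m - deriv psi m * m + c * m * (?s * m + 2 * m)) * k r y x + (deriv psi m + c * m * ?s) * (u x * k r y x)
        - (c * m * real n * ?E) * (m * k r (y + e *\<^sub>R v) x + u x * k r (y + e *\<^sub>R v) x)
        - (c * m * (2 * m)) * k r (y + \<beta> *\<^sub>R v) x" for x
    proof -
      have "?E * k r (y + e *\<^sub>R v) x = exp (e * sg x) * k r y x"
        unfolding shift by (simp add: exp_diff)
      then have 1: "(c * m * real n * ?E) * (m * k r (y + e *\<^sub>R v) x + u x * k r (y + e *\<^sub>R v) x)
        = c * m * real n * (m + u x) * (exp (e * sg x) * k r y x)"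
        by (simp add: distrib_left[symmetric] distrib_right[symmetric] mult_ac)
      have 2: "k r (y + \<beta> *\<^sub>R v) x = exp (\<beta> * sg x - \<beta>\<^sup>2 * var / 2) * k r y x"
        unfolding shift by simp
      show ?thesis unfolding 1 2 by (simp add: T_def algebra_simps)
    qed
    note ki = k_prob(1)[OF r] and k1 = k_prob(2)[OF r]
    have "(\<integral>x. (psi m + deriv psi m * (u x - m) + c * m * ((m + u x) * T x - 2 * m * exp (\<beta> * sg x - \<beta>\<^sup>2 * var / 2) + 2 * m)) * k r y x \<partial>lborel) \<le> I"
      unfolding I_def
    proof (rule integral_mono[OF _ pi])
      show "integrable lborel (\<lambda>x. (psi m + deriv psi m * (u x - m) + c * m * ((m + u x) * T x - 2 * m * exp (\<beta> * sg x - \<beta>\<^sup>2 * var / 2) + 2 * m)) * k r y x)"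
        unfolding eq by (intro Bochner_Integration.integrable_diff Bochner_Integration.integrable_add integrable_mult_right ki int)
    qed (rule point)
    also have "(\<integral>x. (psi m + deriv psi m * (u x - m) + c * m * ((m + u x) * T x - 2 * m * exp (\<beta> * sg x - \<beta>\<^sup>2 * var / 2) + 2 * m)) * k r y x \<partial>lborel)
      = (psi m - deriv psi m * m + c * m * (?s * m + 2 * m)) + (deriv psi m + c * m * ?s) * m
        - (c * m * real n * ?E) * (m + h (y + e *\<^sub>R v)) - (c * m * (2 * m))"
      unfolding eq by (simp add: ki int k1 h[symmetric] m_def[symmetric])
    also have "\<dots> = psi m + c * m * A n"
      by (simp add: A_def e_def algebra_simps)
    finally show ?thesis using admissible_nonneg[OF adm, of m] m by simp
  qed
  have lim: "A \<longlonglongrightarrow> \<beta> * dh - \<beta>\<^sup>2 * var * m"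
  proof -
    \<comment> \<open>With \<eta> = 1 / n and F 0 = - 2 m, the divergent parts of A n combine to the
      difference quotient of F at 0. The exponential factor is quadratic in \<eta> and does not
      contribute to the derivative.\<close>
    define F where "F \<eta> = - (exp ((\<beta> * \<eta>)\<^sup>2 * var / 2) * (m + h (y + (- (\<beta> * \<eta>)) *\<^sub>R v)))" for \<eta>
    have inner: "((\<lambda>\<eta>. - (\<beta> * \<eta>)) has_real_derivative - \<beta>) (at 0)" by (auto intro!: derivative_eq_intros)
    have "((\<lambda>\<eta>. h (y + (- (\<beta> * \<eta>)) *\<^sub>R v)) has_real_derivative dh * - \<beta>) (at 0)"
      by (rule DERIV_chain2[where f = "\<lambda>l. h (y + l *\<^sub>R v)" and g = "\<lambda>\<eta>. - (\<beta> * \<eta>)"]) (use dh inner in simp_all)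
    note dh' = this
    have "((\<lambda>\<eta>. exp ((\<beta> * \<eta>)\<^sup>2 * var / 2)) has_real_derivative 0) (at 0)"
      by (auto intro!: derivative_eq_intros)
    from DERIV_minus[OF DERIV_mult[OF this DERIV_add[OF DERIV_const[of m] dh']]]
    have "(F has_real_derivative \<beta> * dh) (at 0)"
      unfolding F_def by (rule DERIV_cong) simp
    then have "((\<lambda>\<eta>. (F (0 + \<eta>) - F 0) / \<eta>) \<longlongrightarrow> \<beta> * dh) (at 0)" by (simp only: DERIV_def)
    moreover have "filterlim (\<lambda>n. 1 / real (Suc n)) (at 0) sequentially"
      using LIMSEQ_Suc[OF lim_1_over_n[where 'a = real]] by (auto simp: filterlim_at)
    ultimately have "(\<lambda>n. (F (0 + 1 / real (Suc n)) - F 0) / (1 / real (Suc n))) \<longlonglongrightarrow> \<beta> * dh"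
      by (rule filterlim_compose)
    then have "(\<lambda>n. (F (0 + 1 / real (Suc n)) - F 0) / (1 / real (Suc n)) - \<beta>\<^sup>2 * var * m) \<longlonglongrightarrow> \<beta> * dh - \<beta>\<^sup>2 * var * m"
      by (intro tendsto_diff tendsto_const)
    moreover have "(F (0 + 1 / real (Suc n)) - F 0) / (1 / real (Suc n)) - \<beta>\<^sup>2 * var * m = A (Suc n)" for n
      by (simp add: F_def A_def m_def[symmetric] algebra_simps del: of_nat_Suc)
    ultimately have "(\<lambda>n. A (Suc n)) \<longlonglongrightarrow> \<beta> * dh - \<beta>\<^sup>2 * var * m" by simp
    then show ?thesis by (rule LIMSEQ_imp_Suc)
  qed
  have "c * m * (\<beta> * dh - \<beta>\<^sup>2 * var * m) \<le> I"
    by (rule LIMSEQ_le_const2[OF tendsto_mult_left[OF lim]]) (use AI in \<open>auto intro!: exI[of _ 1]\<close>)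
  \<comment> \<open>By \<open>BMB\<close> the variance differs from v . R v by the nonnegative form
    of K^-1.\<close>
  moreover have "var \<le> S"
  proof -
    have "v \<bullet> (Kinv *v v) \<ge> 0"
      using spd_inverse_spd[OF K_spd] unfolding Kinv_def sym_pos_def_def by (cases "v = 0") (auto simp: less_imp_le)
    then show ?thesis using S(2) unfolding var_def BMB[OF r] by linarith
  qed
  then have "c * m * (\<beta> * dh - \<beta>\<^sup>2 * S * m) \<le> c * m * (\<beta> * dh - \<beta>\<^sup>2 * var * m)"
    using c m by (intro mult_left_mono diff_left_mono mult_right_mono) auto
  moreover have "c * m * (\<beta> * dh - \<beta>\<^sup>2 * S * m) = c * dh\<^sup>2 / (4 * S)"
    using m S(1) by (simp add: \<beta>_def power2_eq_square field_simps)
  ultimately have "c * dh\<^sup>2 / (4 * S) \<le> I" by linarith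
  then have "c * dh\<^sup>2 \<le> 4 * S * I" using S(1) by (simp add: field_simps)
  then have "ennreal (c * dh\<^sup>2) \<le> ennreal (4 * S * I)" by (rule ennreal_leI)
  also have "\<dots> = ennreal (4 * S) * ennreal I" using S(1) I0 by (intro ennreal_mult) auto
  finally show ?thesis by (simp add: I c_def m_def)
qed

end

section \<open>Integration of the local inequality against the equilibrium\<close>

context fokker_planck
begin

lemma norm_square_components: "(norm v)\<^sup>2 = (\<Sum>j\<in>UNIV. (v $ j)\<^sup>2)" for v :: "real^'n"
  unfolding power2_norm_eq_inner by (simp add: inner_vec_def power2_eq_square)

text \<open>The form of P is bounded by \<open>norm P\<close> times the squared gradient, and
  \<open>entropy_gradient_bound\<close> is applied in each coordinate direction; the sum over these
  accounts for the dimension in the constant. After Tonelli, invariance of the equilibrium removes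
  the kernel.\<close>

lemma entropy_production_bound:
  fixes P :: "real^'n^'n"
  assumes adm: "admissible psi" and f: "classical f"
    and f0: "integrable lborel f0" "\<And>x. f0 x \<ge> 0"
    and L1: "((\<lambda>t. \<integral>x. \<bar>f t x - f0 x\<bar> \<partial>lborel) \<longlongrightarrow> 0) (at_right 0)"
    and finf: "c0 > 0" "\<And>x. finf x = c0 * g x"
    and t: "t > 0" and S: "S > 0" "\<And>j. axis j 1 \<bullet> (R t *v axis j 1) \<le> S"
  shows "S_psi psi P finf (f t) \<le> ennreal (norm P * (4 * S * real CARD('n))) * e_psi psi finf f0"
proof -
  define u where "u x = f0 x / finf x" for x
  define h where "h y = f t y / finf y" for y
  have finf0: "finf x > 0" for x using finf by simp
  have finf_meas: "finf \<in> borel_measurable borel"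
    using g_measurable finf(2) by (simp add: finf(2)[abs_def])
  have u0: "u x \<ge> 0" for x using f0(2)[of x] finf0[of x] by (simp add: u_def)
  have um: "u \<in> borel_measurable borel"
    using borel_measurable_integrable[OF f0(1)] finf_meas unfolding u_def[abs_def] by simp
  have uk: "u x * k t y x = (f0 x / g x * k t y x) / c0" for x y by (simp add: u_def finf(2))
  have int: "integrable lborel (\<lambda>x. u x * k t y x)" for y
    unfolding uk by (rule integrable_divide_zero) (rule representation(2)[OF f t f0(1) L1])
  have hrep: "h y = (\<integral>x. u x * k t y x \<partial>lborel)" for y
    unfolding uk integral_divide_zero representation(1)[OF f t f0(1) L1, symmetric] by (simp add: h_def finf(2))
  obtain ft gf dF where "classical_data f ft gf dF" using f unfolding classical_def by blast
  note dgf = this[unfolded classical_data_def, THEN conjunct2, THEN conjunct1, rule_format]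
  have dh: "((\<lambda>l. h (y + l *\<^sub>R axis j 1)) has_real_derivative grad h y $ j) (at 0)" for y j
  proof -
    have "((\<lambda>l. c0 * g (y + l *\<^sub>R axis j 1)) has_real_derivative c0 * (g y * - (Kinv *v y) $ j)) (at 0)"
      by (rule DERIV_cmult[OF g_axis_derivative])
    from DERIV_divide[OF dgf[OF t] this]
    have "\<exists>D. ((\<lambda>l. h (y + l *\<^sub>R axis j 1)) has_real_derivative D) (at 0)"
      unfolding h_def finf(2) using finf(1) g_pos[of y] by (auto simp: less_imp_neq[symmetric])
    then show ?thesis by (auto simp: grad_def pd_def DERIV_imp_deriv)
  qed
  define I where "I y = (\<integral>\<^sup>+x. ennreal (psi (u x) * k t y x) \<partial>lborel)" for y
  have psi0: "psi (u x) \<ge> 0" for x by (rule admissible_nonneg[OF adm u0])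
  have point: "indicator {y. f t y / finf y > 0} y *
      ennreal ((deriv ^^ 2) psi (f t y / finf y) *
        (grad (\<lambda>y. f t y / finf y) y \<bullet> (P *v grad (\<lambda>y. f t y / finf y) y)) * finf y)
      \<le> ennreal (norm P * (4 * S * real CARD('n))) * (I y * ennreal (finf y))" for y
  proof (cases "h y > 0")
    case True
    let ?c = "(deriv ^^ 2) psi (h y)"
    have c: "?c \<ge> 0" using adm True unfolding admissible_def by blast
    have each: "ennreal (?c * (grad h y $ j)\<^sup>2) \<le> ennreal (4 * S) * I y" for j
      unfolding I_def by (rule entropy_gradient_bound[OF adm t u0 um int hrep True dh S])
    have "?c * (grad h y \<bullet> (P *v grad h y)) * finf y \<le> ?c * (norm P * (norm (grad h y))\<^sup>2) * finf y"
      using c finf0[of y] quadratic_form_le[of "grad h y" P] by (intro mult_right_mono mult_left_mono) (auto simp: less_imp_le)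
    also have "\<dots> = norm P * ((\<Sum>j\<in>UNIV. ?c * (grad h y $ j)\<^sup>2) * finf y)"
      by (simp add: norm_square_components sum_distrib_left sum_distrib_right mult_ac)
    finally have "ennreal (?c * (grad h y \<bullet> (P *v grad h y)) * finf y)
        \<le> ennreal (norm P * ((\<Sum>j\<in>UNIV. ?c * (grad h y $ j)\<^sup>2) * finf y))" by (rule ennreal_leI)
    also have "\<dots> = ennreal (norm P) * ((\<Sum>j\<in>UNIV. ennreal (?c * (grad h y $ j)\<^sup>2)) * ennreal (finf y))"
    proof -
      have "(\<Sum>j\<in>UNIV. ennreal (?c * (grad h y $ j)\<^sup>2)) = ennreal (\<Sum>j\<in>UNIV. ?c * (grad h y $ j)\<^sup>2)"
        by (rule sum_ennreal) (use c in simp)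
      moreover have "(\<Sum>j\<in>UNIV. ?c * (grad h y $ j)\<^sup>2) \<ge> 0" using c by (intro sum_nonneg) simp
      ultimately show ?thesis using finf0[of y] by (simp only: ennreal_mult norm_ge_zero mult_nonneg_nonneg less_imp_le)
    qed
    also have "\<dots> \<le> ennreal (norm P) * ((\<Sum>j\<in>(UNIV::'n set). ennreal (4 * S) * I y) * ennreal (finf y))"
      by (intro mult_left_mono mult_right_mono sum_mono each) auto
    also have "\<dots> = ennreal (norm P * (4 * S * real CARD('n))) * (I y * ennreal (finf y))"
      using S(1) by (simp add: ennreal_mult ennreal_of_nat_eq_real_of_nat mult_ac)
    finally show ?thesis using True by (simp add: h_def[abs_def])
  next
    case False
    then show ?thesis by (simp add: h_def)
  qed
  have m1: "(\<lambda>p. ennreal (psi (u (snd p)) * k t (fst p) (snd p))) \<in> borel_measurable (lborel \<Otimes>\<^sub>M lborel)"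
  proof -
    have "(\<lambda>x. psi (u x)) \<in> borel_measurable lborel" using admissible_measurable[OF adm um u0] by simp
    then have "(\<lambda>p. psi (u (snd p))) \<in> borel_measurable ((lborel :: (real^'n) measure) \<Otimes>\<^sub>M lborel)"
      by (rule measurable_compose[OF measurable_snd])
    with k_measurable_pair[OF t] show ?thesis by simp
  qed
  have m2: "(\<lambda>p. ennreal (finf (fst p))) \<in> borel_measurable ((lborel :: (real^'n) measure) \<Otimes>\<^sub>M (lborel :: (real^'n) measure))"
    using measurable_compose[OF measurable_fst, of finf lborel] finf_meas by simp
  have I_meas: "(\<lambda>y. I y * ennreal (finf y)) \<in> borel_measurable lborel"
  proof -
    have "I \<in> borel_measurable lborel"
      unfolding I_def[abs_def] using lborel.borel_measurable_nn_integral_fst[OF m1] by simp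
    then show ?thesis using finf_meas by simp
  qed
  have "S_psi psi P finf (f t) \<le> (\<integral>\<^sup>+y. ennreal (norm P * (4 * S * real CARD('n))) * (I y * ennreal (finf y)) \<partial>lborel)"
    unfolding S_psi_def by (intro nn_integral_mono point)
  also have "\<dots> = ennreal (norm P * (4 * S * real CARD('n))) * (\<integral>\<^sup>+y. I y * ennreal (finf y) \<partial>lborel)"
    by (rule nn_integral_cmult[OF I_meas])
  \<comment> \<open>Exchange of the integrals: for fixed x the kernel is integrated over y against
    the equilibrium, which by \<open>k_mass_left\<close> returns the equilibrium at x and leaves the
    initial entropy, without loss.\<close>
  also have "(\<integral>\<^sup>+y. I y * ennreal (finf y) \<partial>lborel) = e_psi psi finf f0"
  proof -
    have "(\<integral>\<^sup>+y. I y * ennreal (finf y) \<partial>lborel) =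
      (\<integral>\<^sup>+y. (\<integral>\<^sup>+x. ennreal (psi (u x) * k t y x) * ennreal (finf y) \<partial>lborel) \<partial>lborel)"
    proof (intro nn_integral_cong)
      fix y
      have "(\<lambda>x. ennreal (psi (u x) * k t y x)) \<in> borel_measurable lborel"
        using measurable_compose_Pair1[OF _ m1, of y] by simp
      then show "I y * ennreal (finf y) = (\<integral>\<^sup>+x. ennreal (psi (u x) * k t y x) * ennreal (finf y) \<partial>lborel)"
        unfolding I_def by (rule nn_integral_multc[symmetric])
    qed
    also have "\<dots> = (\<integral>\<^sup>+x. (\<integral>\<^sup>+y. ennreal (psi (u x) * k t y x) * ennreal (finf y) \<partial>lborel) \<partial>lborel)"
    proof -
      have "(\<lambda>(y, x). ennreal (psi (u x) * k t y x) * ennreal (finf y)) \<in> borel_measurable (lborel \<Otimes>\<^sub>M lborel)"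
        unfolding split_beta by (rule borel_measurable_times_ennreal[OF m1 m2])
      from lborel_pair.Fubini'[OF this] show ?thesis by simp
    qed
    also have "\<dots> = e_psi psi finf f0"
      unfolding e_psi_def
    proof (intro nn_integral_cong)
      fix x
      have "ennreal (psi (u x) * k t y x) * ennreal (finf y) = ennreal (psi (u x) * c0) * ennreal (g y * k t y x)" for y
        using psi0[of x] k_pos[OF t, of y x] finf(1) g_pos[of y]
        by (simp add: finf(2) ennreal_mult[symmetric] less_imp_le mult_ac)
      then have "(\<integral>\<^sup>+y. ennreal (psi (u x) * k t y x) * ennreal (finf y) \<partial>lborel)
        = (\<integral>\<^sup>+y. ennreal (psi (u x) * c0) * ennreal (g y * k t y x) \<partial>lborel)" by simp
      also have "\<dots> = ennreal (psi (u x) * c0) * (\<integral>\<^sup>+y. ennreal (g y * k t y x) \<partial>lborel)"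
      proof (rule nn_integral_cmult)
        have "continuous_on UNIV (\<lambda>y. g y * k t y x)"
          by (intro continuous_intros continuous_on_g continuous_on_k t)
        from borel_measurable_continuous_onI[OF this]
        show "(\<lambda>y. ennreal (g y * k t y x)) \<in> borel_measurable lborel" by simp
      qed
      also have "\<dots> = ennreal (psi (u x) * c0) * ennreal (g x)" by (simp only: k_mass_left[OF t])
      also have "\<dots> = ennreal (psi (f0 x / finf x) * finf x)"
        using psi0[of x] finf(1) g_pos[of x] by (simp add: ennreal_mult[symmetric] less_imp_le finf(2) u_def mult_ac)
      finally show "(\<integral>\<^sup>+y. ennreal (psi (u x) * k t y x) * ennreal (finf y) \<partial>lborel) = ennreal (psi (f0 x / finf x) * finf x)" .
    qed
    finally show ?thesis .
  qed
  finally show ?thesis .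
qed

end

text \<open>Condition (A)(a) says that the kernels of \<open>v \<mapsto> (D (C\<^sup>T)\<^sup>j v)\<^bsub>j \<le> n\<^esub>\<close> have trivial intersection;
  compactness of the sphere makes a finite stage trivial.\<close>

lemma hypoelliptic_index_exists:
  fixes C D :: "real^'n^'n"
  assumes A: "condA D C" and D: "\<And>w. (norm (D *v w))\<^sup>2 = w \<bullet> (D *v w)"
  shows "\<exists>kappa>0. \<forall>v. kappa * (norm v)\<^sup>2 \<le> (\<Sum>j<Suc (hc_index C D). (norm (D *v (matpow (transpose C) j *v v)))\<^sup>2)"
proof -
  let ?T = "transpose C"
  let ?N = "\<lambda>n v. \<Sum>j<Suc n. (norm (D *v (matpow ?T j *v v)))\<^sup>2"
  let ?A = "\<lambda>n. \<Sum>j\<le>n. matpow C j ** D ** matpow ?T j"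
  have form: "v \<bullet> (?A n *v v) = ?N n v" for n v
  proof -
    have "?A n *v v = (\<Sum>j\<le>n. (matpow C j ** D ** matpow ?T j) *v v)"
      by (rule bounded_bilinear.sum_left[OF bounded_bilinear_matrix_vector])
    then have "v \<bullet> (?A n *v v) = (\<Sum>j\<le>n. v \<bullet> ((matpow C j ** D ** matpow ?T j) *v v))"
      by (simp add: inner_sum_right)
    also have "\<dots> = (\<Sum>j\<le>n. (norm (D *v (matpow ?T j *v v)))\<^sup>2)"
    proof (intro sum.cong refl)
      fix j
      have "v \<bullet> ((matpow C j ** D ** matpow ?T j) *v v) = v \<bullet> (matpow C j *v (D *v (matpow ?T j *v v)))"
        by (simp only: matrix_vector_mul_assoc matrix_mul_assoc)
      also have "\<dots> = (matpow ?T j *v v) \<bullet> (D *v (matpow ?T j *v v))"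
        by (simp only: inner_matrix_right[of v "matpow C j"] transpose_matpow)
      finally show "v \<bullet> ((matpow C j ** D ** matpow ?T j) *v v) = (norm (D *v (matpow ?T j *v v)))\<^sup>2"
        by (simp only: D)
    qed
    finally show ?thesis by (simp only: lessThan_Suc_atMost)
  qed
  have loewner: "loewner_ge (?A n) (kappa *\<^sub>R mat 1) \<longleftrightarrow> (\<forall>v. kappa * (norm v)\<^sup>2 \<le> ?N n v)" for n kappa
  proof -
    have "v \<bullet> ((?A n - kappa *\<^sub>R mat 1) *v v) = ?N n v - kappa * (norm v)\<^sup>2" for v
      by (simp only: matrix_vector_mult_diff_rdistrib inner_diff_right form
          bounded_bilinear.scaleR_left[OF bounded_bilinear_matrix_vector] matrix_vector_mul_lid
          inner_scaleR_right power2_norm_eq_inner)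
    then show ?thesis by (simp only: loewner_ge_def diff_ge_0_iff_ge)
  qed
  \<comment> \<open>Unit vectors annihilated up to stage n, a decreasing sequence of compact sets. A
    point common to all of them would lie in \<open>V\<close>, an invariant subspace inside the
    kernel of D.\<close>
  define S where "S n = {v \<in> sphere (0::real^'n) 1. ?N n v = 0}" for n
  have "\<exists>n. S n = {}"
  proof (rule ccontr)
    assume "\<nexists>n. S n = {}"
    then have ne: "S n \<noteq> {}" for n by blast
    have comp: "compact (S n)" for n
    proof -
      have "closed {v. ?N n v = 0}"
        by (intro closed_Collect_eq continuous_intros)
      then have "compact (sphere (0::real^'n) 1 \<inter> {v. ?N n v = 0})" by (intro compact_Int_closed) auto
      moreover have "S n = sphere 0 1 \<inter> {v. ?N n v = 0}" unfolding S_def by blast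
      ultimately show ?thesis by (simp only:)
    qed
    have zero: "?N n v = 0 \<longleftrightarrow> (\<forall>j<Suc n. D *v (matpow ?T j *v v) = 0)" for n v
      by (subst sum_nonneg_eq_0_iff) auto
    have decr: "S n \<subseteq> S m" if "m \<le> n" for m n
      using that unfolding S_def zero by auto
    have "(\<Inter>n. S n) \<noteq> {}"
      using compact_nest[of S] comp ne decr by blast
    then obtain v where v: "\<And>n. v \<in> S n" by blast
    define V where "V = {v. \<forall>j. D *v (matpow ?T j *v v) = 0}"
    have "subspace V"
      unfolding subspace_def V_def by (simp add: matrix_vector_right_distrib matrix_vector_mult_scaleR)
    moreover have "V \<subseteq> {x. D *v x = 0}"
    proof
      fix x assume "x \<in> V"
      then have "D *v (matpow ?T 0 *v x) = 0" unfolding V_def by blast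
      then show "x \<in> {x. D *v x = 0}" by simp
    qed
    moreover have "(\<lambda>x. ?T *v x) ` V \<subseteq> V"
    proof (rule image_subsetI)
      fix x assume x: "x \<in> V"
      have "D *v (matpow ?T j *v (?T *v x)) = 0" for j
      proof -
        have "matpow ?T j *v (?T *v x) = matpow ?T (Suc j) *v x"
          by (simp only: matpow_Suc_right matrix_vector_mul_assoc)
        then show ?thesis using x unfolding V_def by (simp only: mem_Collect_eq)
      qed
      then show "?T *v x \<in> V" unfolding V_def by blast
    qed
    ultimately have "V = {0}" using A unfolding condA_def by blast
    moreover have "v \<in> V"
      unfolding V_def
    proof (intro CollectI allI)
      fix j
      have "?N j v = 0" using v[of j] by (simp add: S_def)
      then show "D *v (matpow ?T j *v v) = 0" unfolding zero by blast
    qed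
    moreover have "norm v = 1" using v[of 0] by (simp add: S_def)
    ultimately show False by auto
  qed
  then obtain n where n: "S n = {}" by blast
  have "v \<bullet> (?A n *v v) > 0" if "v \<noteq> 0" for v
  proof (rule ccontr)
    assume "\<not> v \<bullet> (?A n *v v) > 0"
    moreover have "?N n v \<ge> 0" by (intro sum_nonneg) auto
    ultimately have "?N n v = 0" unfolding form by linarith
    moreover have "?N n ((1 / norm v) *\<^sub>R v) = (1 / norm v)\<^sup>2 * ?N n v"
      by (simp only: matrix_vector_mult_scaleR norm_scaleR power_mult_distrib sum_distrib_left power2_abs)
    ultimately have "(1 / norm v) *\<^sub>R v \<in> S n" using that by (simp add: S_def)
    then show False using n by blast
  qed
  then obtain kappa where "kappa > 0" "\<And>v. kappa * (norm v)\<^sup>2 \<le> v \<bullet> (?A n *v v)"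
    using quadratic_form_coercive[of "?A n"] by blast
  then have "\<exists>kappa>0. loewner_ge (?A n) (kappa *\<^sub>R mat 1)" unfolding loewner form by blast
  \<comment> \<open>\<open>hc_index\<close> is a least number; it has its defining property because
    some stage n has been found.\<close>
  then have "\<exists>kappa>0. loewner_ge (?A (hc_index C D)) (kappa *\<^sub>R mat 1)"
    unfolding hc_index_def by (rule LeastI)
  then show ?thesis unfolding loewner .
qed

theorem theorem4p8:
  fixes C K P :: "real^('n::{finite,linorder})^('n::{finite,linorder})"
    and k :: nat and eps :: real
    and psi :: "real \<Rightarrow> real"
    and f0 :: "real^('n::{finite,linorder}) \<Rightarrow> real"
    and f :: "real \<Rightarrow> real^('n::{finite,linorder}) \<Rightarrow> real"
  assumes d_ge2: "CARD('n) \<ge> 2"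
    and k_range: "1 \<le> k" "k < CARD('n)"
    and A: "condA (diagD k) C"
    and K_spd: "sym_pos_def K"
    and K_eq: "2 *\<^sub>R diagD k = C ** K + K ** transpose C"
    and psi_adm: "admissible psi"
    and f0_int: "integrable lborel f0"
    and f0_nonneg: "\<forall>x. f0 x \<ge> 0"
    and f0_mass: "(\<integral>x. f0 x \<partial>lborel) = 1"
    and f0_entropy: "e_psi psi (f_inf K) f0 < \<infinity>"
    and f_sol: "FP_solution (diagD k) C f0 f"
    and P_spd: "sym_pos_def P"
    and eps_range: "0 \<le> eps" "eps < mu_spec C"
    and P_ineq: "loewner_ge (Qmat K C ** P + P ** transpose (Qmat K C))
                            ((2 * (mu_spec C - eps)) *\<^sub>R P)"
  shows "\<exists>c_r>0. \<forall>t\<in>{0<..1}.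
           S_psi psi P (f_inf K) (f t)
             \<le> ennreal (c_r * t powr (- real (2 * hc_index C (diagD k) + 1))) * e_psi psi (f_inf K) f0"
proof -
  define d where "d i = (if card {j'. j' < i} < k then 1 else 0 :: real)" for i :: 'n
  let ?D = "diagD k :: real^('n::{finite,linorder})^('n::{finite,linorder})"
  let ?tau = "hc_index C ?D"
  have D_diag: "?D $ i $ j = (if i = j then d i else 0)" for i j by (simp add: diagD_def d_def)
  have D_comp: "(?D *v w) $ i = d i * w $ i" for w i
    by (simp add: matrix_vector_mult_def D_diag if_distrib if_distribR cong: if_cong)
  have D_norm: "(norm (?D *v w))\<^sup>2 = w \<bullet> (?D *v w)" for w
    unfolding power2_norm_eq_inner by (simp add: inner_vec_def D_comp) (intro sum.cong refl, simp add: d_def)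
  obtain kappa where kappa: "kappa > 0" "\<And>v. kappa * (norm v)\<^sup>2 \<le>
      (\<Sum>j<Suc ?tau. (norm (?D *v (matpow (transpose C) j *v v)))\<^sup>2)"
    using hypoelliptic_index_exists[OF A D_norm] by blast
  interpret fokker_planck C K ?D d ?tau kappa
    by unfold_locales (use D_diag K_spd K_eq kappa in \<open>auto simp: d_def\<close>)
  have classical: "classical f"
    unfolding classical_def classical_data_def
    using f_sol unfolding FP_solution_def by (elim conjE) (intro conjI; (assumption | fastforce))
  have L1: "((\<lambda>t. \<integral>x. \<bar>f t x - f0 x\<bar> \<partial>lborel) \<longlongrightarrow> 0) (at_right 0)"
    using f_sol unfolding FP_solution_def by blast
  define c0 where "c0 = (2*pi) powr (- real CARD('n) / 2) * (det K) powr (-1/2)"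
  \<comment> \<open>A real power \<open>x powr a\<close> is positive as soon as x is nonzero, so
    invertibility of K settles the sign of the normalising constant.\<close>
  have "det K \<noteq> 0"
    using spd_inverse(1,2)[OF K_spd] unfolding invertible_det_nz[symmetric] invertible_def by blast
  then have c0: "c0 > 0" by (simp add: c0_def)
  have finf: "f_inf K x = c0 * g x" for x by (simp add: f_inf_def c0_def g_def Kinv_def)
  obtain c where c: "c > 0" "\<And>r v. 0 < r \<Longrightarrow> r \<le> 1 \<Longrightarrow> v \<bullet> (R r *v v) \<le> (norm v)\<^sup>2 / (c * r ^ (2 * ?tau + 1))"
    using R_upper by blast
  \<comment> \<open>4 is the constant of the local inequality, 1 / c bounds R up to the power of t,
    and CARD counts the coordinate directions. Adding 1 to \<open>norm P\<close> makes positivity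
    immediate.\<close>
  define c_r where "c_r = (1 + norm P) * (4 * (1 / c) * real CARD('n))"
  show ?thesis
  proof (intro exI[of _ c_r] conjI ballI)
    show "c_r > 0" using c(1) by (simp add: c_r_def add_pos_nonneg)
    fix t :: real assume "t \<in> {0<..1}"
    then have t: "0 < t" "t \<le> 1" by auto
    define S where "S = 1 / (c * t ^ (2 * ?tau + 1))"
    have S: "S > 0" "\<And>j. axis j 1 \<bullet> (R t *v axis j 1) \<le> S"
      using c(1) c(2)[OF t, of "axis _ 1"] t by (auto simp: S_def)
    have "S_psi psi P (f_inf K) (f t) \<le> ennreal (norm P * (4 * S * real CARD('n))) * e_psi psi (f_inf K) f0"
      by (rule entropy_production_bound[OF psi_adm classical f0_int _ L1 c0 finf t(1) S]) (use f0_nonneg in auto)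
    also have "\<dots> \<le> ennreal (c_r * t powr (- real (2 * ?tau + 1))) * e_psi psi (f_inf K) f0"
    proof (intro mult_right_mono ennreal_leI)
      have "t powr (- real (2 * ?tau + 1)) = 1 / t ^ (2 * ?tau + 1)"
        using t(1) by (simp only: powr_minus powr_realpow divide_inverse mult_1)
      then have "c_r * t powr (- real (2 * ?tau + 1)) = (1 + norm P) * (4 * S * real CARD('n))"
        by (simp add: c_r_def S_def)
      moreover have "norm P * (4 * S * real CARD('n)) \<le> (1 + norm P) * (4 * S * real CARD('n))"
        using S(1) by (intro mult_right_mono) auto
      ultimately show "norm P * (4 * S * real CARD('n)) \<le> c_r * t powr (- real (2 * ?tau + 1))" by simp
    qed simp
    finally show "S_psi psi P (f_inf K) (f t)
             \<le> ennreal (c_r * t powr (- real (2 * ?tau + 1))) * e_psi psi (f_inf K) f0" .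
  qed
qed

end
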